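(* Let $G$ be a Lie group with Lie algebra $\mathfrak g$, let $V$ be a finite-dimensional smooth representation of $G$, and let $K\subseteq G$ be a compact Lie subgroup. Let $\mathrm{VE}_{G/K}=\mathsf p\circ(1+\mathsf d\mathsf h)^{-1}\circ\mathsf j\colon \mathsf C^\bullet(G,V)\to \mathsf C^\bullet(\mathfrak g,V)_{K\text{-basic}}$ be the van Est differentiation map defined in the context (on degree $p$ elements it equals $(-1)^p\,\mathsf p\circ(\mathsf d\mathsf h)^p\circ \mathsf j$). Then for all $p\ge 0$ and all $f\in C^\infty(G^p,V)=\mathsf C^p(G,V)$, $$\mathrm{VE}_{G/K}(f)=\big(\mathsf d^{(1)}\cdots \mathsf d^{(p)}\,\mathrm{Av}(f)\big)\Big|_{(e,\ldots,e)}\in V\otimes\wedge^p\mathfrak g^*,$$ where $\mathrm{Av}$ is the $K^{p+1}$-averaging operator and $\mathsf d^{(i)}$ are the Chevalley-Eilenberg differentials defined in the context. In particular, $\mathrm{VE}_{G/K}=\mathrm{VE}_G\circ \mathrm{Av}$, where $\mathrm{VE}_G$ denotes the map $\mathrm{VE}_{G/K}$ for $K=\{e\}$.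
   Context: Lie group complex: $\mathsf C^p(G,V)=C^\infty(G^p,V)$ with $(\delta f)(g_1,\ldots,g_{p+1})=f(g_2,\ldots,g_{p+1})+\sum_{i=1}^p(-1)^i f(g_1,\ldots,g_ig_{i+1},\ldots,g_{p+1})+(-1)^{p+1}g_{p+1}^{-1}\cdot f(g_1,\ldots,g_p)$. Lie algebra complex: $\mathsf C^q(\mathfrak g,V)=V\otimes\wedge^q\mathfrak g^*$ with the Chevalley-Eilenberg differential $\mathsf d_{CE}$. The subcomplex $\mathsf C(\mathfrak g,V)_{K\text{-basic}}$ consists of the $K$-invariant elements (given action on $V$, coadjoint action on $\wedge\mathfrak g^*$) annihilated by contractions with elements of $\mathfrak k=\mathrm{Lie}(K)$. Double complex: $\mathsf D^{p,q}(G,V)=C^\infty(G^p\times G,V\otimes\wedge^q\mathfrak g^* )$, elements written $\psi(g_1,\ldots,g_p;g)$. Horizontal differential: $(\delta\psi)(g_1,\ldots,g_{p+1};g)=\psi(g_2,\ldots,g_{p+1};g)+\sum_{i=1}^p(-1)^i\psi(g_1,\ldots,g_ig_{i+1},\ldots,g_{p+1};g)+(-1)^{p+1}\psi(g_1,\ldots,g_p;g_{p+1}g)$. Vertical differential: $\mathsf d=(-1)^p\mathsf d_{CE}$, where $\mathsf d_{CE}$ is the Chevalley-Eilenberg differential for the $\mathfrak g$-representation on $C^\infty(G^p\times G)\otimes V$ given by the left-invariant vector fields $\xi^L$ on the last factor $G$ together with the representation on $V$. $\mathsf D(G,V)_{K\text{-basic}}$ consists of the $\psi$ annihilated by contractions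 with $\mathfrak k$ and invariant under $K$ for the action $(a\cdot\psi)(g_1,\ldots,g_p;g)=a\cdot\psi(g_1,\ldots,g_p;ga)$ (with coadjoint action on $\wedge\mathfrak g^*$). Maps: $(\mathsf jf)(g_1,\ldots,g_p;g)=g^{-1}\cdot f(g_1,\ldots,g_p)$, $\mathsf j\colon \mathsf C^p(G,V)\to\mathsf D^{p,0}(G,V)_{K\text{-basic}}$. With $dk$ the normalized Haar measure on $K$, for $\psi\in \mathsf D^{p,q}(G,V)_{K\text{-basic}}$ put $(\mathsf h\psi)(g_1,\ldots,g_{p-1};g)=(-1)^p\int_K\psi(g_1,\ldots,g_{p-1},gk^{-1};k)\,dk$ if $p>0$, and $\mathsf h\psi=0$ if $p=0$. The map $\mathsf p$ is zero on $\mathsf D^{p,q}$ for $p>0$, and $\mathsf p(\psi)=\int_K\psi(k)\,dk\in \mathsf C^q(\mathfrak g,V)_{K\text{-basic}}$ for $\psi\in\mathsf D^{0,q}(G,V)_{K\text{-basic}}$. Averaging: on $C^\infty(G^p,V)$ there are $p+1$ commuting $G$-actions, labeled $i=0,\ldots,p$: $(a\cdot f)(g_1,\ldots,g_p)=f(a^{-1}g_1,g_2,\ldots,g_p)$ for $i=0<p$; $=f(g_1,\ldots,g_ia,a^{-1}g_{i+1},\ldots,g_p)$ for $0<i<p$; $=a\cdot f(g_1,\ldots,g_pa)$ for $i=p$ (for $p=0$ the single action is $f\mapsto a\cdot f$). Let $\mathrm{Av}^{(i)}$ be the average over $K$ with respect to the $i$-th action and $\mathrm{Av}=\mathrm{Av}^{(0)}\circ\cdots\circ\mathrm{Av}^{(p)}$.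 Differentials $\mathsf d^{(i)}$, $1\le i\le p$: the Chevalley-Eilenberg differential on $C^\infty(G^p,V)\otimes\wedge\mathfrak g^*$ for the $\mathfrak g$-representation on $C^\infty(G^p,V)$ obtained by differentiating the $G$-action $(a\cdot f)(g_1,\ldots,g_p)=a\cdot f(g_1,\ldots,g_{i-1},g_ia,a^{-1}g_{i+1}a,\ldots,a^{-1}g_pa)$. *)

theory Defs
  imports "HOL-Probability.Probability" "HOL-Algebra.Coset"
begin

text \<open>
  Points of an n-fold power \<open>X\<^sup>n\<close> are functions of type \<^typ>\<open>nat \<Rightarrow> 'x\<close> of which only the entries
  \<open>1, ..., n\<close> matter; a function on \<open>X\<^sup>n\<close> is a function on \<^typ>\<open>nat \<Rightarrow> 'x\<close> that
  depends only on these entries. Indices start at 1.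

  Finite-dimensional vector spaces are normed types with a finite spanning set. Unlike the class
  \<open>euclidean_space\<close> this includes dimension 0, so discrete groups and \<open>V = 0\<close> are covered.
\<close>

definition finite_dim :: "'a::real_vector set \<Rightarrow> bool" where
  "finite_dim S \<longleftrightarrow> (\<exists>B. finite B \<and> span B = S)"

definition depends_upto :: "nat \<Rightarrow> ((nat \<Rightarrow> 'x) \<Rightarrow> 'y) \<Rightarrow> bool" where
  "depends_upto n f \<longleftrightarrow> (\<forall>g h. (\<forall>i\<in>{1..n}. g i = h i) \<longrightarrow> f g = f h)"


section \<open>Smooth functions, manifolds, Lie groups\<close>

definition partial_deriv ::
    "nat \<Rightarrow> 'e::real_normed_vector \<Rightarrow> ((nat \<Rightarrow> 'e) \<Rightarrow> 'b::real_normed_vector) \<Rightarrow> (nat \<Rightarrow> 'e) \<Rightarrow> 'b" where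
  "partial_deriv i v F x = vector_derivative (\<lambda>t. F (x(i := x i + t *\<^sub>R v))) (at 0)"

text \<open>
  \<open>C\<^sup>k\<close> functions on an open subset of \<open>E\<^sup>n\<close>: all iterated partial derivatives up to order \<open>k\<close> exist and
  are continuous. The directions \<open>v\<close> range over all of \<open>E\<close>. The topology on \<^typ>\<open>nat \<Rightarrow> 'e\<close> is the
  product topology; on functions of the first \<open>n\<close> entries continuity is continuity on \<open>E\<^sup>n\<close>.
\<close>

primrec C_k :: "nat \<Rightarrow> nat \<Rightarrow> (nat \<Rightarrow> 'e::real_normed_vector) set
    \<Rightarrow> ((nat \<Rightarrow> 'e) \<Rightarrow> 'b::real_normed_vector) \<Rightarrow> bool" where
  "C_k 0 n S F \<longleftrightarrow> continuous_on S F"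
| "C_k (Suc k) n S F \<longleftrightarrow> continuous_on S F \<and>
     (\<forall>i\<in>{1..n}. \<forall>v. (\<forall>x\<in>S. (\<lambda>t::real. F (x(i := x i + t *\<^sub>R v))) differentiable (at 0))
        \<and> C_k k n S (partial_deriv i v F))"

definition C_infinity :: "nat \<Rightarrow> (nat \<Rightarrow> 'e::real_normed_vector) set
    \<Rightarrow> ((nat \<Rightarrow> 'e) \<Rightarrow> 'b::real_normed_vector) \<Rightarrow> bool" where
  "C_infinity n S F \<longleftrightarrow> (\<forall>k. C_k k n S F)"

type_synonym ('g, 'e) chart = "'g set \<times> ('g \<Rightarrow> 'e)"

abbreviation chart_image :: "('g, 'e) chart \<Rightarrow> 'e set" where
  "chart_image c \<equiv> snd c ` fst c"

abbreviation chart_inv :: "('g, 'e) chart \<Rightarrow> 'e \<Rightarrow> 'g" where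
  "chart_inv c \<equiv> inv_into (fst c) (snd c)"

definition is_chart :: "('g::topological_space, 'e::real_normed_vector) chart \<Rightarrow> bool" where
  "is_chart c \<longleftrightarrow> open (fst c) \<and> open (chart_image c)
     \<and> homeomorphism (fst c) (chart_image c) (snd c) (chart_inv c)"

definition smooth_transition ::
    "('g::topological_space, 'e::real_normed_vector) chart \<Rightarrow> ('g, 'e) chart \<Rightarrow> bool" where
  "smooth_transition c d \<longleftrightarrow>
     C_infinity 1 {x. x 1 \<in> snd c ` (fst c \<inter> fst d)} (\<lambda>x. snd d (chart_inv c (x 1)))"

definition smooth_atlas :: "('g::topological_space, 'e::real_normed_vector) chart set \<Rightarrow> bool" where
  "smooth_atlas A \<longleftrightarrow> (\<forall>c\<in>A. is_chart c) \<and> (\<Union>c\<in>A. fst c) = UNIV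
     \<and> (\<forall>c\<in>A. \<forall>d\<in>A. smooth_transition c d)"

text \<open>
  \<open>ident_chart\<close> is an arbitrary chart around the neutral element. Through it the tangent space at the
  neutral element, i.e. the Lie algebra as a vector space, is identified with the model space \<^typ>\<open>'e\<close>.
\<close>

record ('g, 'e) charted_group = "'g monoid" +
  atlas :: "('g, 'e) chart set"
  ident_chart :: "('g, 'e) chart"

definition smooth_fun :: "('g::topological_space, 'e::real_normed_vector) charted_group \<Rightarrow> nat
    \<Rightarrow> ((nat \<Rightarrow> 'g) \<Rightarrow> 'v::real_normed_vector) \<Rightarrow> bool" where
  "smooth_fun G n f \<longleftrightarrow> (\<forall>c. (\<forall>i\<in>{1..n}. c i \<in> atlas G) \<longrightarrow>
     C_infinity n {x. \<forall>i\<in>{1..n}. x i \<in> chart_image (c i)} (\<lambda>x. f (\<lambda>i. chart_inv (c i) (x i))))"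

definition smooth_map :: "('g::topological_space, 'e::real_normed_vector) charted_group \<Rightarrow> nat
    \<Rightarrow> ((nat \<Rightarrow> 'g) \<Rightarrow> 'g) \<Rightarrow> bool" where
  "smooth_map G n F \<longleftrightarrow> continuous_on UNIV F \<and>
     (\<forall>c. \<forall>d\<in>atlas G. (\<forall>i\<in>{1..n}. c i \<in> atlas G) \<longrightarrow>
       C_infinity n
         {x. (\<forall>i\<in>{1..n}. x i \<in> chart_image (c i)) \<and> F (\<lambda>i. chart_inv (c i) (x i)) \<in> fst d}
         (\<lambda>x. snd d (F (\<lambda>i. chart_inv (c i) (x i)))))"

definition lie_group ::
    "('g::{t2_space, second_countable_topology}, 'e::real_normed_vector) charted_group \<Rightarrow> bool" where
  "lie_group G \<longleftrightarrow> group G \<and> carrier G = UNIV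
     \<and> finite_dim (UNIV :: 'e set) \<and> smooth_atlas (atlas G)
     \<and> smooth_map G 2 (\<lambda>g. g 1 \<otimes>\<^bsub>G\<^esub> g 2) \<and> smooth_map G 1 (\<lambda>g. inv\<^bsub>G\<^esub> (g 1))
     \<and> ident_chart G \<in> atlas G \<and> \<one>\<^bsub>G\<^esub> \<in> fst (ident_chart G)"

text \<open>
  Lie subgroups are embedded submanifolds, given by slice charts of the maximal atlas. (A compact
  immersed Lie subgroup is automatically embedded.)
\<close>

definition lie_subgroup ::
    "'g set \<Rightarrow> ('g::topological_space, 'e::real_normed_vector) charted_group \<Rightarrow> bool" where
  "lie_subgroup K G \<longleftrightarrow> subgroup K G \<and>
     (\<forall>k\<in>K. \<exists>c W. is_chart c \<and> (\<forall>d\<in>atlas G. smooth_transition c d \<and> smooth_transition d c)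
        \<and> k \<in> fst c \<and> subspace W \<and> snd c ` (fst c \<inter> K) = chart_image c \<inter> W)"

definition smooth_rep :: "('g::topological_space, 'e::real_normed_vector) charted_group
    \<Rightarrow> ('g \<Rightarrow> 'v::real_normed_vector \<Rightarrow> 'v) \<Rightarrow> bool" where
  "smooth_rep G \<rho> \<longleftrightarrow> finite_dim (UNIV :: 'v set) \<and> (\<forall>g. linear (\<rho> g))
     \<and> \<rho> \<one>\<^bsub>G\<^esub> = id \<and> (\<forall>g h. \<rho> (g \<otimes>\<^bsub>G\<^esub> h) = \<rho> g \<circ> \<rho> h)
     \<and> (\<forall>v. smooth_fun G 1 (\<lambda>g. \<rho> (g 1) v))"

text \<open>Left invariance characterises normalized Haar measure; on a compact group it is bi-invariant.\<close>

definition normalized_haar ::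
    "('g::topological_space, 'e) charted_group \<Rightarrow> 'g set \<Rightarrow> 'g measure \<Rightarrow> bool" where
  "normalized_haar G K \<mu> \<longleftrightarrow> prob_space \<mu> \<and> space \<mu> = K \<and> sets \<mu> = sets (restrict_space borel K)
     \<and> (\<forall>a\<in>K. \<forall>A\<in>sets \<mu>. emeasure \<mu> (a <#\<^bsub>G\<^esub> A) = emeasure \<mu> A)"


section \<open>The Lie algebra\<close>

text \<open>
  \<open>exp_chart G \<xi>\<close> is the point with coordinates \<open>\<xi>\<close> in the identity chart recentred at \<open>e\<close>. The curve
  \<open>t \<mapsto> exp_chart G (t \<xi>)\<close> has velocity \<open>\<xi>\<close> at \<open>t = 0\<close>, so it computes derivatives at \<open>e\<close> along \<open>\<xi>\<close>; it
  need not be a one-parameter subgroup.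
\<close>

definition exp_chart :: "('g, 'e::real_normed_vector) charted_group \<Rightarrow> 'e \<Rightarrow> 'g" where
  "exp_chart G \<xi> = chart_inv (ident_chart G) (snd (ident_chart G) \<one>\<^bsub>G\<^esub> + \<xi>)"

definition left_deriv :: "('g, 'e::real_normed_vector) charted_group \<Rightarrow> 'e
    \<Rightarrow> ('g \<Rightarrow> 'v::real_normed_vector) \<Rightarrow> 'g \<Rightarrow> 'v" where
  "left_deriv G \<xi> f g = vector_derivative (\<lambda>t. f (g \<otimes>\<^bsub>G\<^esub> exp_chart G (t *\<^sub>R \<xi>))) (at 0)"

text \<open>
  \<open>left_field G \<xi> y\<close>: the left-invariant vector field \<open>\<xi>\<^sup>L\<close> written in the recentred identity chart, at
  the coordinate \<open>y\<close>. The bracket is the value at \<open>e\<close> of \<open>[\<xi>\<^sup>L, \<eta>\<^sup>L]\<close>, where vector fields act as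
  derivations; in coordinates \<open>[X, Y] = DY X - DX Y\<close>.
\<close>

definition left_field :: "('g, 'e::real_normed_vector) charted_group \<Rightarrow> 'e \<Rightarrow> 'e \<Rightarrow> 'e" where
  "left_field G \<xi> y = left_deriv G \<xi> (snd (ident_chart G)) (exp_chart G y)"

definition lie_bracket :: "('g, 'e::real_normed_vector) charted_group \<Rightarrow> 'e \<Rightarrow> 'e \<Rightarrow> 'e" where
  "lie_bracket G \<xi> \<eta> = vector_derivative (\<lambda>s. left_field G \<eta> (s *\<^sub>R \<xi>)) (at 0)
                      - vector_derivative (\<lambda>s. left_field G \<xi> (s *\<^sub>R \<eta>)) (at 0)"

definition Ad :: "('g, 'e::real_normed_vector) charted_group \<Rightarrow> 'g \<Rightarrow> 'e \<Rightarrow> 'e" where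
  "Ad G a \<xi> = vector_derivative
     (\<lambda>t. snd (ident_chart G) (a \<otimes>\<^bsub>G\<^esub> exp_chart G (t *\<^sub>R \<xi>) \<otimes>\<^bsub>G\<^esub> inv\<^bsub>G\<^esub> a)) (at 0)"

text \<open>The tangent space of a Lie subgroup at \<open>e\<close>, as the set of velocities of curves in it.\<close>

definition lie_subalgebra ::
    "('g::topological_space, 'e::real_normed_vector) charted_group \<Rightarrow> 'g set \<Rightarrow> 'e set" where
  "lie_subalgebra G K = {\<xi>. \<exists>\<gamma>::real \<Rightarrow> 'g. range \<gamma> \<subseteq> K \<and> \<gamma> 0 = \<one>\<^bsub>G\<^esub> \<and> isCont \<gamma> 0
     \<and> ((\<lambda>t. snd (ident_chart G) (\<gamma> t)) has_vector_derivative \<xi>) (at 0)}"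

definition rep_deriv :: "('g, 'e::real_normed_vector) charted_group
    \<Rightarrow> ('g \<Rightarrow> 'v::real_normed_vector \<Rightarrow> 'v) \<Rightarrow> 'e \<Rightarrow> 'v \<Rightarrow> 'v" where
  "rep_deriv G \<rho> \<xi> v = vector_derivative (\<lambda>t. \<rho> (exp_chart G (t *\<^sub>R \<xi>)) v) (at 0)"


section \<open>Forms and the Chevalley-Eilenberg differential\<close>

text \<open>
  \<open>V \<otimes> \<Lambda>\<^sup>q \<gg>\<^sup>*\<close> is the space of alternating multilinear maps \<open>\<gg>\<^sup>q \<rightarrow> V\<close>, evaluated on \<open>\<xi> 1, ..., \<xi> q\<close>.
\<close>

type_synonym ('e, 'v) form = "(nat \<Rightarrow> 'e) \<Rightarrow> 'v"

definition alt_forms :: "nat \<Rightarrow> ('e::real_vector, 'v::real_vector) form set" where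
  "alt_forms q = {\<omega>. depends_upto q \<omega>
     \<and> (\<forall>i\<in>{1..q}. \<forall>\<xi>. linear (\<lambda>v. \<omega> (\<xi>(i := v))))
     \<and> (\<forall>\<xi>. \<forall>i\<in>{1..q}. \<forall>j\<in>{1..q}. i \<noteq> j \<and> \<xi> i = \<xi> j \<longrightarrow> \<omega> \<xi> = 0)}"

definition omit :: "nat \<Rightarrow> (nat \<Rightarrow> 'e) \<Rightarrow> nat \<Rightarrow> 'e" where
  "omit i \<xi> = (\<lambda>k. if k < i then \<xi> k else \<xi> (k + 1))"

definition prepend :: "'e \<Rightarrow> (nat \<Rightarrow> 'e) \<Rightarrow> nat \<Rightarrow> 'e" where
  "prepend \<eta> \<xi> = (\<lambda>k. if k \<le> 1 then \<eta> else \<xi> (k - 1))"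

text \<open>
  \<open>CE G act q\<close>: the differential on q-forms with values in a \<open>\<gg>\<close>-module of functions \<open>X \<rightarrow> V\<close>, on which
  \<open>\<xi> \<in> \<gg>\<close> acts by \<open>act \<xi>\<close>. Such a form is written as a function of the point of \<open>X\<close> and the arguments.
\<close>

definition CE :: "('g, 'e::real_normed_vector) charted_group \<Rightarrow> ('e \<Rightarrow> ('x \<Rightarrow> 'v) \<Rightarrow> 'x \<Rightarrow> 'v)
    \<Rightarrow> nat \<Rightarrow> ('x \<Rightarrow> ('e, 'v::real_normed_vector) form) \<Rightarrow> 'x \<Rightarrow> ('e, 'v) form" where
  "CE G act q \<omega> x \<xi> =
     (\<Sum>i=1..q+1. (-1) ^ (i + 1) *\<^sub>R act (\<xi> i) (\<lambda>y. \<omega> y (omit i \<xi>)) x)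
     + (\<Sum>j=1..q+1. \<Sum>i=1..<j. (-1) ^ (i + j) *\<^sub>R
          \<omega> x (prepend (lie_bracket G (\<xi> i) (\<xi> j)) (omit i (omit j \<xi>))))"

definition basic_forms :: "('g::topological_space, 'e::real_normed_vector) charted_group
    \<Rightarrow> ('g \<Rightarrow> 'v::real_normed_vector \<Rightarrow> 'v) \<Rightarrow> 'g set \<Rightarrow> nat \<Rightarrow> ('e, 'v) form set" where
  "basic_forms G \<rho> K q = {\<omega> \<in> alt_forms q.
     (\<forall>\<xi>. q > 0 \<and> \<xi> 1 \<in> lie_subalgebra G K \<longrightarrow> \<omega> \<xi> = 0)
     \<and> (\<forall>a\<in>K. \<forall>\<xi>. \<rho> a (\<omega> (\<lambda>i. Ad G (inv\<^bsub>G\<^esub> a) (\<xi> i))) = \<omega> \<xi>)}"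


section \<open>The complexes\<close>

definition cochains :: "('g::topological_space, 'e::real_normed_vector) charted_group \<Rightarrow> nat
    \<Rightarrow> ((nat \<Rightarrow> 'g) \<Rightarrow> 'v::real_normed_vector) set" where
  "cochains G p = {f. depends_upto p f \<and> smooth_fun G p f}"

text \<open>
  An element \<open>\<psi>\<close> of the double complex in bidegree (p,q), written
  \<open>\<psi> (g, x) \<xi> = \<psi>(g\<^sub>1, ..., g\<^sub>p; x)(\<xi>\<^sub>1, ..., \<xi>\<^sub>q)\<close>.
  In the smoothness condition the last factor of \<open>G\<^sup>p \<times> G\<close> is entry \<open>p + 1\<close>.
\<close>

type_synonym ('g, 'e, 'v) dcochain = "(nat \<Rightarrow> 'g) \<times> 'g \<Rightarrow> ('e, 'v) form"

definition dcochains :: "('g::topological_space, 'e::real_normed_vector) charted_group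
    \<Rightarrow> nat \<Rightarrow> nat \<Rightarrow> ('g, 'e, 'v::real_normed_vector) dcochain set" where
  "dcochains G p q = {\<psi>. (\<forall>y. \<psi> y \<in> alt_forms q)
     \<and> (\<forall>x. depends_upto p (\<lambda>g. \<psi> (g, x)))
     \<and> (\<forall>\<xi>. smooth_fun G (p + 1) (\<lambda>g. \<psi> (g, g (p + 1)) \<xi>))}"

definition basic_dcochains :: "('g::topological_space, 'e::real_normed_vector) charted_group
    \<Rightarrow> ('g \<Rightarrow> 'v::real_normed_vector \<Rightarrow> 'v) \<Rightarrow> 'g set \<Rightarrow> nat \<Rightarrow> nat \<Rightarrow> ('g, 'e, 'v) dcochain set" where
  "basic_dcochains G \<rho> K p q = {\<psi> \<in> dcochains G p q.
     (\<forall>y \<xi>. q > 0 \<and> \<xi> 1 \<in> lie_subalgebra G K \<longrightarrow> \<psi> y \<xi> = 0)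
     \<and> (\<forall>a\<in>K. \<forall>g x \<xi>. \<rho> a (\<psi> (g, x \<otimes>\<^bsub>G\<^esub> a) (\<lambda>i. Ad G (inv\<^bsub>G\<^esub> a) (\<xi> i))) = \<psi> (g, x) \<xi>)}"

text \<open>The \<open>\<gg>\<close>-representation on \<open>C\<^sup>\<infinity>(G\<^sup>p \<times> G) \<otimes> V\<close> and the vertical differential on bidegree (p,q).\<close>

definition vert_act :: "('g, 'e::real_normed_vector) charted_group
    \<Rightarrow> ('g \<Rightarrow> 'v::real_normed_vector \<Rightarrow> 'v) \<Rightarrow> 'e
    \<Rightarrow> ((nat \<Rightarrow> 'g) \<times> 'g \<Rightarrow> 'v) \<Rightarrow> (nat \<Rightarrow> 'g) \<times> 'g \<Rightarrow> 'v" where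
  "vert_act G \<rho> \<xi> F = (\<lambda>(g, x). left_deriv G \<xi> (\<lambda>y. F (g, y)) x + rep_deriv G \<rho> \<xi> (F (g, x)))"

definition vert_diff :: "('g, 'e::real_normed_vector) charted_group
    \<Rightarrow> ('g \<Rightarrow> 'v::real_normed_vector \<Rightarrow> 'v) \<Rightarrow> nat \<Rightarrow> nat
    \<Rightarrow> ('g, 'e, 'v) dcochain \<Rightarrow> ('g, 'e, 'v) dcochain" where
  "vert_diff G \<rho> p q \<psi> = (\<lambda>y \<xi>. (-1) ^ p *\<^sub>R CE G (vert_act G \<rho>) q \<psi> y \<xi>)"

definition j_map :: "('g, 'e) charted_group \<Rightarrow> ('g \<Rightarrow> 'v \<Rightarrow> 'v) \<Rightarrow> ((nat \<Rightarrow> 'g) \<Rightarrow> 'v)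
    \<Rightarrow> ('g, 'e, 'v) dcochain" where
  "j_map G \<rho> f = (\<lambda>(g, x) \<xi>. \<rho> (inv\<^bsub>G\<^esub> x) (f g))"

definition h_map :: "('g, 'e) charted_group \<Rightarrow> 'g measure \<Rightarrow> nat
    \<Rightarrow> ('g, 'e, 'v::{banach, second_countable_topology}) dcochain \<Rightarrow> ('g, 'e, 'v) dcochain" where
  "h_map G \<mu> p \<psi> = (\<lambda>(g, x) \<xi>. if p = 0 then 0 else
     (-1) ^ p *\<^sub>R (\<integral>k. \<psi> (g(p := x \<otimes>\<^bsub>G\<^esub> inv\<^bsub>G\<^esub> k), k) \<xi> \<partial>\<mu>))"

text \<open>
  The total K-basic space: direct sum over all bidegrees, as finitely supported families.
  \<open>one_plus_dh\<close> is \<open>1 + dh\<close> on it; \<open>dh\<close> has bidegree (-1,+1).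
\<close>

type_synonym ('g, 'e, 'v) dfamily = "nat \<Rightarrow> nat \<Rightarrow> ('g, 'e, 'v) dcochain"

definition total_basic :: "('g::topological_space, 'e::real_normed_vector) charted_group
    \<Rightarrow> ('g \<Rightarrow> 'v::real_normed_vector \<Rightarrow> 'v) \<Rightarrow> 'g set \<Rightarrow> ('g, 'e, 'v) dfamily set" where
  "total_basic G \<rho> K = {\<Psi>. (\<forall>p q. \<Psi> p q \<in> basic_dcochains G \<rho> K p q)
     \<and> finite {(p, q). \<Psi> p q \<noteq> (\<lambda>y \<xi>. 0)}}"

definition dh :: "('g, 'e::real_normed_vector) charted_group
    \<Rightarrow> ('g \<Rightarrow> 'v::{banach, second_countable_topology} \<Rightarrow> 'v) \<Rightarrow> 'g measure
    \<Rightarrow> ('g, 'e, 'v) dfamily \<Rightarrow> ('g, 'e, 'v) dfamily" where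
  "dh G \<rho> \<mu> \<Psi> = (\<lambda>p q. if q = 0 then (\<lambda>y \<xi>. 0)
     else vert_diff G \<rho> p (q - 1) (h_map G \<mu> (p + 1) (\<Psi> (p + 1) (q - 1))))"

definition one_plus_dh :: "('g, 'e::real_normed_vector) charted_group
    \<Rightarrow> ('g \<Rightarrow> 'v::{banach, second_countable_topology} \<Rightarrow> 'v) \<Rightarrow> 'g measure
    \<Rightarrow> ('g, 'e, 'v) dfamily \<Rightarrow> ('g, 'e, 'v) dfamily" where
  "one_plus_dh G \<rho> \<mu> \<Psi> = (\<lambda>p q y \<xi>. \<Psi> p q y \<xi> + dh G \<rho> \<mu> \<Psi> p q y \<xi>)"

text \<open>
  The map \<open>p\<close> on the total space: its component of degree \<open>q\<close> comes from \<open>\<Psi> 0 q\<close>, the parts with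
  \<open>p > 0\<close> are sent to 0. The first entry of the pair is irrelevant for \<open>\<Psi> 0 q\<close>.
\<close>

definition p_map :: "('g, 'e) charted_group \<Rightarrow> 'g measure
    \<Rightarrow> ('g, 'e, 'v::{banach, second_countable_topology}) dfamily \<Rightarrow> nat \<Rightarrow> ('e, 'v) form" where
  "p_map G \<mu> \<Psi> = (\<lambda>q \<xi>. \<integral>k. \<Psi> 0 q ((\<lambda>_. \<one>\<^bsub>G\<^esub>), k) \<xi> \<partial>\<mu>)"

text \<open>
  Homogeneous elements of degree \<open>p\<close>, as elements of the total (direct sum) spaces, and the van Est
  map \<open>p \<circ> (1 + dh)\<^sup>-\<^sup>1 \<circ> j\<close> on \<open>C\<^sup>\<infinity>(G\<^sup>p, V)\<close>; its value is a family of forms indexed by the degree.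
\<close>

definition homogeneous :: "nat \<Rightarrow> ('e, 'v::zero) form \<Rightarrow> nat \<Rightarrow> ('e, 'v) form" where
  "homogeneous p \<omega> = (\<lambda>q. if q = p then \<omega> else (\<lambda>\<xi>. 0))"

definition j_total :: "('g, 'e) charted_group \<Rightarrow> ('g \<Rightarrow> 'v::zero \<Rightarrow> 'v) \<Rightarrow> nat
    \<Rightarrow> ((nat \<Rightarrow> 'g) \<Rightarrow> 'v) \<Rightarrow> ('g, 'e, 'v) dfamily" where
  "j_total G \<rho> p f = (\<lambda>p' q. if p' = p \<and> q = 0 then j_map G \<rho> f else (\<lambda>y \<xi>. 0))"

definition VE :: "('g::topological_space, 'e::real_normed_vector) charted_group
    \<Rightarrow> ('g \<Rightarrow> 'v::{banach, second_countable_topology} \<Rightarrow> 'v) \<Rightarrow> 'g set \<Rightarrow> 'g measure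
    \<Rightarrow> nat \<Rightarrow> ((nat \<Rightarrow> 'g) \<Rightarrow> 'v) \<Rightarrow> nat \<Rightarrow> ('e, 'v) form" where
  "VE G \<rho> K \<mu> p f =
     p_map G \<mu> (the_inv_into (total_basic G \<rho> K) (one_plus_dh G \<rho> \<mu>) (j_total G \<rho> p f))"


section \<open>Averaging and the iterated differentials\<close>

definition avg_act :: "('g, 'e) charted_group \<Rightarrow> ('g \<Rightarrow> 'v \<Rightarrow> 'v) \<Rightarrow> nat \<Rightarrow> nat \<Rightarrow> 'g
    \<Rightarrow> ((nat \<Rightarrow> 'g) \<Rightarrow> 'v) \<Rightarrow> (nat \<Rightarrow> 'g) \<Rightarrow> 'v" where
  "avg_act G \<rho> p i a f g =
     (if p = 0 then \<rho> a (f g)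
      else if i = 0 then f (g(1 := inv\<^bsub>G\<^esub> a \<otimes>\<^bsub>G\<^esub> g 1))
      else if i < p then f (g(i := g i \<otimes>\<^bsub>G\<^esub> a, i + 1 := inv\<^bsub>G\<^esub> a \<otimes>\<^bsub>G\<^esub> g (i + 1)))
      else \<rho> a (f (g(p := g p \<otimes>\<^bsub>G\<^esub> a))))"

definition Av_i :: "('g, 'e) charted_group
    \<Rightarrow> ('g \<Rightarrow> 'v::{banach, second_countable_topology} \<Rightarrow> 'v) \<Rightarrow> 'g measure \<Rightarrow> nat \<Rightarrow> nat
    \<Rightarrow> ((nat \<Rightarrow> 'g) \<Rightarrow> 'v) \<Rightarrow> (nat \<Rightarrow> 'g) \<Rightarrow> 'v" where
  "Av_i G \<rho> \<mu> p i f g = (\<integral>k. avg_act G \<rho> p i k f g \<partial>\<mu>)"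

definition Av :: "('g, 'e) charted_group
    \<Rightarrow> ('g \<Rightarrow> 'v::{banach, second_countable_topology} \<Rightarrow> 'v) \<Rightarrow> 'g measure \<Rightarrow> nat
    \<Rightarrow> ((nat \<Rightarrow> 'g) \<Rightarrow> 'v) \<Rightarrow> (nat \<Rightarrow> 'g) \<Rightarrow> 'v" where
  "Av G \<rho> \<mu> p f = foldr (Av_i G \<rho> \<mu> p) [0..<p + 1] f"

definition conj_act :: "('g, 'e) charted_group \<Rightarrow> ('g \<Rightarrow> 'v \<Rightarrow> 'v) \<Rightarrow> nat \<Rightarrow> nat \<Rightarrow> 'g
    \<Rightarrow> ((nat \<Rightarrow> 'g) \<Rightarrow> 'v) \<Rightarrow> (nat \<Rightarrow> 'g) \<Rightarrow> 'v" where
  "conj_act G \<rho> p i a f g = \<rho> a (f (\<lambda>l. if l = i then g i \<otimes>\<^bsub>G\<^esub> a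
     else if i < l \<and> l \<le> p then inv\<^bsub>G\<^esub> a \<otimes>\<^bsub>G\<^esub> g l \<otimes>\<^bsub>G\<^esub> a else g l))"

definition conj_act_deriv :: "('g, 'e::real_normed_vector) charted_group
    \<Rightarrow> ('g \<Rightarrow> 'v::real_normed_vector \<Rightarrow> 'v) \<Rightarrow> nat \<Rightarrow> nat \<Rightarrow> 'e
    \<Rightarrow> ((nat \<Rightarrow> 'g) \<Rightarrow> 'v) \<Rightarrow> (nat \<Rightarrow> 'g) \<Rightarrow> 'v" where
  "conj_act_deriv G \<rho> p i \<xi> f g =
     vector_derivative (\<lambda>t. conj_act G \<rho> p i (exp_chart G (t *\<^sub>R \<xi>)) f g) (at 0)"

definition d_i :: "('g, 'e::real_normed_vector) charted_group
    \<Rightarrow> ('g \<Rightarrow> 'v::real_normed_vector \<Rightarrow> 'v) \<Rightarrow> nat \<Rightarrow> nat \<Rightarrow> nat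
    \<Rightarrow> ((nat \<Rightarrow> 'g) \<Rightarrow> ('e, 'v) form) \<Rightarrow> (nat \<Rightarrow> 'g) \<Rightarrow> ('e, 'v) form" where
  "d_i G \<rho> p i q = CE G (conj_act_deriv G \<rho> p i) q"

text \<open>The operator with index \<open>p\<close> is applied first, so the one with index \<open>i\<close> meets a form of degree \<open>p - i\<close>.\<close>

definition d_all :: "('g, 'e::real_normed_vector) charted_group
    \<Rightarrow> ('g \<Rightarrow> 'v::real_normed_vector \<Rightarrow> 'v) \<Rightarrow> nat
    \<Rightarrow> ((nat \<Rightarrow> 'g) \<Rightarrow> 'v) \<Rightarrow> (nat \<Rightarrow> 'g) \<Rightarrow> ('e, 'v) form" where
  "d_all G \<rho> p f = foldr (\<lambda>i. d_i G \<rho> p i (p - i)) [1..<p + 1] (\<lambda>g \<xi>. f g)"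

end

theory Submission
  imports Defs
begin

text \<open>
  The operator \<open>dh\<close> lowers \<open>p\<close> and raises \<open>q\<close>. Hence \<open>1 + dh\<close> is injective, by induction on \<open>q\<close>, and it is
  enough to exhibit the preimage of \<open>j f\<close>. Write \<open>D\<^sub>j = d\<^sup>(\<^sup>j\<^sup>) \<dots> d\<^sup>(\<^sup>p\<^sup>)\<close> and \<open>f\<^sub>j = Av\<^sup>(\<^sup>j\<^sup>) \<dots> Av\<^sup>(\<^sup>p\<^sup>) f\<close>. For
  \<open>1 \<le> j \<le> p\<close> its component of bidegree \<open>(j - 1, p + 1 - j)\<close> is
  \<open>\<psi>(g\<^sub>1, \<dots>, g\<^sub>j\<^sub>-\<^sub>1; x) = (D\<^sub>j f\<^sub>j)(g\<^sub>1, \<dots>, g\<^sub>j\<^sub>-\<^sub>1, x, e, \<dots>, e)\<close>.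

  On points whose last entries are \<open>e\<close>, the differential \<open>d\<^sup>(\<^sup>j\<^sup>)\<close> is the vertical differential. The operator
  \<open>D\<^sub>j\<close> commutes with integration over \<open>K\<close> and, up to the coadjoint action on the forms, with the
  conjugation actions \<open>(a \<cdot> f)(g) = a \<cdot> f(\<dots>, g\<^sub>i a, a\<^sup>-\<^sup>1 g\<^sub>i\<^sub>+\<^sub>1 a, \<dots>, a\<^sup>-\<^sup>1 g\<^sub>p a)\<close> for \<open>i \<le> j\<close>. The latter is the
  product of the actions with labels \<open>i, \<dots>, p\<close> used for averaging, so on a function that is invariant under
  those with labels \<open>i + 1, \<dots>, p\<close> it reduces to the action with label \<open>i\<close>. This is why \<open>h\<close> turns
  \<open>D\<^sub>j f\<^sub>j\<close> into \<open>D\<^sub>j f\<^sub>j\<^sub>-\<^sub>1\<close> up to sign. That \<open>\<psi>\<close> vanishes on \<open>\<kk>\<close> follows from Cartan's formula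
  \<open>\<iota>\<^sub>\<xi> d = L\<^sub>\<xi> - d \<iota>\<^sub>\<xi>\<close>, since \<open>L\<^sub>\<xi> = 0\<close> on \<open>K\<close>-invariant forms.
\<close>

section \<open>Finite-dimensional normed spaces\<close>

text \<open>Applied to the component with index \<open>j + 1\<close>, \<open>h\<close> contributes
  the sign \<open>(-1) ^ j\<close> and the vertical differential the sign
  \<open>(-1) ^ (j - 1)\<close>. So \<open>dh\<close> maps each component to minus the one below it,
  and only \<open>j f\<close> survives in \<open>1 + dh\<close>. This component has index
  \<open>p + 1\<close>; it carries a factor \<open>\<rho> (inv x)\<close> instead of an
  \<open>x\<close> among the entries and is treated apart.

  The obstacle is the integrand of \<open>h\<close>, in which the variable \<open>k\<close> of
  integration fills two neighbouring entries, as \<open>x \<otimes> inv k\<close> and as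
  \<open>k\<close>. Equivariance of the differentials absorbs both into one conjugation action of
  \<open>inv k\<close>, and the Haar measure does not see the inversion. To carry the differentials
  past the integral, the acting group element is made one more entry of the function, beyond those
  that the actions move; this is why functions of \<open>n \<ge> p\<close> entries occur.

  The curves given by \<open>exp_chart\<close> need not be one-parameter groups. Everything at the
  neutral element therefore rests on one principle: a derivative along a curve depends only on the
  velocity of the curve.\<close>

definition fbasis :: "'a::real_vector set" where
  "fbasis = (SOME B. finite B \<and> independent B \<and> span B = UNIV)"

definition fcoord :: "'a::real_vector \<Rightarrow> 'a \<Rightarrow> real" where
  "fcoord b x = representation fbasis x b"

lemma fbasis:
  assumes "finite_dim (UNIV :: 'a::real_vector set)"
  shows "finite (fbasis :: 'a set)" "independent (fbasis :: 'a set)" "span fbasis = (UNIV :: 'a set)"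
proof -
  obtain B0 :: "'a set" where B0: "finite B0" "span B0 = UNIV"
    using assms unfolding finite_dim_def by blast
  obtain B where B: "B \<subseteq> B0" "independent B" "B0 \<subseteq> span B"
    using maximal_independent_subset by blast
  have "span B = UNIV"
    using B(3) B0(2) by (metis span_minimal subspace_span top.extremum_uniqueI)
  hence "finite B \<and> independent B \<and> span B = UNIV"
    using B B0(1) finite_subset by auto
  hence "finite (fbasis :: 'a set) \<and> independent (fbasis :: 'a set) \<and> span fbasis = (UNIV :: 'a set)"
    unfolding fbasis_def by (rule someI)
  thus "finite (fbasis :: 'a set)" "independent (fbasis :: 'a set)" "span fbasis = (UNIV :: 'a set)"
    by auto
qed

lemma fcoord_sum:
  assumes "finite_dim (UNIV :: 'a::real_vector set)"
  shows "(\<Sum>b\<in>fbasis. fcoord b x *\<^sub>R b) = (x :: 'a)"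
  unfolding fcoord_def using fbasis[OF assms]
  by (intro real_vector.sum_representation_eq) auto

lemma linear_fcoord:
  assumes "finite_dim (UNIV :: 'a::real_vector set)"
  shows "linear (fcoord (b :: 'a))"
  unfolding fcoord_def using fbasis[OF assms]
  by (intro linearI) (auto simp: real_vector.representation_add real_vector.representation_scale)

text \<open>On the compact set of coefficient vectors of l1-norm 1, the norm of the corresponding
  combination of basis vectors attains its minimum, which is positive by independence. By
  homogeneity this minimum bounds all coordinates.\<close>

lemma bounded_linear_fcoord:
  assumes fd: "finite_dim (UNIV :: 'a::real_normed_vector set)"
  shows "bounded_linear (fcoord (b :: 'a))"
proof (cases "b \<in> fbasis")
  case False
  then have "fcoord b = (\<lambda>_. 0)"
    unfolding fcoord_def using real_vector.representation_ne_zero by blast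
  then show ?thesis by simp
next
  case True
  let ?B = "fbasis :: 'a set"
  have fin: "finite ?B" and ind: "independent ?B" using fbasis[OF fd] by auto
  \<comment> \<open>Coefficients off the basis are pinned to 0, so that the box is compact in the
    product topology by Tychonoff.\<close>
  define S where "S = (PiE UNIV (\<lambda>b. if b \<in> ?B then {-1..1} else {0::real})) \<inter> {u. (\<Sum>b\<in>?B. \<bar>u b\<bar>) = 1}"
  have "compact (PiE UNIV (\<lambda>b. if b \<in> ?B then {-1..1} else {0::real}))"
    using compactin_PiE[of "\<lambda>_::'a. euclidean :: real topology" UNIV "\<lambda>b. if b \<in> ?B then {-1..1} else {0::real}"]
    by (simp add: euclidean_product_topology)
  moreover have "closed {u::'a\<Rightarrow>real. (\<Sum>b\<in>?B. \<bar>u b\<bar>) = 1}"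
    by (intro closed_Collect_eq continuous_intros) (auto intro: continuous_on_product_coordinates)
  ultimately have cS: "compact S" unfolding S_def by (intro compact_Int_closed)
  define N where "N u = norm (\<Sum>b\<in>?B. u b *\<^sub>R b)" for u :: "'a \<Rightarrow> real"
  have "continuous_on UNIV N" unfolding N_def
    by (intro continuous_intros) (auto intro: continuous_on_product_coordinates)
  hence cN: "continuous_on S N" by (rule continuous_on_subset) simp
  have inS: "(\<lambda>c. if c = b then 1 else 0) \<in> S"
    using True fin by (auto simp: S_def PiE_iff if_distrib[of abs] cong: if_cong)
  then have "S \<noteq> {}" by auto
  from continuous_attains_inf[OF cS this cN] obtain u where u: "u \<in> S" "\<And>v. v \<in> S \<Longrightarrow> N u \<le> N v" by blast
  have "N u \<noteq> 0"
  proof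
    assume "N u = 0"
    then have "(\<Sum>b\<in>?B. u b *\<^sub>R b) = 0" by (simp add: N_def)
    then have "\<forall>b\<in>?B. u b = 0" using ind fin by (auto simp: dependent_finite)
    then have "(\<Sum>b\<in>?B. \<bar>u b\<bar>) = 0" by simp
    then show False using u(1) by (auto simp: S_def)
  qed
  then have Npos: "N u > 0" by (simp add: N_def)
  have bd: "\<bar>fcoord b x\<bar> \<le> norm x * (1 / N u)" for x :: 'a
  proof -
    define s where "s = (\<Sum>b\<in>?B. \<bar>fcoord b x\<bar>)"
    have sb: "\<bar>fcoord c x\<bar> \<le> s" if "c \<in> ?B" for c unfolding s_def
      using that fin by (intro member_le_sum) auto
    show ?thesis
    proof (cases "s = 0")
      case True
      then show ?thesis using sb[OF \<open>b \<in> ?B\<close>] Npos by simp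
    next
      case False
      then have s: "s > 0" unfolding s_def by (metis abs_ge_zero less_eq_real_def sum_nonneg)
      define v where "v c = fcoord c x / s" for c
      have "fcoord c x = 0" if "c \<notin> ?B" for c
        using that real_vector.representation_ne_zero unfolding fcoord_def by blast
      then have "v \<in> S" using sb s
        by (auto simp: S_def v_def PiE_iff divide_simps abs_le_iff simp flip: sum_divide_distrib s_def)
           (use sb in force)
      then have "N u \<le> N v" by (rule u(2))
      also have "N v = norm ((1 / s) *\<^sub>R (\<Sum>b\<in>?B. fcoord b x *\<^sub>R b))"
        unfolding N_def v_def by (simp add: scaleR_sum_right divide_inverse mult.commute)
      also have "\<dots> = norm x / s" using s by (simp add: fcoord_sum[OF fd])
      finally have "s \<le> norm x / N u" using s Npos by (simp add: field_simps)
      then show ?thesis using sb[OF True] by simp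
    qed
  qed
  show ?thesis
  proof (rule bounded_linear_intro)
    show "fcoord b (x + y) = fcoord b x + fcoord b y" for x y :: 'a
      by (rule linear_add[OF linear_fcoord[OF fd]])
    show "fcoord b (r *\<^sub>R x) = r *\<^sub>R fcoord b x" for r and x :: 'a
      by (rule linear_scale[OF linear_fcoord[OF fd]])
    show "norm (fcoord b x) \<le> norm x * (1 / N u)" for x :: 'a using bd by simp
  qed
qed

lemma linear_expand:
  assumes fd: "finite_dim (UNIV :: 'a::real_vector set)" and "linear (f :: 'a \<Rightarrow> 'b::real_vector)"
  shows "f x = (\<Sum>b\<in>fbasis. fcoord b x *\<^sub>R f b)"
proof -
  have "f x = f (\<Sum>b\<in>fbasis. fcoord b x *\<^sub>R b)" by (simp add: fcoord_sum[OF fd])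
  also have "\<dots> = (\<Sum>b\<in>fbasis. fcoord b x *\<^sub>R f b)"
    by (simp add: linear_sum[OF assms(2)] linear_scale[OF assms(2)])
  finally show ?thesis .
qed

lemma linear_imp_bounded_linear:
  assumes fd: "finite_dim (UNIV :: 'a::real_normed_vector set)"
    and l: "linear (f :: 'a \<Rightarrow> 'b::real_normed_vector)"
  shows "bounded_linear f"
proof -
  have "bounded_linear (\<lambda>x. \<Sum>b\<in>fbasis. fcoord b x *\<^sub>R f b)"
    by (intro bounded_linear_sum bounded_linear_compose[OF bounded_linear_scaleR_left] bounded_linear_fcoord fd)
  then show ?thesis using linear_expand[OF fd l] by (metis (no_types, lifting) ext)
qed

section \<open>Calculus of functions of several vector variables\<close>

lemma continuous_on_coord: "continuous_on S (\<lambda>x. (x::nat \<Rightarrow> 'b::topological_space) i)"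
  by (rule continuous_on_subset[OF continuous_on_product_coordinates]) simp

lemma continuous_on_line:
  fixes b :: "'e::real_normed_vector"
  shows "continuous_on S (\<lambda>p::(nat \<Rightarrow> 'e) \<times> real. (fst p)(j := fst p j + snd p *\<^sub>R b))"
proof (rule continuous_on_coordinatewise_then_product)
  fix i
  have *: "continuous_on S (\<lambda>p::(nat \<Rightarrow> 'e) \<times> real. fst p i)" for i
    by (rule continuous_on_compose2[OF continuous_on_coord[of UNIV]]) (auto intro: continuous_intros)
  show "continuous_on S (\<lambda>p::(nat \<Rightarrow> 'e) \<times> real. ((fst p)(j := fst p j + snd p *\<^sub>R b)) i)"
    by (cases "i = j") (auto intro!: continuous_intros *)
qed

lemma eventually_line:
  fixes S :: "(nat \<Rightarrow> 'e::real_normed_vector) set"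
  assumes "open S" "x \<in> S"
  shows "\<forall>\<^sub>F t in nhds (0::real). x(i := x i + t *\<^sub>R v) \<in> S"
proof -
  have "continuous_on UNIV (\<lambda>t::real. (\<lambda>p. (fst p)(i := fst p i + snd p *\<^sub>R v)) (x, t))"
    by (rule continuous_on_compose2[OF continuous_on_line[of UNIV]]) (auto intro!: continuous_intros)
  then have "open ((\<lambda>t::real. x(i := x i + t *\<^sub>R v)) -` S)"
    using assms(1) by (simp add: continuous_on_open_vimage)
  moreover have "0 \<in> ((\<lambda>t::real. x(i := x i + t *\<^sub>R v)) -` S)" using assms(2) by simp
  ultimately show ?thesis unfolding eventually_nhds by blast
qed

lemma vector_derivative_cong_eventually:
  assumes "\<forall>\<^sub>F t in nhds (a::real). f t = g t"
  shows "vector_derivative f (at a) = vector_derivative g (at a)"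
  by (rule vector_derivative_cong_eq) (use assms in auto)

lemma has_vector_derivative_cong_eventually:
  assumes "\<forall>\<^sub>F t in nhds (a::real). f t = g t"
  shows "(f has_vector_derivative D) (at a) \<longleftrightarrow> (g has_vector_derivative D) (at a)"
  by (rule has_vector_derivative_cong_ev) (use assms eventually_nhds_x_imp_x in auto)

lemma partial_deriv_cong:
  assumes "open S" "x \<in> S" "\<And>x. x \<in> S \<Longrightarrow> F x = F' x"
  shows "partial_deriv i v F x = partial_deriv i v F' x"
  unfolding partial_deriv_def
  by (rule vector_derivative_cong_eventually)
     (rule eventually_mono[OF eventually_line[OF assms(1,2)]], rule assms(3))

lemma C_k_continuous: "C_k k n S F \<Longrightarrow> continuous_on S F"
  by (cases k) (simp_all add: C_k.simps(2))

lemma C_k_partial: "C_k (Suc k) n S F \<Longrightarrow> i \<in> {1..n} \<Longrightarrow> C_k k n S (partial_deriv i v F)"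
  by (simp only: C_k.simps)

lemma C_k_differentiable:
  "C_k (Suc k) n S F \<Longrightarrow> i \<in> {1..n} \<Longrightarrow> x \<in> S \<Longrightarrow>
    (\<lambda>t::real. F (x(i := x i + t *\<^sub>R v))) differentiable (at 0)"
  by (simp only: C_k.simps)

lemma has_partial_deriv:
  assumes "C_k (Suc k) n S F" "i \<in> {1..n}" "x \<in> S"
  shows "((\<lambda>t. F (x(i := x i + t *\<^sub>R v))) has_vector_derivative partial_deriv i v F x) (at 0)"
  unfolding partial_deriv_def vector_derivative_works[symmetric]
  by (rule C_k_differentiable[OF assms])

declare C_k.simps(2) [simp del]

text \<open>Functions are total, with arbitrary values off \<open>S\<close>; openness ensures that
  derivatives at points of \<open>S\<close> read only values on \<open>S\<close>.\<close>

lemma C_k_cong_imp: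
  assumes "open S" "\<And>x. x \<in> S \<Longrightarrow> F x = F' x" "C_k k n S F"
  shows "C_k k n S F'"
  using assms(2,3)
proof (induction k arbitrary: F F')
  case 0
  then show ?case using continuous_on_cong[of S S F F'] by simp
next
  case (Suc k)
  show ?case unfolding C_k.simps
  proof (intro conjI ballI allI)
    show "continuous_on S F'"
      using Suc.prems(1) C_k_continuous[OF Suc.prems(2)] continuous_on_cong[of S S F F'] by simp
    fix i v assume i: "i \<in> {1..n}"
    show "C_k k n S (partial_deriv i v F')"
    proof (rule Suc.IH)
      show "partial_deriv i v F x = partial_deriv i v F' x" if "x \<in> S" for x
        by (rule partial_deriv_cong[OF assms(1) that]) (rule Suc.prems(1))
      show "C_k k n S (partial_deriv i v F)" by (rule C_k_partial[OF Suc.prems(2) i])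
    qed
    fix x assume x: "x \<in> S"
    have ev: "\<forall>\<^sub>F t in nhds 0. F (x(i := x i + t *\<^sub>R v)) = F' (x(i := x i + t *\<^sub>R v))"
      by (rule eventually_mono[OF eventually_line[OF assms(1) x]], rule Suc.prems(1))
    from has_partial_deriv[OF Suc.prems(2) i x, of v]
    show "(\<lambda>t::real. F' (x(i := x i + t *\<^sub>R v))) differentiable (at 0)"
      unfolding has_vector_derivative_cong_eventually[OF ev] by (rule differentiableI_vector)
  qed
qed

lemma C_k_subset: "C_k k n S F \<Longrightarrow> T \<subseteq> S \<Longrightarrow> C_k k n T F"
proof (induction k arbitrary: F)
  case (Suc k)
  have "continuous_on T F" by (rule continuous_on_subset[OF C_k_continuous[OF Suc.prems(1)] Suc.prems(2)])
  moreover have "C_k k n T (partial_deriv i v F)" if "i \<in> {1..n}" for i v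
    by (rule Suc.IH[OF C_k_partial[OF Suc.prems(1) that] Suc.prems(2)])
  moreover have "(\<lambda>t::real. F (x(i := x i + t *\<^sub>R v))) differentiable (at 0)" if "i \<in> {1..n}" "x \<in> T" for x i v
    by (rule C_k_differentiable[OF Suc.prems(1)]) (use Suc.prems(2) that in auto)
  ultimately show ?case unfolding C_k.simps by blast
qed (simp add: continuous_on_subset)

lemma C_k_Suc_imp: "C_k (Suc k) n S F \<Longrightarrow> C_k k n S F"
proof (induction k arbitrary: F)
  case 0
  then show ?case using C_k_continuous by simp
next
  case (Suc k)
  have "C_k k n S (partial_deriv i v F)" if "i \<in> {1..n}" for i v
    by (rule Suc.IH[OF C_k_partial[OF Suc.prems that]])
  then show ?case unfolding C_k.simps(2)[of k]
    using C_k_continuous[OF Suc.prems] C_k_differentiable[OF Suc.prems] by blast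
qed

lemma C_k_mono: "C_k k n S F \<Longrightarrow> l \<le> k \<Longrightarrow> C_k l n S F"
proof (induction k)
  case (Suc k)
  show ?case
  proof (cases "l = Suc k")
    case False
    with Suc.prems(2) have "l \<le> k" by simp
    then show ?thesis by (rule Suc.IH[OF C_k_Suc_imp[OF Suc.prems(1)]])
  qed (use Suc.prems(1) in \<open>simp only:\<close>)
qed simp

lemma continuous_on_local:
  fixes F :: "'a::t2_space \<Rightarrow> 'b::topological_space"
  assumes "\<And>x. x \<in> S \<Longrightarrow> \<exists>U. open U \<and> x \<in> U \<and> continuous_on U F"
  shows "continuous_on S F"
proof -
  have "isCont F x" if "x \<in> S" for x
    using assms[OF that] by (metis continuous_on_eq_continuous_at)
  then show ?thesis by (simp add: continuous_at_imp_continuous_on)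
qed

text \<open>Continuity and directional derivatives are decided near each point. Thanks to this,
  smoothness can be checked in charts chosen anew around each point.\<close>

lemma C_k_local:
  assumes "\<And>x. x \<in> S \<Longrightarrow> \<exists>U. open U \<and> x \<in> U \<and> C_k k n U F"
  shows "C_k k n S F"
  using assms
proof (induction k arbitrary: F)
  case 0
  then show ?case using continuous_on_local[of S F] by simp
next
  case (Suc k)
  show ?case unfolding C_k.simps
  proof (intro conjI ballI allI)
    show "continuous_on S F"
    proof (rule continuous_on_local)
      fix x assume "x \<in> S"
      from Suc.prems[OF this] obtain U where U: "open U" "x \<in> U" "C_k (Suc k) n U F" by (elim exE conjE)
      then show "\<exists>U. open U \<and> x \<in> U \<and> continuous_on U F" using C_k_continuous[OF U(3)] by (intro exI conjI)
    qed
    fix i v assume i: "i \<in> {1..n}"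
    show "C_k k n S (partial_deriv i v F)"
    proof (rule Suc.IH)
      fix x assume "x \<in> S"
      from Suc.prems[OF this] obtain U where U: "open U" "x \<in> U" "C_k (Suc k) n U F" by (elim exE conjE)
      then show "\<exists>U. open U \<and> x \<in> U \<and> C_k k n U (partial_deriv i v F)"
        using C_k_partial[OF U(3) i] by (intro exI conjI)
    qed
    fix x assume "x \<in> S"
    from Suc.prems[OF this] obtain U where U: "open U" "x \<in> U" "C_k (Suc k) n U F" by (elim exE conjE)
    then show "(\<lambda>t::real. F (x(i := x i + t *\<^sub>R v))) differentiable (at 0)"
      by (intro C_k_differentiable[OF U(3) i])
  qed
qed

text \<open>The derivatives are supplied as formulas \<open>F'\<close>, which have to agree with
  \<open>partial_deriv\<close> only on \<open>S\<close>.\<close>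

lemma C_k_SucI:
  assumes "open S" "continuous_on S F"
    and "\<And>i v x. i \<in> {1..n} \<Longrightarrow> x \<in> S \<Longrightarrow>
        ((\<lambda>t. F (x(i := x i + t *\<^sub>R v))) has_vector_derivative F' i v x) (at 0)"
    and "\<And>i v. i \<in> {1..n} \<Longrightarrow> C_k k n S (F' i v)"
  shows "C_k (Suc k) n S F"
  unfolding C_k.simps
proof (intro conjI ballI allI)
  show "continuous_on S F" by fact
  fix i v assume i: "i \<in> {1..n}"
  show "(\<lambda>t. F (x(i := x i + t *\<^sub>R v))) differentiable at 0" if "x \<in> S" for x
    by (rule differentiableI_vector[OF assms(3)[OF i that]])
  have "partial_deriv i v F x = F' i v x" if "x \<in> S" for x
    unfolding partial_deriv_def by (rule vector_derivative_at[OF assms(3)[OF i that]])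
  from C_k_cong_imp[OF assms(1) this[symmetric] assms(4)[OF i]]
  show "C_k k n S (partial_deriv i v F)" .
qed

lemma C_k_const: "open S \<Longrightarrow> C_k k n S (\<lambda>_. c)"
proof (induction k arbitrary: c)
  case (Suc k)
  show ?case by (rule C_k_SucI[where F' = "\<lambda>_ _ _. 0"]) (use Suc in simp_all)
qed simp

lemma C_k_coord: "open S \<Longrightarrow> C_k k n S (\<lambda>x. x j)"
proof (cases k)
  case (Suc k')
  assume S: "open S"
  show ?thesis unfolding Suc
  proof (rule C_k_SucI[where F' = "\<lambda>i v _. if i = j then v else 0", OF S continuous_on_coord])
    fix i v and x :: "nat \<Rightarrow> 'a"
    show "((\<lambda>t. (x(i := x i + t *\<^sub>R v)) j) has_vector_derivative (if i = j then v else 0)) (at 0)"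
      by (cases "i = j") (auto intro!: derivative_eq_intros)
  qed (auto intro: C_k_const S)
qed (auto intro: continuous_on_coord)

lemma C_k_add: "open S \<Longrightarrow> C_k k n S F \<Longrightarrow> C_k k n S H \<Longrightarrow> C_k k n S (\<lambda>x. F x + H x)"
proof (induction k arbitrary: F H)
  case (Suc k)
  show ?case
  proof (rule C_k_SucI[where F' = "\<lambda>i v x. partial_deriv i v F x + partial_deriv i v H x"])
    show "continuous_on S (\<lambda>x. F x + H x)"
      by (intro continuous_on_add C_k_continuous[OF Suc.prems(2)] C_k_continuous[OF Suc.prems(3)])
    fix i v assume i: "i \<in> {1..n}"
    show "C_k k n S (\<lambda>x. partial_deriv i v F x + partial_deriv i v H x)"
      by (rule Suc.IH[OF Suc.prems(1) C_k_partial[OF Suc.prems(2) i] C_k_partial[OF Suc.prems(3) i]])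
    fix x assume x: "x \<in> S"
    show "((\<lambda>t. F (x(i := x i + t *\<^sub>R v)) + H (x(i := x i + t *\<^sub>R v))) has_vector_derivative
        partial_deriv i v F x + partial_deriv i v H x) (at 0)"
      by (rule has_vector_derivative_add[OF has_partial_deriv[OF Suc.prems(2) i x] has_partial_deriv[OF Suc.prems(3) i x]])
  qed (rule Suc.prems(1))
qed (simp add: continuous_on_add)

lemma C_k_linear: "open S \<Longrightarrow> bounded_linear L \<Longrightarrow> C_k k n S F \<Longrightarrow> C_k k n S (\<lambda>x. L (F x))"
proof (induction k arbitrary: F)
  case 0
  show ?case unfolding C_k.simps by (rule bounded_linear.continuous_on[OF 0(2) 0(3)[unfolded C_k.simps]])
next
  case (Suc k)
  show ?case
  proof (rule C_k_SucI[where F' = "\<lambda>i v x. L (partial_deriv i v F x)"])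
    show "continuous_on S (\<lambda>x. L (F x))"
      by (rule bounded_linear.continuous_on[OF Suc.prems(2) C_k_continuous[OF Suc.prems(3)]])
    fix i v assume i: "i \<in> {1..n}"
    show "C_k k n S (\<lambda>x. L (partial_deriv i v F x))"
      by (rule Suc.IH[OF Suc.prems(1,2) C_k_partial[OF Suc.prems(3) i]])
    fix x assume x: "x \<in> S"
    show "((\<lambda>t. L (F (x(i := x i + t *\<^sub>R v)))) has_vector_derivative L (partial_deriv i v F x)) (at 0)"
      by (rule bounded_linear.has_vector_derivative[OF Suc.prems(2) has_partial_deriv[OF Suc.prems(3) i x]])
  qed (rule Suc.prems(1))
qed

lemma C_k_sum:
  assumes "open S" "\<And>a. a \<in> A \<Longrightarrow> C_k k n S (F a)"
  shows "C_k k n S (\<lambda>x. \<Sum>a\<in>A. F a x)"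
  using assms(2)
  by (induction A rule: infinite_finite_induct) (auto intro!: C_k_const C_k_add assms(1))

lemma C_k_scaleR:
  "open S \<Longrightarrow> C_k k n S u \<Longrightarrow> C_k k n S F \<Longrightarrow> C_k k n S (\<lambda>x. (u x :: real) *\<^sub>R F x)"
proof (induction k arbitrary: u F)
  case (Suc k)
  show ?case
  proof (rule C_k_SucI[where F' = "\<lambda>i v x. u x *\<^sub>R partial_deriv i v F x + partial_deriv i v u x *\<^sub>R F x"])
    show "continuous_on S (\<lambda>x. u x *\<^sub>R F x)"
      by (rule continuous_on_scaleR[OF C_k_continuous[OF Suc.prems(2)] C_k_continuous[OF Suc.prems(3)]])
    fix i v assume i: "i \<in> {1..n}"
    show "C_k k n S (\<lambda>x. u x *\<^sub>R partial_deriv i v F x + partial_deriv i v u x *\<^sub>R F x)"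
      by (rule C_k_add[OF Suc.prems(1)
            Suc.IH[OF Suc.prems(1) C_k_Suc_imp[OF Suc.prems(2)] C_k_partial[OF Suc.prems(3) i]]
            Suc.IH[OF Suc.prems(1) C_k_partial[OF Suc.prems(2) i] C_k_Suc_imp[OF Suc.prems(3)]]])
    fix x assume x: "x \<in> S"
    show "((\<lambda>t. u (x(i := x i + t *\<^sub>R v)) *\<^sub>R F (x(i := x i + t *\<^sub>R v))) has_vector_derivative
         u x *\<^sub>R partial_deriv i v F x + partial_deriv i v u x *\<^sub>R F x) (at 0)"
    proof -
      have "((\<lambda>t. u (x(i := x i + t *\<^sub>R v)) *\<^sub>R F (x(i := x i + t *\<^sub>R v))) has_vector_derivative
         u (x(i := x i + 0 *\<^sub>R v)) *\<^sub>R partial_deriv i v F x + partial_deriv i v u x *\<^sub>R F (x(i := x i + 0 *\<^sub>R v))) (at 0)"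
        by (rule has_vector_derivative_scaleR[OF
            has_partial_deriv[OF Suc.prems(2) i x, folded has_real_derivative_iff_has_vector_derivative]
            has_partial_deriv[OF Suc.prems(3) i x]])
      then show ?thesis by simp
    qed
  qed (rule Suc.prems(1))
qed (simp add: continuous_on_scaleR)

section \<open>The chain rule along curves and for compositions\<close>

lemma tendsto_coordinatewise:
  fixes z :: "'a \<Rightarrow> nat \<Rightarrow> 'c::topological_space"
  assumes "\<And>i. ((\<lambda>t. z t i) \<longlongrightarrow> l i) F"
  shows "(z \<longlongrightarrow> l) F"
proof -
  have "limitin (product_topology (\<lambda>_::nat. euclidean :: 'c topology) UNIV) z l F"
    using assms by (simp add: limitin_componentwise)
  then show ?thesis by (simp add: euclidean_product_topology)
qed

lemma has_partial_deriv_at: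
  assumes "C_k (Suc k) n S F" "i \<in> {1..n}" "x(i := x i + s *\<^sub>R v) \<in> S"
  shows "((\<lambda>s. F (x(i := x i + s *\<^sub>R v))) has_vector_derivative
     partial_deriv i v F (x(i := x i + s *\<^sub>R v))) (at s)"
proof -
  let ?y = "x(i := x i + s *\<^sub>R v)"
  let ?h = "\<lambda>t. F (?y(i := ?y i + t *\<^sub>R v))"
  have 1: "(?h has_vector_derivative partial_deriv i v F ?y) (at (s - s))"
    using has_partial_deriv[OF assms, of v] by simp
  have 2: "((\<lambda>r. r - s) has_vector_derivative 1) (at s)"
    by (auto intro!: derivative_eq_intros)
  have "(?h \<circ> (\<lambda>r. r - s) has_vector_derivative 1 *\<^sub>R partial_deriv i v F ?y) (at s)"
    by (rule vector_diff_chain_at[OF 2 1])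
  moreover have "?h \<circ> (\<lambda>r. r - s) = (\<lambda>s. F (x(i := x i + s *\<^sub>R v)))"
    by (simp only: o_def fun_upd_same fun_upd_upd) (simp add: scaleR_diff_left)
  ultimately show ?thesis by simp
qed

lemma onorm_scaleR_le: "norm c \<le> B \<Longrightarrow> onorm (\<lambda>k::real. k *\<^sub>R c) \<le> B"
  by (rule onorm_le) (simp add: mult.commute[of B] mult_left_mono)

text \<open>Joint continuity in the base point and the parameter gives one bound \<open>d\<close>
  for all base points near \<open>x\<close>. The chain rule needs this uniformity, since its base
  point moves with time.\<close>

lemma line_neighbourhood:
  fixes S :: "(nat \<Rightarrow> 'e::real_normed_vector) set"
  assumes "open S" "x \<in> S"
  shows "\<exists>W d. open W \<and> x \<in> W \<and> 0 < d \<and> (\<forall>w\<in>W. \<forall>s. \<bar>s\<bar> < d \<longrightarrow> w(j := w j + s *\<^sub>R b) \<in> S)"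
proof -
  let ?m = "\<lambda>p::(nat \<Rightarrow> 'e) \<times> real. (fst p)(j := fst p j + snd p *\<^sub>R b)"
  have "open (?m -` S)"
    using continuous_on_line[of UNIV j b] assms(1) by (simp add: continuous_on_open_vimage)
  moreover have "(x, 0) \<in> ?m -` S" using assms(2) by simp
  ultimately obtain W D where WD: "open W" "open D" "x \<in> W" "0 \<in> D" "W \<times> D \<subseteq> ?m -` S"
    by (elim open_prod_elim) auto
  from WD(2,4) obtain d where d: "d > 0" "ball 0 d \<subseteq> D" using open_contains_ball by blast
  show ?thesis
  proof (intro exI conjI ballI allI impI)
    show "open W" "x \<in> W" "0 < d" by fact+
    fix w s assume ws: "w \<in> W" "\<bar>s\<bar> < d"
    then have "s \<in> D" using d(2) by (auto simp: dist_real_def)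
    then have "(w, s) \<in> ?m -` S" using ws WD(5) by auto
    then show "w(j := w j + s *\<^sub>R b) \<in> S" by simp
  qed
qed

text \<open>One increment of the chain rule: slot \<open>j\<close> is moved by \<open>u t\<close> in
  direction \<open>b\<close> on top of a curve \<open>z\<close> along which \<open>H\<close> is
  already differentiable. The mean value inequality on the segment starting at \<open>z t\<close>,
  together with continuity of the partial derivative, makes the error small compared with
  \<open>t\<close>; of \<open>z\<close> itself this uses only continuity at 0.\<close>

lemma C_1_curve_step:
  fixes H :: "(nat \<Rightarrow> 'e::real_normed_vector) \<Rightarrow> 'b::real_normed_vector" and u :: "real \<Rightarrow> real"
  assumes S: "open S" and H: "C_k (Suc 0) n S H" and j: "j \<in> {1..n}" and z0: "z 0 \<in> S"
    and zc: "(z \<longlongrightarrow> z 0) (at 0)"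
    and A: "((\<lambda>t. H (z t)) has_vector_derivative A) (at 0)"
    and u0: "u 0 = 0" and u: "(u has_vector_derivative u') (at 0)"
  shows "((\<lambda>t. H ((z t)(j := z t j + u t *\<^sub>R b))) has_vector_derivative
     A + u' *\<^sub>R partial_deriv j b H (z 0)) (at 0)"
proof -
  let ?P = "partial_deriv j b H"
  define R where "R t = H ((z t)(j := z t j + u t *\<^sub>R b)) - H (z t) - u t *\<^sub>R ?P (z 0)" for t
  have Pc: "continuous_on S ?P" using C_k_partial[OF H j] by simp
  have uquot: "((\<lambda>t. u t / t) \<longlongrightarrow> u') (at 0)"
    using u u0 by (simp add: has_real_derivative_iff_has_vector_derivative[symmetric] DERIV_def)
  have ut: "(u \<longlongrightarrow> 0) (at 0)"
    using has_vector_derivative_continuous[OF u] u0 by (simp add: continuous_at)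
  have R0: "R 0 = 0" by (simp add: R_def u0)
  have "((\<lambda>t. norm (R t) / \<bar>t\<bar>) \<longlongrightarrow> 0) (at 0)"
  proof (rule tendstoI)
    fix e :: real assume e: "e > 0"
    \<comment> \<open>Near 0 the quotient \<open>u t / t\<close> is below \<open>|u'| + 1\<close> in
      absolute value, so an error of at most \<open>eps\<close> per unit of \<open>u t\<close>
      amounts to at most \<open>e / 2\<close> per unit of \<open>t\<close>.\<close>
    define eps where "eps = e / (2 * (\<bar>u'\<bar> + 1))"
    have eps: "eps > 0" using e by (simp add: eps_def)
    have "open {y \<in> S. dist (?P y) (?P (z 0)) < eps}"
    proof -
      have "open (S \<inter> ?P -` ball (?P (z 0)) eps)"
        using Pc S by (simp add: continuous_open_preimage)
      moreover have "S \<inter> ?P -` ball (?P (z 0)) eps = {y \<in> S. dist (?P y) (?P (z 0)) < eps}"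
        by (auto simp: dist_commute)
      ultimately show ?thesis by simp
    qed
    moreover have "z 0 \<in> {y \<in> S. dist (?P y) (?P (z 0)) < eps}" using z0 eps by simp
    ultimately have "\<exists>W d. open W \<and> z 0 \<in> W \<and> 0 < d \<and> (\<forall>w\<in>W. \<forall>s. \<bar>s\<bar> < d \<longrightarrow>
        w(j := w j + s *\<^sub>R b) \<in> {y \<in> S. dist (?P y) (?P (z 0)) < eps})"
      by (rule line_neighbourhood)
    then obtain W d where W: "open W" "z 0 \<in> W" "0 < d" and W4:
      "\<forall>w\<in>W. \<forall>s. \<bar>s\<bar> < d \<longrightarrow> w(j := w j + s *\<^sub>R b) \<in> {y \<in> S. dist (?P y) (?P (z 0)) < eps}"
      by (elim exE conjE)
    have ev1: "\<forall>\<^sub>F t in at 0. z t \<in> W" using topological_tendstoD[OF zc W(1,2)] .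
    have ev2: "\<forall>\<^sub>F t in at 0. \<bar>u t\<bar> < d" using tendstoD[OF ut W(3)] by simp
    have ev3: "\<forall>\<^sub>F t in at 0. \<bar>u t / t\<bar> < \<bar>u'\<bar> + 1"
      using order_tendstoD(2)[OF tendsto_rabs[OF uquot], of "\<bar>u'\<bar> + 1"] by simp
    have ev4: "\<forall>\<^sub>F t in at 0. t \<noteq> (0::real)" by (rule eventually_neq_at_within)
    show "\<forall>\<^sub>F t in at 0. dist (norm (R t) / \<bar>t\<bar>) 0 < e"
      using ev1 ev2 ev3 ev4
    proof eventually_elim
      fix t assume t: "z t \<in> W" "\<bar>u t\<bar> < d" "\<bar>u t / t\<bar> < \<bar>u'\<bar> + 1" "t \<noteq> 0"
      let ?c = "\<lambda>s. (z t)(j := z t j + s *\<^sub>R b)"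
      have seg: "\<bar>s\<bar> < d" if "s \<in> closed_segment 0 (u t)" for s
        using that t(2) by (auto simp: closed_segment_eq_real_ivl split: if_splits)
      have "norm (H (?c (u t)) - H (?c 0) - (u t - 0) *\<^sub>R ?P (z 0)) \<le> norm (u t - 0) * eps"
      proof -
        \<comment> \<open>Without the linear part, the derivative of \<open>G\<close> is the
          variation of \<open>?P\<close> along the segment, which is below
          \<open>eps\<close>.\<close>
        define G where "G s = H (?c s) - s *\<^sub>R ?P (z 0)" for s
        have "norm (G (u t) - G 0) \<le> eps * norm (u t - 0)"
        proof (rule differentiable_bound[where f' = "\<lambda>s h. h *\<^sub>R (?P (?c s) - ?P (z 0))" and S = "closed_segment 0 (u t)"])
          fix s assume s: "s \<in> closed_segment 0 (u t)"
          from W4 t(1) seg[OF s] have c: "?c s \<in> S" "dist (?P (?c s)) (?P (z 0)) < eps" by auto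
          have "(G has_vector_derivative ?P (?c s) - ?P (z 0)) (at s)"
            unfolding G_def by (intro has_vector_derivative_diff has_partial_deriv_at[OF H j c(1)]) (auto intro!: derivative_eq_intros)
          then show "(G has_derivative (\<lambda>h. h *\<^sub>R (?P (?c s) - ?P (z 0)))) (at s within closed_segment 0 (u t))"
            unfolding has_vector_derivative_def by (rule has_derivative_at_withinI)
          show "onorm (\<lambda>h. h *\<^sub>R (?P (?c s) - ?P (z 0))) \<le> eps"
            using c(2) by (intro onorm_scaleR_le) (simp add: dist_norm)
        qed auto
        then show ?thesis by (simp add: G_def algebra_simps)
      qed
      then have "norm (R t) \<le> \<bar>u t\<bar> * eps" by (simp add: R_def)
      then have "norm (R t) / \<bar>t\<bar> \<le> \<bar>u t / t\<bar> * eps"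
        using t(4) by (simp add: divide_right_mono abs_divide)
      also have "\<dots> \<le> (\<bar>u'\<bar> + 1) * eps" using t(3) eps by (intro mult_right_mono) auto
      also have "\<dots> = e / 2" by (simp add: eps_def field_simps)
      finally have "norm (R t) / \<bar>t\<bar> < e" using e by linarith
      then show "dist (norm (R t) / \<bar>t\<bar>) 0 < e" by (simp add: dist_real_def)
    qed
  qed
  then have "(R has_vector_derivative 0) (at 0)"
    by (simp add: has_vector_derivative_def has_derivative_at R0)
  from has_vector_derivative_add[OF has_vector_derivative_add[OF this A]
        bounded_linear.has_vector_derivative[OF bounded_linear_scaleR_left[of "?P (z 0)"] u]]
  show ?thesis by (simp add: R_def)
qed

text \<open>The curve \<open>y\<close> is reached from a constant curve by finitely many
  applications of the previous step, one for each pair of a slot and a basis vector. The basis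
  reduces vector increments to scalar ones.\<close>

lemma C_1_curve:
  fixes H :: "(nat \<Rightarrow> 'e::real_normed_vector) \<Rightarrow> 'b::real_normed_vector"
  assumes fd: "finite_dim (UNIV :: 'e set)"
    and S: "open S" and H: "C_k (Suc 0) n S H" and y0: "y 0 \<in> S"
    and dy: "\<And>j. j \<in> {1..n} \<Longrightarrow> ((\<lambda>t::real. y t j) has_vector_derivative y' j) (at 0)"
    and const: "\<And>t j. j \<notin> {1..n} \<Longrightarrow> y t j = y 0 j"
  shows "((\<lambda>t. H (y t)) has_vector_derivative
     (\<Sum>j=1..n. \<Sum>b\<in>fbasis. fcoord b (y' j) *\<^sub>R partial_deriv j b H (y 0))) (at 0)"
proof -
  \<comment> \<open>In \<open>z D\<close> only the coordinates listed in \<open>D\<close> follow the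
    curve \<open>y\<close>; all others stay at their values at time 0.\<close>
  define z where "z D t j = y 0 j + (\<Sum>d\<in>D. if fst d = j then fcoord (snd d) (y t j - y 0 j) *\<^sub>R snd d else 0)"
    for D :: "(nat \<times> 'e) set" and t j
  define P where "P = {1..n} \<times> (fbasis :: 'e set)"
  have finP: "finite P" unfolding P_def using fbasis(1)[OF fd] by simp
  have dcoord: "((\<lambda>t. fcoord b (y t j - y 0 j)) has_vector_derivative fcoord b (y' j)) (at 0)"
    if "j \<in> {1..n}" for j b
  proof -
    have "((\<lambda>t. y t j - y 0 j) has_vector_derivative y' j - 0) (at 0)"
      by (intro has_vector_derivative_diff dy[OF that]) (rule has_vector_derivative_const)
    from bounded_linear.has_vector_derivative[OF bounded_linear_fcoord[OF fd] this] show ?thesis by simp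
  qed
  have c0: "fcoord b 0 = 0" for b :: 'e by (rule linear_0[OF linear_fcoord[OF fd]])
  have z0: "z D 0 = y 0" for D by (auto simp: z_def fun_eq_iff c0 intro!: sum.neutral)
  have zlim: "(z D \<longlongrightarrow> z D 0) (at 0)" if "D \<subseteq> P" for D
  proof (rule tendsto_coordinatewise)
    fix i
    have "((\<lambda>t. if fst d = i then fcoord (snd d) (y t i - y 0 i) *\<^sub>R snd d else 0) \<longlongrightarrow> 0) (at 0)" if "d \<in> D" for d
    proof (cases "fst d = i")
      case True
      then have "i \<in> {1..n}" using that \<open>D \<subseteq> P\<close> by (auto simp: P_def)
      from has_vector_derivative_continuous[OF dcoord[OF this]]
      have "((\<lambda>t. fcoord (snd d) (y t i - y 0 i)) \<longlongrightarrow> 0) (at 0)" by (simp add: continuous_at c0)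
      from tendsto_scaleR[OF this tendsto_const[of "snd d"]] show ?thesis using True by simp
    qed simp
    from tendsto_sum[OF this] have "((\<lambda>t. (\<Sum>d\<in>D. if fst d = i then fcoord (snd d) (y t i - y 0 i) *\<^sub>R snd d else 0)) \<longlongrightarrow> (\<Sum>d\<in>D. 0)) (at 0)" .
    from tendsto_add[OF tendsto_const[of "y 0 i"] this]
    show "((\<lambda>t. z D t i) \<longlongrightarrow> z D 0 i) (at 0)" unfolding z0 by (simp add: z_def)
  qed
  have main: "D \<subseteq> P \<Longrightarrow> ((\<lambda>t. H (z D t)) has_vector_derivative
      (\<Sum>d\<in>D. fcoord (snd d) (y' (fst d)) *\<^sub>R partial_deriv (fst d) (snd d) H (y 0))) (at 0)"
    if "finite D" for D
    using that
  proof (induction D)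
    case empty
    then show ?case by (simp add: z_def)
  next
    case (insert d D)
    obtain j b where d: "d = (j, b)" by (cases d)
    have j: "j \<in> {1..n}" using insert.prems by (auto simp: P_def d)
    have upd: "z (insert d D) t = (z D t)(j := z D t j + fcoord b (y t j - y 0 j) *\<^sub>R b)" for t
      using insert.hyps by (auto simp: z_def d fun_eq_iff)
    have "((\<lambda>t. H ((z D t)(j := z D t j + fcoord b (y t j - y 0 j) *\<^sub>R b))) has_vector_derivative
       (\<Sum>d\<in>D. fcoord (snd d) (y' (fst d)) *\<^sub>R partial_deriv (fst d) (snd d) H (y 0))
       + fcoord b (y' j) *\<^sub>R partial_deriv j b H (z D 0)) (at 0)"
    proof (rule C_1_curve_step[OF S H j])
      show "z D 0 \<in> S" using y0 by (simp add: z0)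
      show "(z D \<longlongrightarrow> z D 0) (at 0)" using insert.prems by (intro zlim) simp
    qed (use insert dcoord[OF j] c0 in auto)
    moreover have "(\<Sum>d\<in>insert d D. fcoord (snd d) (y' (fst d)) *\<^sub>R partial_deriv (fst d) (snd d) H (y 0))
      = (\<Sum>d\<in>D. fcoord (snd d) (y' (fst d)) *\<^sub>R partial_deriv (fst d) (snd d) H (y 0))
       + fcoord b (y' j) *\<^sub>R partial_deriv j b H (z D 0)"
      using insert.hyps by (simp add: d z0 add.commute)
    ultimately show ?case by (simp only: upd)
  qed
  have zP: "z P t = y t" for t
  proof
    fix j
    show "z P t j = y t j"
    proof (cases "j \<in> {1..n}")
      case True
      have "(\<Sum>d\<in>P. if fst d = j then fcoord (snd d) (y t j - y 0 j) *\<^sub>R snd d else 0)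
        = (\<Sum>i\<in>{1..n}. \<Sum>b\<in>fbasis. if i = j then fcoord b (y t j - y 0 j) *\<^sub>R b else 0)"
        unfolding P_def by (simp add: sum.cartesian_product case_prod_beta)
      also have "\<dots> = (\<Sum>i\<in>{1..n}. if i = j then (\<Sum>b\<in>fbasis. fcoord b (y t j - y 0 j) *\<^sub>R b) else 0)"
        by (intro sum.cong) auto
      also have "\<dots> = y t j - y 0 j" using True by (simp add: fcoord_sum[OF fd])
      finally show ?thesis by (simp add: z_def)
    next
      case False
      then have "(\<Sum>d\<in>P. if fst d = j then fcoord (snd d) (y t j - y 0 j) *\<^sub>R snd d else 0) = 0"
        by (intro sum.neutral) (auto simp: P_def)
      then show ?thesis using const[OF False, of t] by (simp add: z_def)
    qed
  qed
  have "(\<Sum>d\<in>P. fcoord (snd d) (y' (fst d)) *\<^sub>R partial_deriv (fst d) (snd d) H (y 0))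
     = (\<Sum>j=1..n. \<Sum>b\<in>fbasis. fcoord b (y' j) *\<^sub>R partial_deriv j b H (y 0))"
    unfolding P_def by (simp add: sum.cartesian_product case_prod_beta)
  with main[OF finP subset_refl] show ?thesis by (simp add: zP)
qed

lemma continuous_on_family:
  fixes F :: "nat \<Rightarrow> 'a::topological_space \<Rightarrow> 'b::topological_space"
  assumes "\<And>j. j \<in> J \<Longrightarrow> continuous_on S (F j)" "\<And>x j. j \<notin> J \<Longrightarrow> F j x = z j"
  shows "continuous_on S (\<lambda>x j. F j x)"
proof (rule continuous_on_coordinatewise_then_product)
  fix j
  show "continuous_on S (\<lambda>x. F j x)"
    by (cases "j \<in> J") (simp_all add: assms)
qed

text \<open>By the chain rule the derivative is a sum of products of a coordinate of an inner
  derivative with a partial derivative of \<open>H\<close> along the inner functions, and the latter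
  is a composite of lower order. The inner functions beyond \<open>m\<close> are constant because
  the tuple has to be continuous in all its infinitely many entries.\<close>

lemma C_k_compose:
  fixes H :: "(nat \<Rightarrow> 'e::real_normed_vector) \<Rightarrow> 'b::real_normed_vector"
    and F :: "nat \<Rightarrow> (nat \<Rightarrow> 'd::real_normed_vector) \<Rightarrow> 'e"
  assumes fd: "finite_dim (UNIV :: 'e set)" and S: "open S" and T: "open T"
  shows "C_k k m T H \<Longrightarrow> (\<And>j. j \<in> {1..m} \<Longrightarrow> C_k k n S (F j)) \<Longrightarrow>
     (\<And>x j. j \<notin> {1..m} \<Longrightarrow> F j x = z j) \<Longrightarrow> (\<And>x. x \<in> S \<Longrightarrow> (\<lambda>j. F j x) \<in> T) \<Longrightarrow>
     C_k k n S (\<lambda>x. H (\<lambda>j. F j x))"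
proof (induction k arbitrary: H)
  case 0
  have "continuous_on S (\<lambda>x j. F j x)"
    by (rule continuous_on_family[of "{1..m}", OF _ 0(3)]) (use 0(2) in simp)
  then show ?case unfolding C_k.simps
    by (rule continuous_on_compose2[OF 0(1)[unfolded C_k.simps]]) (use 0(4) in auto)
next
  case (Suc k)
  have cc: "continuous_on S (\<lambda>x j. F j x)"
    by (rule continuous_on_family[of "{1..m}", OF C_k_continuous[OF Suc.prems(2)] Suc.prems(3)])
  show ?case
  proof (rule C_k_SucI[where F' = "\<lambda>i v x. \<Sum>j=1..m. \<Sum>b\<in>fbasis.
        fcoord b (partial_deriv i v (F j) x) *\<^sub>R partial_deriv j b H (\<lambda>j. F j x)", OF S])
    show "continuous_on S (\<lambda>x. H (\<lambda>j. F j x))"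
      by (rule continuous_on_compose2[OF C_k_continuous[OF Suc.prems(1)] cc]) (use Suc.prems(4) in auto)
    fix i v assume i: "i \<in> {1..n}"
    show "C_k k n S (\<lambda>x. \<Sum>j = 1..m. \<Sum>b\<in>fbasis.
        fcoord b (partial_deriv i v (F j) x) *\<^sub>R partial_deriv j b H (\<lambda>j. F j x))"
    proof (rule C_k_sum[OF S], rule C_k_sum[OF S])
      fix j b assume j: "j \<in> {1..m}"
      show "C_k k n S (\<lambda>x. fcoord b (partial_deriv i v (F j) x) *\<^sub>R partial_deriv j b H (\<lambda>j. F j x))"
      proof (rule C_k_scaleR[OF S])
        show "C_k k n S (\<lambda>x. fcoord b (partial_deriv i v (F j) x))"
          by (rule C_k_linear[OF S bounded_linear_fcoord[OF fd] C_k_partial[OF Suc.prems(2)[OF j] i]])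
        show "C_k k n S (\<lambda>x. partial_deriv j b H (\<lambda>j. F j x))"
          by (rule Suc.IH[OF C_k_partial[OF Suc.prems(1) j] C_k_Suc_imp[OF Suc.prems(2)]])
            (use Suc.prems(3,4) in auto)
      qed
    qed
    fix x assume x: "x \<in> S"
    have "((\<lambda>t. H ((\<lambda>t j. F j (x(i := x i + t *\<^sub>R v))) t)) has_vector_derivative
        (\<Sum>j=1..m. \<Sum>b\<in>fbasis. fcoord b (partial_deriv i v (F j) x) *\<^sub>R
          partial_deriv j b H ((\<lambda>t j. F j (x(i := x i + t *\<^sub>R v))) 0))) (at 0)"
    proof (rule C_1_curve[OF fd T C_k_mono[OF Suc.prems(1)]])
      show "(\<lambda>j. F j (x(i := x i + 0 *\<^sub>R v))) \<in> T" using Suc.prems(4)[OF x] by simp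
      show "((\<lambda>t. F j (x(i := x i + t *\<^sub>R v))) has_vector_derivative partial_deriv i v (F j) x) (at 0)"
        if "j \<in> {1..m}" for j by (rule has_partial_deriv[OF Suc.prems(2)[OF that] i x])
      show "F j (x(i := x i + t *\<^sub>R v)) = F j (x(i := x i + 0 *\<^sub>R v))" if "j \<notin> {1..m}" for t j
        using Suc.prems(3)[OF that] by simp
    qed simp
    then show "((\<lambda>t. H (\<lambda>j. F j (x(i := x i + t *\<^sub>R v)))) has_vector_derivative
        (\<Sum>j=1..m. \<Sum>b\<in>fbasis. fcoord b (partial_deriv i v (F j) x) *\<^sub>R
          partial_deriv j b H (\<lambda>j. F j x))) (at 0)"
      by simp
  qed
qed

text \<open>The mean value inequality is used twice: for \<open>a s\<close> in the variable
  \<open>t\<close>, then for the difference \<open>g s h - g s 0\<close> in the variable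
  \<open>s\<close>. Only the derivatives in this order are assumed, so the other order is covered by
  exchanging the variables.\<close>

lemma mixed_difference_bound:
  fixes g :: "real \<Rightarrow> real \<Rightarrow> 'b::real_normed_vector"
  assumes g: "\<And>s t. \<bar>s\<bar> < d \<Longrightarrow> \<bar>t\<bar> < d \<Longrightarrow> ((\<lambda>s. g s t) has_vector_derivative a s t) (at s)"
    and a: "\<And>s t. \<bar>s\<bar> < d \<Longrightarrow> \<bar>t\<bar> < d \<Longrightarrow> ((\<lambda>t. a s t) has_vector_derivative A s t) (at t)"
    and A: "\<And>s t. \<bar>s\<bar> < d \<Longrightarrow> \<bar>t\<bar> < d \<Longrightarrow> norm (A s t - A0) \<le> e"
    and h: "0 < h" "h < d"
  shows "norm (g h h - g h 0 - g 0 h + g 0 0 - (h * h) *\<^sub>R A0) \<le> e * h * h"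
proof -
  have bd: "norm (a s h - a s 0 - h *\<^sub>R A0) \<le> e * h" if s: "s \<in> {0..h}" for s
  proof -
    have "norm ((\<lambda>t. a s t - t *\<^sub>R A0) h - (\<lambda>t. a s t - t *\<^sub>R A0) 0) \<le> e * norm (h - 0)"
    proof (rule differentiable_bound[where f' = "\<lambda>t k. k *\<^sub>R (A s t - A0)" and S = "{0..h}"])
      fix t assume t: "t \<in> {0..h}"
      have "((\<lambda>t. a s t - t *\<^sub>R A0) has_vector_derivative A s t - A0) (at t)"
        using s t h by (intro has_vector_derivative_diff a) (auto intro!: derivative_eq_intros)
      then show "((\<lambda>t. a s t - t *\<^sub>R A0) has_derivative (\<lambda>k. k *\<^sub>R (A s t - A0))) (at t within {0..h})"
        unfolding has_vector_derivative_def by (rule has_derivative_at_withinI)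
      show "onorm (\<lambda>k. k *\<^sub>R (A s t - A0)) \<le> e"
        using A[of s t] s t h by (intro onorm_scaleR_le) simp
    qed (use h in auto)
    then show ?thesis using h by (simp add: algebra_simps)
  qed
  have "norm ((\<lambda>s. g s h - g s 0 - (s * h) *\<^sub>R A0) h - (\<lambda>s. g s h - g s 0 - (s * h) *\<^sub>R A0) 0) \<le> (e * h) * norm (h - 0)"
  proof (rule differentiable_bound[where f' = "\<lambda>s k. k *\<^sub>R (a s h - a s 0 - h *\<^sub>R A0)" and S = "{0..h}"])
    fix s assume s: "s \<in> {0..h}"
    have "((\<lambda>s. g s h - g s 0 - (s * h) *\<^sub>R A0) has_vector_derivative a s h - a s 0 - h *\<^sub>R A0) (at s)"
      using s h by (intro has_vector_derivative_diff g) (auto intro!: derivative_eq_intros)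
    then show "((\<lambda>s. g s h - g s 0 - (s * h) *\<^sub>R A0) has_derivative (\<lambda>k. k *\<^sub>R (a s h - a s 0 - h *\<^sub>R A0))) (at s within {0..h})"
      unfolding has_vector_derivative_def by (rule has_derivative_at_withinI)
    show "onorm (\<lambda>k. k *\<^sub>R (a s h - a s 0 - h *\<^sub>R A0)) \<le> e * h"
      by (rule onorm_scaleR_le[OF bd[OF s]])
  qed (use h in auto)
  then show ?thesis using h by (simp add: algebra_simps)
qed

text \<open>Both iterated derivatives are approximated by the same second difference quotient.\<close>

lemma partial_deriv_commute:
  fixes F :: "(nat \<Rightarrow> 'e::real_normed_vector) \<Rightarrow> 'b::real_normed_vector"
  assumes S: "open S" and F: "C_k (Suc (Suc 0)) n S F" and ij: "i \<in> {1..n}" "j \<in> {1..n}" "i \<noteq> j" and x: "x \<in> S"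
  shows "partial_deriv i v (partial_deriv j w F) x = partial_deriv j w (partial_deriv i v F) x"
proof -
  let ?A = "partial_deriv j w (partial_deriv i v F)" and ?B = "partial_deriv i v (partial_deriv j w F)"
  have cA: "continuous_on S ?A" using C_k_partial[OF C_k_partial[OF F ij(1)] ij(2)] by simp
  have cB: "continuous_on S ?B" using C_k_partial[OF C_k_partial[OF F ij(2)] ij(1)] by simp
  have le: "norm (?A x - ?B x) \<le> 2 * e" if e: "e > 0" for e
  proof -
    have "open (S \<inter> ?A -` ball (?A x) e)" "open (S \<inter> ?B -` ball (?B x) e)"
      using cA cB S by (simp_all add: continuous_open_preimage)
    then have "open ((S \<inter> ?A -` ball (?A x) e) \<inter> (S \<inter> ?B -` ball (?B x) e))" by blast
    moreover have "x \<in> (S \<inter> ?A -` ball (?A x) e) \<inter> (S \<inter> ?B -` ball (?B x) e)" using x e by simp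
    ultimately have "\<exists>W d1. open W \<and> x \<in> W \<and> 0 < d1 \<and> (\<forall>y\<in>W. \<forall>s. \<bar>s\<bar> < d1 \<longrightarrow>
        y(j := y j + s *\<^sub>R w) \<in> (S \<inter> ?A -` ball (?A x) e) \<inter> (S \<inter> ?B -` ball (?B x) e))"
      by (rule line_neighbourhood)
    then obtain W d1 where W: "open W" "x \<in> W" "0 < d1" "\<forall>y\<in>W. \<forall>s. \<bar>s\<bar> < d1 \<longrightarrow>
        y(j := y j + s *\<^sub>R w) \<in> (S \<inter> ?A -` ball (?A x) e) \<inter> (S \<inter> ?B -` ball (?B x) e)"
      by (elim exE conjE)
    obtain d2 where W': "0 < d2" "\<forall>s. \<bar>s\<bar> < d2 \<longrightarrow> x(i := x i + s *\<^sub>R v) \<in> W"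
      using line_neighbourhood[OF W(1,2), of i v] by (elim exE conjE) (rule that, assumption, drule (1) bspec)
    define d where "d = min d1 d2"
    define P where "P s t = x(i := x i + s *\<^sub>R v, j := x j + t *\<^sub>R w)" for s t
    have P1: "P s t = (x(j := x j + t *\<^sub>R w))(i := (x(j := x j + t *\<^sub>R w)) i + s *\<^sub>R v)" for s t
      using ij(3) by (auto simp: P_def fun_eq_iff)
    have P2: "P s t = (x(i := x i + s *\<^sub>R v))(j := (x(i := x i + s *\<^sub>R v)) j + t *\<^sub>R w)" for s t
      using ij(3) by (auto simp: P_def fun_eq_iff)
    have Pin: "P s t \<in> S" "dist (?A x) (?A (P s t)) < e" "dist (?B x) (?B (P s t)) < e"
      if "\<bar>s\<bar> < d" "\<bar>t\<bar> < d" for s t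
    proof -
      have "x(i := x i + s *\<^sub>R v) \<in> W" using W'(2) that by (simp add: d_def)
      with W(4) have "P s t \<in> (S \<inter> ?A -` ball (?A x) e) \<inter> (S \<inter> ?B -` ball (?B x) e)"
        unfolding P2 using that(2)[unfolded d_def min_less_iff_conj] by blast
      then show "P s t \<in> S" "dist (?A x) (?A (P s t)) < e" "dist (?B x) (?B (P s t)) < e" by simp_all
    qed
    have d: "d > 0" using W(3) W'(1) by (simp add: d_def)
    define h where "h = d / 2"
    have h: "0 < h" "h < d" using d by (simp_all add: h_def)
    have 1: "norm (F (P h h) - F (P h 0) - F (P 0 h) + F (P 0 0) - (h * h) *\<^sub>R ?A x) \<le> e * h * h"
    proof (rule mixed_difference_bound[where d = d and a = "\<lambda>s t. partial_deriv i v F (P s t)" and A = "\<lambda>s t. ?A (P s t)"])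
      fix s t assume st: "\<bar>s\<bar> < d" "\<bar>t\<bar> < d"
      show "((\<lambda>s. F (P s t)) has_vector_derivative partial_deriv i v F (P s t)) (at s)"
        unfolding P1 by (rule has_partial_deriv_at[OF F ij(1) Pin(1)[OF st, unfolded P1]])
      show "((\<lambda>t. partial_deriv i v F (P s t)) has_vector_derivative ?A (P s t)) (at t)"
        unfolding P2 by (rule has_partial_deriv_at[OF C_k_partial[OF F ij(1)] ij(2) Pin(1)[OF st, unfolded P2]])
      show "norm (?A (P s t) - ?A x) \<le> e" using Pin(2)[OF st] by (simp add: dist_norm norm_minus_commute)
    qed (use h in auto)
    have 2: "norm ((\<lambda>t s. F (P s t)) h h - (\<lambda>t s. F (P s t)) h 0 - (\<lambda>t s. F (P s t)) 0 h + (\<lambda>t s. F (P s t)) 0 0 - (h * h) *\<^sub>R ?B x) \<le> e * h * h"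
    proof (rule mixed_difference_bound[where d = d and a = "\<lambda>t s. partial_deriv j w F (P s t)" and A = "\<lambda>t s. ?B (P s t)"])
      fix t s assume st: "\<bar>t\<bar> < d" "\<bar>s\<bar> < d"
      show "((\<lambda>t. F (P s t)) has_vector_derivative partial_deriv j w F (P s t)) (at t)"
        unfolding P2 by (rule has_partial_deriv_at[OF F ij(2) Pin(1)[OF st(2,1), unfolded P2]])
      show "((\<lambda>s. partial_deriv j w F (P s t)) has_vector_derivative ?B (P s t)) (at s)"
        unfolding P1 by (rule has_partial_deriv_at[OF C_k_partial[OF F ij(2)] ij(1) Pin(1)[OF st(2,1), unfolded P1]])
      show "norm (?B (P s t) - ?B x) \<le> e" using Pin(3)[OF st(2,1)] by (simp add: dist_norm norm_minus_commute)
    qed (use h in auto)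
    let ?D = "F (P h h) - F (P h 0) - F (P 0 h) + F (P 0 0)"
    have "(h * h) *\<^sub>R (?A x - ?B x) = (?D - (h * h) *\<^sub>R ?B x) - (?D - (h * h) *\<^sub>R ?A x)"
      by (simp add: algebra_simps)
    also have "norm \<dots> \<le> e * h * h + e * h * h"
      using norm_triangle_le_diff[of "?D - (h * h) *\<^sub>R ?B x" "?D - (h * h) *\<^sub>R ?A x" "e * h * h + e * h * h"] 1 2
      by (simp add: algebra_simps)
    finally have "h * h * norm (?A x - ?B x) \<le> h * h * (2 * e)"
      unfolding norm_scaleR by (simp add: mult.commute mult.left_commute)
    then show ?thesis using h by (simp add: mult_le_cancel_left)
  qed
  have "norm (?A x - ?B x) \<le> 0 + e" if "e > 0" for e using le[of "e / 2"] that by simp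
  then have "norm (?A x - ?B x) \<le> 0" by (rule field_le_epsilon)
  then show ?thesis by simp
qed

section \<open>Integrals depending on a parameter\<close>

text \<open>Smoothness in \<open>x\<close> with a parameter \<open>k\<close> from a mere topological
  space: the derivatives in \<open>x\<close> are jointly continuous in \<open>x\<close> and
  \<open>k\<close>, and \<open>k\<close> is never differentiated. Over a compact \<open>K\<close>
  this suffices for differentiation under the integral.\<close>

primrec C_kp :: "nat \<Rightarrow> nat \<Rightarrow> (nat \<Rightarrow> 'e::real_normed_vector) set \<Rightarrow> 'k::topological_space set
    \<Rightarrow> ((nat \<Rightarrow> 'e) \<Rightarrow> 'k \<Rightarrow> 'b::real_normed_vector) \<Rightarrow> bool" where
  "C_kp 0 n S K H \<longleftrightarrow> continuous_on (S \<times> K) (\<lambda>y. H (fst y) (snd y))"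
| "C_kp (Suc m) n S K H \<longleftrightarrow> continuous_on (S \<times> K) (\<lambda>y. H (fst y) (snd y)) \<and>
     (\<forall>i\<in>{1..n}. \<forall>v. (\<forall>x\<in>S. \<forall>k\<in>K. (\<lambda>t::real. H (x(i := x i + t *\<^sub>R v)) k) differentiable (at 0))
        \<and> C_kp m n S K (\<lambda>x k. partial_deriv i v (\<lambda>x. H x k) x))"

declare C_kp.simps(2) [simp del]

lemma C_kp_continuous: "C_kp m n S K H \<Longrightarrow> continuous_on (S \<times> K) (\<lambda>y. H (fst y) (snd y))"
  by (cases m) (simp_all add: C_kp.simps(2))

lemma C_kp_partial:
  "C_kp (Suc m) n S K H \<Longrightarrow> i \<in> {1..n} \<Longrightarrow> C_kp m n S K (\<lambda>x k. partial_deriv i v (\<lambda>x. H x k) x)"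
  by (simp only: C_kp.simps)

lemma C_kp_differentiable:
  "C_kp (Suc m) n S K H \<Longrightarrow> i \<in> {1..n} \<Longrightarrow> x \<in> S \<Longrightarrow> k \<in> K \<Longrightarrow>
    (\<lambda>t::real. H (x(i := x i + t *\<^sub>R v)) k) differentiable (at 0)"
  by (simp only: C_kp.simps)

lemma continuous_on_slice1:
  assumes "continuous_on (S \<times> K) (\<lambda>y. H (fst y) (snd y))" "k \<in> K"
  shows "continuous_on S (\<lambda>x. H x k)"
proof -
  have "continuous_on S (\<lambda>x. (\<lambda>y. H (fst y) (snd y)) (x, k))"
    by (rule continuous_on_compose2[OF assms(1)]) (use assms(2) in \<open>auto intro!: continuous_intros\<close>)
  then show ?thesis by simp
qed

lemma continuous_on_slice2:
  assumes "continuous_on (S \<times> K) (\<lambda>y. H (fst y) (snd y))" "x \<in> S"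
  shows "continuous_on K (H x)"
proof -
  have "continuous_on K (\<lambda>k. (\<lambda>y. H (fst y) (snd y)) (x, k))"
    by (rule continuous_on_compose2[OF assms(1)]) (use assms(2) in \<open>auto intro!: continuous_intros\<close>)
  then show ?thesis by simp
qed

lemma C_kp_slice: "C_kp m n S K H \<Longrightarrow> k \<in> K \<Longrightarrow> C_k m n S (\<lambda>x. H x k)"
proof (induction m arbitrary: H)
  case 0
  then show ?case using continuous_on_slice1[of S K H k] by simp
next
  case (Suc m)
  show ?case unfolding C_k.simps
  proof (intro conjI ballI allI)
    show "continuous_on S (\<lambda>x. H x k)"
      by (rule continuous_on_slice1[OF C_kp_continuous[OF Suc.prems(1)] Suc.prems(2)])
    fix i v assume i: "i \<in> {1..n}"
    show "C_k m n S (partial_deriv i v (\<lambda>x. H x k))"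
      by (rule Suc.IH[OF C_kp_partial[OF Suc.prems(1) i] Suc.prems(2)])
    show "(\<lambda>t::real. H (x(i := x i + t *\<^sub>R v)) k) differentiable (at 0)" if "x \<in> S" for x
      by (rule C_kp_differentiable[OF Suc.prems(1) i that Suc.prems(2)])
  qed
qed

text \<open>Locality in the parameter: there are no global coordinates on \<open>K\<close>, so it
  will be covered by charts of the group.\<close>

lemma C_kp_local:
  fixes H :: "(nat \<Rightarrow> 'e::real_normed_vector) \<Rightarrow> 'k::t2_space \<Rightarrow> 'b::real_normed_vector"
  assumes S: "open S"
  shows "(\<And>k. k \<in> K \<Longrightarrow> \<exists>U. open U \<and> k \<in> U \<and> C_kp m n S U H) \<Longrightarrow> C_kp m n S K H"
proof (induction m arbitrary: H)
  case 0
  have "continuous_on (S \<times> K) (\<lambda>y. H (fst y) (snd y))"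
  proof (rule continuous_on_local)
    fix y assume y: "y \<in> S \<times> K"
    from 0[of "snd y"] y obtain U where U: "open U" "snd y \<in> U" "C_kp 0 n S U H" by auto
    have "open (S \<times> U)" using S U(1) by (rule open_Times)
    then show "\<exists>U. open U \<and> y \<in> U \<and> continuous_on U (\<lambda>y. H (fst y) (snd y))"
      using U y by (intro exI[of _ "S \<times> U"] conjI) (auto simp: mem_Times_iff)
  qed
  then show ?case by simp
next
  case (Suc m)
  show ?case unfolding C_kp.simps
  proof (intro conjI ballI allI)
    show "continuous_on (S \<times> K) (\<lambda>y. H (fst y) (snd y))"
    proof (rule continuous_on_local)
      fix y assume y: "y \<in> S \<times> K"
      then have "snd y \<in> K" by auto
      from Suc.prems[OF this] obtain U where U: "open U" "snd y \<in> U" "C_kp (Suc m) n S U H" by (elim exE conjE)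
      have "open (S \<times> U)" using S U(1) by (rule open_Times)
      then show "\<exists>U. open U \<and> y \<in> U \<and> continuous_on U (\<lambda>y. H (fst y) (snd y))"
        using U(2) y C_kp_continuous[OF U(3)] by (intro exI[of _ "S \<times> U"] conjI) (auto simp: mem_Times_iff)
    qed
    fix i v assume i: "i \<in> {1..n}"
    show "C_kp m n S K (\<lambda>x k. partial_deriv i v (\<lambda>x. H x k) x)"
    proof (rule Suc.IH)
      fix k assume "k \<in> K"
      from Suc.prems[OF this] obtain U where U: "open U" "k \<in> U" "C_kp (Suc m) n S U H" by (elim exE conjE)
      then show "\<exists>U. open U \<and> k \<in> U \<and> C_kp m n S U (\<lambda>x k. partial_deriv i v (\<lambda>x. H x k) x)"
        using C_kp_partial[OF U(3) i] by (intro exI conjI)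
    qed
    fix x k assume x: "x \<in> S" and "k \<in> K"
    from Suc.prems[OF this(2)] obtain U where U: "open U" "k \<in> U" "C_kp (Suc m) n S U H" by (elim exE conjE)
    show "(\<lambda>t::real. H (x(i := x i + t *\<^sub>R v)) k) differentiable (at 0)"
      by (rule C_kp_differentiable[OF U(3) i x U(2)])
  qed
qed

text \<open>The parameter becomes slot \<open>n + 1\<close> through its coordinates
  \<open>c k\<close>; joint continuity is then inherited from continuity in all \<open>n + 1\<close>
  slots.\<close>

lemma C_kp_of_C_k:
  fixes h :: "(nat \<Rightarrow> 'e::real_normed_vector) \<Rightarrow> 'b::real_normed_vector" and c :: "'k::topological_space \<Rightarrow> 'e"
  assumes c: "continuous_on U c" and ST: "\<And>x k. x \<in> S \<Longrightarrow> k \<in> U \<Longrightarrow> x(Suc n := c k) \<in> T"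
  shows "C_k m (Suc n) T h \<Longrightarrow> (\<And>x k. k \<in> U \<Longrightarrow> H x k = h (x(Suc n := c k))) \<Longrightarrow> C_kp m n S U H"
proof (induction m arbitrary: h H)
  have cont: "continuous_on (S \<times> U) (\<lambda>y. H (fst y) (snd y))"
    if h: "continuous_on T h" and H: "\<And>x k. k \<in> U \<Longrightarrow> H x k = h (x(Suc n := c k))"
    for h :: "(nat \<Rightarrow> 'e) \<Rightarrow> 'b" and H :: "(nat \<Rightarrow> 'e) \<Rightarrow> 'k \<Rightarrow> 'b"
  proof -
    have "continuous_on (S \<times> U) (\<lambda>y. (fst y)(Suc n := c (snd y)))"
    proof (rule continuous_on_coordinatewise_then_product)
      fix i
      have "continuous_on (S \<times> U) (\<lambda>y. fst y i)"
        by (rule continuous_on_compose2[OF continuous_on_coord[of UNIV]]) (auto intro: continuous_intros)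
      moreover have "continuous_on (S \<times> U) (\<lambda>y. c (snd y))"
        by (rule continuous_on_compose2[OF c]) (auto intro: continuous_intros)
      ultimately show "continuous_on (S \<times> U) (\<lambda>y. ((fst y)(Suc n := c (snd y))) i)" by (cases "i = Suc n") auto
    qed
    moreover have "(\<lambda>y. (fst y)(Suc n := c (snd y))) ` (S \<times> U) \<subseteq> T" using ST by auto
    ultimately have "continuous_on (S \<times> U) (\<lambda>y. h ((fst y)(Suc n := c (snd y))))"
      by (rule continuous_on_compose2[OF h])
    moreover have "continuous_on (S \<times> U) (\<lambda>y. H (fst y) (snd y)) \<longleftrightarrow> continuous_on (S \<times> U) (\<lambda>y. h ((fst y)(Suc n := c (snd y))))"
      by (rule continuous_on_cong) (auto simp: H)
    ultimately show ?thesis by simp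
  qed
  {
    case 0
    from cont[OF 0(1)[unfolded C_k.simps] 0(2)] show ?case by simp
  next
    case (Suc m)
  show ?case unfolding C_kp.simps
  proof (intro conjI ballI allI)
    show "continuous_on (S \<times> U) (\<lambda>y. H (fst y) (snd y))" by (rule cont[OF C_k_continuous[OF Suc.prems(1)] Suc.prems(2)])
    fix i v assume i: "i \<in> {1..n}"
    then have i': "i \<in> {1..Suc n}" and ne: "i \<noteq> Suc n" by auto
    have eq: "H (x(i := x i + t *\<^sub>R v)) k = h ((x(Suc n := c k))(i := (x(Suc n := c k)) i + t *\<^sub>R v))"
      if "k \<in> U" for x k t
    proof -
      have "x(i := x i + t *\<^sub>R v, Suc n := c k) = (x(Suc n := c k))(i := (x(Suc n := c k)) i + t *\<^sub>R v)"
        using ne by (auto simp: fun_eq_iff)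
      then show ?thesis by (simp only: Suc.prems(2)[OF that])
    qed
    show "C_kp m n S U (\<lambda>x k. partial_deriv i v (\<lambda>x. H x k) x)"
    proof (rule Suc.IH[OF C_k_partial[OF Suc.prems(1) i']])
      fix x k assume k: "k \<in> U"
      show "partial_deriv i v (\<lambda>x. H x k) x = partial_deriv i v h (x(Suc n := c k))"
        unfolding partial_deriv_def by (simp only: eq[OF k])
    qed
    fix x k assume x: "x \<in> S" and k: "k \<in> U"
    show "(\<lambda>t::real. H (x(i := x i + t *\<^sub>R v)) k) differentiable (at 0)"
      unfolding eq[OF k] by (rule C_k_differentiable[OF Suc.prems(1) i' ST[OF x k]])
  qed
  }
qed

locale compact_prob =
  fixes K :: "'k::t2_space set" and \<mu> :: "'k measure"
  assumes compact_K: "compact K" and prob: "prob_space \<mu>" and space_\<mu>: "space \<mu> = K"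
    and sets_\<mu>: "sets \<mu> = sets (restrict_space borel K)"
begin

lemma integrable:
  fixes \<phi> :: "'k \<Rightarrow> 'v::{banach, second_countable_topology}"
  assumes "continuous_on K \<phi>"
  shows "integrable \<mu> \<phi>"
proof -
  interpret prob_space \<mu> by (rule prob)
  have "\<phi> \<in> borel_measurable (restrict_space borel K)"
    by (rule borel_measurable_continuous_on_restrict[OF assms])
  then have m: "\<phi> \<in> borel_measurable \<mu>" using measurable_cong_sets[OF sets_\<mu> refl] by blast
  have "bounded (\<phi> ` K)" by (rule compact_imp_bounded[OF compact_continuous_image[OF assms compact_K]])
  then obtain B where "\<And>k. k \<in> K \<Longrightarrow> norm (\<phi> k) \<le> B" unfolding bounded_iff by auto
  then show ?thesis by (intro integrable_const_bound[OF _ m, of B] AE_I2) (simp add: space_\<mu>)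
qed

lemma norm_integral_le:
  fixes \<phi> :: "'k \<Rightarrow> 'v::{banach, second_countable_topology}"
  assumes "continuous_on K \<phi>" "\<And>k. k \<in> K \<Longrightarrow> norm (\<phi> k) \<le> e"
  shows "norm (\<integral>k. \<phi> k \<partial>\<mu>) \<le> e"
proof -
  interpret prob_space \<mu> by (rule prob)
  have "norm (\<integral>k. \<phi> k \<partial>\<mu>) \<le> (\<integral>k. norm (\<phi> k) \<partial>\<mu>)" by (rule integral_norm_bound)
  also have "\<dots> \<le> (\<integral>k. e \<partial>\<mu>)"
    by (intro integral_mono integrable continuous_on_norm assms) (auto simp: space_\<mu> intro: assms)
  also have "\<dots> = e" by (simp add: prob_space)
  finally show ?thesis .
qed

lemma integral_cong_K:
  assumes "\<And>k. k \<in> K \<Longrightarrow> \<phi> k = \<psi> k"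
  shows "(\<integral>k. \<phi> k \<partial>\<mu>) = (\<integral>k. \<psi> k \<partial>\<mu>)"
  by (rule Bochner_Integration.integral_cong) (simp_all add: space_\<mu> assms)

text \<open>By compactness of \<open>K\<close> the integrand is close to its value at
  \<open>x0\<close> uniformly in \<open>k\<close>, and the total mass is 1.\<close>

lemma continuous_on_integral:
  fixes H :: "'x::topological_space \<Rightarrow> 'k \<Rightarrow> 'v::{banach, second_countable_topology}"
  assumes H: "continuous_on (S \<times> K) (\<lambda>y. H (fst y) (snd y))"
  shows "continuous_on S (\<lambda>x. \<integral>k. H x k \<partial>\<mu>)"
  unfolding continuous_on_def
proof (intro ballI tendstoI)
  fix x0 and e :: real assume x0: "x0 \<in> S" and e: "e > 0"
  obtain X0 where X0: "x0 \<in> X0" "open X0"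
    "\<forall>x\<in>X0 \<inter> S. \<forall>k\<in>K. dist ((\<lambda>y. H (fst y) (snd y)) (x, k)) ((\<lambda>y. H (fst y) (snd y)) (x0, k)) \<le> e / 2"
    using continuous_on_prod_compactE[OF H compact_K x0, of "e / 2"] e by auto
  show "\<forall>\<^sub>F x in at x0 within S. dist (\<integral>k. H x k \<partial>\<mu>) (\<integral>k. H x0 k \<partial>\<mu>) < e"
    unfolding eventually_at_topological
  proof (intro exI[of _ X0] conjI ballI impI)
    fix x assume x: "x \<in> X0" "x \<noteq> x0" "x \<in> S"
    have c: "continuous_on K (H x)" "continuous_on K (H x0)"
      using continuous_on_slice2[OF H] x x0 by auto
    have "norm (\<integral>k. H x k - H x0 k \<partial>\<mu>) \<le> e / 2"
      using X0(3) x by (intro norm_integral_le continuous_on_diff c) (auto simp: dist_norm)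
    also have "(\<integral>k. H x k - H x0 k \<partial>\<mu>) = (\<integral>k. H x k \<partial>\<mu>) - (\<integral>k. H x0 k \<partial>\<mu>)"
      by (rule Bochner_Integration.integral_diff[OF integrable[OF c(1)] integrable[OF c(2)]])
    finally show "dist (\<integral>k. H x k \<partial>\<mu>) (\<integral>k. H x0 k \<partial>\<mu>) < e" using e by (simp add: dist_norm)
  qed (use X0 in auto)
qed

text \<open>The mean value inequality bounds the remainder for each \<open>k\<close> by the
  variation of \<open>h'\<close>. Compactness makes this bound uniform in \<open>k\<close>, so that
  it survives integration.\<close>

lemma has_vector_derivative_integral:
  fixes h :: "real \<Rightarrow> 'k \<Rightarrow> 'v::{banach, second_countable_topology}"
  assumes d: "d > 0"
    and h: "\<And>t k. \<bar>t\<bar> < d \<Longrightarrow> k \<in> K \<Longrightarrow> ((\<lambda>t. h t k) has_vector_derivative h' t k) (at t)"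
    and hc: "\<And>t. \<bar>t\<bar> < d \<Longrightarrow> continuous_on K (h t)"
    and h'c: "continuous_on ({-d<..<d} \<times> K) (\<lambda>y. h' (fst y) (snd y))"
  shows "((\<lambda>t. \<integral>k. h t k \<partial>\<mu>) has_vector_derivative (\<integral>k. h' 0 k \<partial>\<mu>)) (at 0)"
  unfolding has_vector_derivative_def has_derivative_at_alt
proof (intro conjI allI impI bounded_linear_scaleR_left)
  fix e :: real assume e: "e > 0"
  have "(0::real) \<in> {-d<..<d}" using d by simp
  then obtain X0 where X0: "0 \<in> X0" "open X0"
    "\<forall>x\<in>X0 \<inter> {-d<..<d}. \<forall>k\<in>K. dist ((\<lambda>y. h' (fst y) (snd y)) (x, k)) ((\<lambda>y. h' (fst y) (snd y)) (0, k)) \<le> e"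
    using continuous_on_prod_compactE[OF h'c compact_K _ e] by blast
  obtain r where r: "r > 0" "ball 0 r \<subseteq> X0" using X0(1,2) open_contains_ball by blast
  have c0: "continuous_on K (h' 0)" by (rule continuous_on_slice2[OF h'c]) (use d in simp)
  have h0c: "continuous_on K (h 0)" using hc[of 0] d by simp
  show "\<exists>r>0. \<forall>y. norm (y - 0) < r \<longrightarrow>
      norm ((\<integral>k. h y k \<partial>\<mu>) - (\<integral>k. h 0 k \<partial>\<mu>) - (y - 0) *\<^sub>R (\<integral>k. h' 0 k \<partial>\<mu>)) \<le> e * norm (y - 0)"
  proof (intro exI[of _ "min r d"] conjI allI impI)
    fix t :: real assume t: "norm (t - 0) < min r d"
    then have ht: "continuous_on K (h t)" using hc by simp
    have "norm (h t k - h 0 k - t *\<^sub>R h' 0 k) \<le> e * norm (t - 0)" if k: "k \<in> K" for k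
    proof -
      have "norm ((\<lambda>s. h s k - s *\<^sub>R h' 0 k) t - (\<lambda>s. h s k - s *\<^sub>R h' 0 k) 0) \<le> e * norm (t - 0)"
      proof (rule differentiable_bound[where f' = "\<lambda>s k'. k' *\<^sub>R (h' s k - h' 0 k)" and S = "closed_segment 0 t"])
        fix s assume s: "s \<in> closed_segment 0 t"
        then have sd: "\<bar>s\<bar> < d" "\<bar>s\<bar> < r" using t by (auto simp: closed_segment_eq_real_ivl split: if_splits)
        have "((\<lambda>s. h s k - s *\<^sub>R h' 0 k) has_vector_derivative h' s k - h' 0 k) (at s)"
          by (intro has_vector_derivative_diff h[OF sd(1) k]) (auto intro!: derivative_eq_intros)
        then show "((\<lambda>s. h s k - s *\<^sub>R h' 0 k) has_derivative (\<lambda>k'. k' *\<^sub>R (h' s k - h' 0 k))) (at s within closed_segment 0 t)"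
          unfolding has_vector_derivative_def by (rule has_derivative_at_withinI)
        have "s \<in> X0 \<inter> {-d<..<d}" using r(2) sd by (auto simp: dist_real_def)
        then have "norm (h' s k - h' 0 k) \<le> e" using X0(3) k by (auto simp: dist_norm)
        then show "onorm (\<lambda>k'. k' *\<^sub>R (h' s k - h' 0 k)) \<le> e" by (rule onorm_scaleR_le)
      qed auto
      then show ?thesis by (simp add: algebra_simps)
    qed
    then have "norm (\<integral>k. h t k - h 0 k - t *\<^sub>R h' 0 k \<partial>\<mu>) \<le> e * norm (t - 0)"
      by (intro norm_integral_le) (auto intro!: continuous_intros ht h0c c0)
    also have "(\<integral>k. h t k - h 0 k - t *\<^sub>R h' 0 k \<partial>\<mu>) = (\<integral>k. h t k \<partial>\<mu>) - (\<integral>k. h 0 k \<partial>\<mu>) - t *\<^sub>R (\<integral>k. h' 0 k \<partial>\<mu>)"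
      using integrable[OF ht] integrable[OF h0c] integrable[OF c0] by simp
    finally show "norm ((\<integral>k. h t k \<partial>\<mu>) - (\<integral>k. h 0 k \<partial>\<mu>) - (t - 0) *\<^sub>R (\<integral>k. h' 0 k \<partial>\<mu>)) \<le> e * norm (t - 0)"
      by simp
  qed (use r d in auto)
qed

lemma has_partial_deriv_integral:
  fixes H :: "(nat \<Rightarrow> 'e::real_normed_vector) \<Rightarrow> 'k \<Rightarrow> 'v::{banach, second_countable_topology}"
  assumes S: "open S" and H: "C_kp (Suc m) n S K H" and i: "i \<in> {1..n}" and x: "x \<in> S"
  shows "((\<lambda>t. \<integral>k. H (x(i := x i + t *\<^sub>R v)) k \<partial>\<mu>) has_vector_derivative
     (\<integral>k. partial_deriv i v (\<lambda>x. H x k) x \<partial>\<mu>)) (at 0)"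
proof -
  let ?y = "\<lambda>t::real. x(i := x i + t *\<^sub>R v)"
  from line_neighbourhood[OF S x, of i v] obtain d where d: "d > 0" "\<forall>t. \<bar>t\<bar> < d \<longrightarrow> ?y t \<in> S"
    by (elim exE conjE) (rule that, assumption, drule (1) bspec)
  have "((\<lambda>t. \<integral>k. H (?y t) k \<partial>\<mu>) has_vector_derivative
     (\<integral>k. partial_deriv i v (\<lambda>x. H x k) (?y 0) \<partial>\<mu>)) (at 0)"
  proof (rule has_vector_derivative_integral[OF d(1)])
    fix t :: real assume "\<bar>t\<bar> < d"
    then have t: "?y t \<in> S" using d(2) by blast
    show "continuous_on K (H (?y t))" by (rule continuous_on_slice2[OF C_kp_continuous[OF H] t])
    fix k assume k: "k \<in> K"
    show "((\<lambda>t. H (?y t) k) has_vector_derivative partial_deriv i v (\<lambda>x. H x k) (?y t)) (at t)"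
      by (rule has_partial_deriv_at[OF C_kp_slice[OF H k] i t])
  next
    have "continuous_on UNIV (\<lambda>t::real. ?y t)"
    proof (rule continuous_on_coordinatewise_then_product)
      show "continuous_on UNIV (\<lambda>t. (?y t) j)" for j by (cases "j = i") (auto intro!: continuous_intros)
    qed
    then have "continuous_on ({-d<..<d} \<times> K) (\<lambda>y. (?y (fst y), snd y))"
      by (intro continuous_on_Pair continuous_on_compose2[of UNIV "\<lambda>t. ?y t" _ fst]) (auto intro!: continuous_intros)
    moreover have "(\<lambda>y. (?y (fst y), snd y)) ` ({-d<..<d} \<times> K) \<subseteq> S \<times> K"
    proof
      fix z assume "z \<in> (\<lambda>y. (?y (fst y), snd y)) ` ({-d<..<d} \<times> K)"
      then obtain t k where "z = (?y t, k)" "\<bar>t\<bar> < d" "k \<in> K" by auto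
      then show "z \<in> S \<times> K" using d(2) by blast
    qed
    ultimately have "continuous_on ({-d<..<d} \<times> K) (\<lambda>y. (\<lambda>y. partial_deriv i v (\<lambda>x. H x (snd y)) (fst y)) (?y (fst y), snd y))"
      by (rule continuous_on_compose2[OF C_kp_continuous[OF C_kp_partial[OF H i, of v]]])
    then show "continuous_on ({-d<..<d} \<times> K) (\<lambda>y. partial_deriv i v (\<lambda>x. H x (snd y)) (?y (fst y)))"
      by (simp only: fst_conv snd_conv)
  qed
  then show ?thesis by simp
qed

lemma C_k_integral:
  fixes H :: "(nat \<Rightarrow> 'e::real_normed_vector) \<Rightarrow> 'k \<Rightarrow> 'v::{banach, second_countable_topology}"
  assumes S: "open S"
  shows "C_kp m n S K H \<Longrightarrow> C_k m n S (\<lambda>x. \<integral>k. H x k \<partial>\<mu>)"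
proof (induction m arbitrary: H)
  case 0
  then show ?case using continuous_on_integral[of S H] by simp
next
  case (Suc m)
  show ?case
  proof (rule C_k_SucI[where F' = "\<lambda>i v x. \<integral>k. partial_deriv i v (\<lambda>x. H x k) x \<partial>\<mu>", OF S])
    show "continuous_on S (\<lambda>x. \<integral>k. H x k \<partial>\<mu>)" by (rule continuous_on_integral[OF C_kp_continuous[OF Suc.prems]])
    fix i v assume i: "i \<in> {1..n}"
    show "C_k m n S (\<lambda>x. \<integral>k. partial_deriv i v (\<lambda>x. H x k) x \<partial>\<mu>)"
      by (rule Suc.IH[OF C_kp_partial[OF Suc.prems i]])
    fix x assume x: "x \<in> S"
    show "((\<lambda>t. \<integral>k. H (x(i := x i + t *\<^sub>R v)) k \<partial>\<mu>) has_vector_derivative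
        (\<integral>k. partial_deriv i v (\<lambda>x. H x k) x \<partial>\<mu>)) (at 0)"
      by (rule has_partial_deriv_integral[OF S Suc.prems i x])
  qed
qed

end

section \<open>Smooth functions on powers of a Lie group\<close>

lemma depends_uptoD:
  assumes "depends_upto n f" "\<And>i. 1 \<le> i \<Longrightarrow> i \<le> n \<Longrightarrow> g i = h i"
  shows "f g = f h"
proof -
  have "(\<forall>i\<in>{1..n}. g i = h i) \<longrightarrow> f g = f h"
    using assms(1) unfolding depends_upto_def by blast
  moreover have "\<forall>i\<in>{1..n}. g i = h i" using assms(2) by simp
  ultimately show ?thesis by (rule mp)
qed

lemma depends_uptoI:
  fixes f :: "(nat \<Rightarrow> 'x) \<Rightarrow> 'y"
  assumes "\<And>g h. (\<And>i. 1 \<le> i \<Longrightarrow> i \<le> n \<Longrightarrow> g i = h i) \<Longrightarrow> f g = f h"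
  shows "depends_upto n f"
  unfolding depends_upto_def
proof (intro allI impI)
  fix g h :: "nat \<Rightarrow> 'x" assume gh: "\<forall>i\<in>{1..n}. g i = h i"
  show "f g = f h" by (rule assms) (simp add: gh)
qed

lemma depends_upto_comp2:
  fixes f :: "(nat \<Rightarrow> 'x) \<Rightarrow> 'y"
  assumes f: "depends_upto n f" and h: "depends_upto n h"
  shows "depends_upto n (\<lambda>g. L (f g) (h g))"
proof (rule depends_uptoI)
  fix g k :: "nat \<Rightarrow> 'x" assume gk: "\<And>i. 1 \<le> i \<Longrightarrow> i \<le> n \<Longrightarrow> g i = k i"
  have "f g = f k" by (rule depends_uptoD[OF f gk])
  moreover have "h g = h k" by (rule depends_uptoD[OF h gk])
  ultimately show "L (f g) (h g) = L (f k) (h k)" by simp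
qed

lemma depends_upto_comp1: "depends_upto n f \<Longrightarrow> depends_upto n (\<lambda>g. L (f g))"
  using depends_upto_comp2[of n f f "\<lambda>x _. L x"] by simp

locale lie =
  fixes G :: "('g::{t2_space,second_countable_topology}, 'e::real_normed_vector) charted_group" (structure)
  assumes lie: "lie_group G"
begin

abbreviation "ic \<equiv> snd (ident_chart G)"

lemma fd_e: "finite_dim (UNIV :: 'e set)"
  using lie unfolding lie_group_def by blast

lemma carrier_UNIV [simp]: "carrier G = UNIV"
  using lie unfolding lie_group_def by blast

sublocale group G
  using lie unfolding lie_group_def by blast

lemma smooth_mult: "smooth_map G 2 (\<lambda>g. g 1 \<otimes> g 2)" and smooth_inv: "smooth_map G 1 (\<lambda>g. inv (g 1))"
  and ident_chart: "ident_chart G \<in> atlas G" and one_in_ident: "\<one> \<in> fst (ident_chart G)"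
  and atlas: "smooth_atlas (atlas G)"
  using lie unfolding lie_group_def by blast+

lemma chart: assumes "c \<in> atlas G" shows "is_chart c"
  using atlas assms unfolding smooth_atlas_def by blast

lemma chart_open: "c \<in> atlas G \<Longrightarrow> open (fst c)" "c \<in> atlas G \<Longrightarrow> open (chart_image c)"
  using chart unfolding is_chart_def by blast+

lemma chart_homeo: assumes "c \<in> atlas G"
  shows "continuous_on (fst c) (snd c)" "continuous_on (chart_image c) (chart_inv c)"
    and "g \<in> fst c \<Longrightarrow> chart_inv c (snd c g) = g"
    and "x \<in> chart_image c \<Longrightarrow> snd c (chart_inv c x) = x"
    and "x \<in> chart_image c \<Longrightarrow> chart_inv c x \<in> fst c"
proof -
  have h: "homeomorphism (fst c) (chart_image c) (snd c) (chart_inv c)"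
    using chart[OF assms] unfolding is_chart_def by blast
  show "continuous_on (fst c) (snd c)" "continuous_on (chart_image c) (chart_inv c)"
    using h unfolding homeomorphism_def by blast+
  show "g \<in> fst c \<Longrightarrow> chart_inv c (snd c g) = g" using h unfolding homeomorphism_def by blast
  show "x \<in> chart_image c \<Longrightarrow> snd c (chart_inv c x) = x" using h unfolding homeomorphism_def by blast
  show "x \<in> chart_image c \<Longrightarrow> chart_inv c x \<in> fst c" by (rule inv_into_into)
qed

lemma chart_at: "\<exists>c\<in>atlas G. g \<in> fst c"
  using atlas unfolding smooth_atlas_def by blast

section \<open>Coordinates on powers of the group\<close>

definition dom :: "nat \<Rightarrow> (nat \<Rightarrow> ('g, 'e) chart) \<Rightarrow> (nat \<Rightarrow> 'e) set" where
  "dom n c = {x. \<forall>i\<in>{1..n}. x i \<in> chart_image (c i)}"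

text \<open>Entries outside \<open>1..n\<close> are reset to the neutral element: the family
  \<open>c\<close> is unconstrained there, and without the reset the map into the infinite product
  need not be continuous. Functions of the first \<open>n\<close> entries do not see the
  change.\<close>

definition pt :: "nat \<Rightarrow> (nat \<Rightarrow> ('g, 'e) chart) \<Rightarrow> (nat \<Rightarrow> 'e) \<Rightarrow> nat \<Rightarrow> 'g" where
  "pt n c x = (\<lambda>i. if i \<in> {1..n} then chart_inv (c i) (x i) else \<one>)"

definition charts :: "nat \<Rightarrow> (nat \<Rightarrow> ('g, 'e) chart) \<Rightarrow> bool" where
  "charts n c \<longleftrightarrow> (\<forall>i\<in>{1..n}. c i \<in> atlas G)"

lemma open_dom: assumes "charts n c" shows "open (dom n c)"
  unfolding dom_def
  by (rule product_topology_basis'[where x = "\<lambda>i. i"]) (use assms chart_open in \<open>auto simp: charts_def\<close>)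

lemma continuous_on_pt: assumes "charts n c" shows "continuous_on (dom n c) (pt n c)"
proof (rule continuous_on_coordinatewise_then_product)
  fix i
  show "continuous_on (dom n c) (\<lambda>x. pt n c x i)"
  proof (cases "i \<in> {1..n}")
    case True
    then have "c i \<in> atlas G" using assms by (simp add: charts_def)
    then have "continuous_on (dom n c) (\<lambda>x. chart_inv (c i) (x i))"
      by (rule continuous_on_compose2[OF chart_homeo(2) continuous_on_coord]) (use True in \<open>auto simp: dom_def\<close>)
    moreover have "(\<lambda>x. pt n c x i) = (\<lambda>x. chart_inv (c i) (x i))" using True by (simp add: pt_def)
    ultimately show ?thesis by (simp only:)
  next
    case False
    then show ?thesis by (simp add: pt_def del: atLeastAtMost_iff)
  qed
qed

lemma cochains_iff:
  "f \<in> cochains G n \<longleftrightarrow> depends_upto n f \<and>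
    (\<forall>c k. charts n c \<longrightarrow> C_k k n (dom n c) (\<lambda>x. f (pt n c x)))"
proof -
  have "(\<lambda>x. f (\<lambda>i. chart_inv (c i) (x i))) = (\<lambda>x. f (pt n c x))" if "depends_upto n f" for c
    by (rule ext, rule depends_uptoD[OF that]) (simp add: pt_def)
  then show ?thesis
    unfolding cochains_def smooth_fun_def C_infinity_def charts_def dom_def[symmetric] by auto
qed

lemma cochainsD: "f \<in> cochains G n \<Longrightarrow> charts n c \<Longrightarrow> C_k k n (dom n c) (\<lambda>x. f (pt n c x))"
  using cochains_iff by blast

lemma cochains_depends: "f \<in> cochains G n \<Longrightarrow> depends_upto n f"
  using cochains_iff by blast

lemma cochainsI: "depends_upto n f \<Longrightarrow> (\<And>c k. charts n c \<Longrightarrow> C_k k n (dom n c) (\<lambda>x. f (pt n c x))) \<Longrightarrow> f \<in> cochains G n"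
  using cochains_iff by blast

section \<open>Smooth maps from powers of the group to the group\<close>

definition smap :: "nat \<Rightarrow> ((nat \<Rightarrow> 'g) \<Rightarrow> 'g) \<Rightarrow> bool" where
  "smap n F \<longleftrightarrow> depends_upto n F \<and> smooth_map G n F"

lemma smap_iff:
  "smap n F \<longleftrightarrow> depends_upto n F \<and> continuous_on UNIV F \<and>
    (\<forall>c d k. charts n c \<longrightarrow> d \<in> atlas G \<longrightarrow>
       C_k k n {x \<in> dom n c. F (pt n c x) \<in> fst d} (\<lambda>x. snd d (F (pt n c x))))"
proof -
  have "(\<lambda>x. F (\<lambda>i. chart_inv (c i) (x i))) = (\<lambda>x. F (pt n c x))" if "depends_upto n F" for c
    by (rule ext, rule depends_uptoD[OF that]) (simp add: pt_def)
  then have *: "F (\<lambda>i. chart_inv (c i) (x i)) = F (pt n c x)" if "depends_upto n F" for c x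
    using that by (simp only: fun_eq_iff)
  show ?thesis
  proof (cases "depends_upto n F")
    case True
    then show ?thesis
      unfolding smap_def smooth_map_def C_infinity_def charts_def *[OF True] dom_def mem_Collect_eq by blast
  qed (simp add: smap_def)
qed

lemma smapD: "smap n F \<Longrightarrow> charts n c \<Longrightarrow> d \<in> atlas G \<Longrightarrow>
    C_k k n {x \<in> dom n c. F (pt n c x) \<in> fst d} (\<lambda>x. snd d (F (pt n c x)))"
  using smap_iff by blast

lemma smap_depends: "smap n F \<Longrightarrow> depends_upto n F"
  and smap_continuous: "smap n F \<Longrightarrow> continuous_on UNIV F"
  using smap_iff by blast+

lemma open_preimage_pt:
  assumes "charts n c" "continuous_on UNIV F" "open U"
  shows "open {x \<in> dom n c. F (pt n c x) \<in> U}"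
proof -
  have "continuous_on (dom n c) (\<lambda>x. F (pt n c x))"
    by (rule continuous_on_compose2[OF assms(2) continuous_on_pt[OF assms(1)]]) simp
  from continuous_open_preimage[OF this open_dom[OF assms(1)] assms(3)]
  show ?thesis by (simp add: vimage_def Int_def)
qed

text \<open>Around each point, charts \<open>d\<close> are chosen at the images under the
  \<open>F j\<close>; on a small open set the composite is then a composite of coordinate
  expressions. The open set \<open>Q\<close> allows \<open>\<Phi>\<close> to be a coordinate
  function of the group, which is smooth only over its chart domain.\<close>

lemma local_compose:
  fixes \<Phi> :: "(nat \<Rightarrow> 'g) \<Rightarrow> 'b::real_normed_vector"
  assumes c: "charts n c" and F: "\<And>j. j \<in> {1..m} \<Longrightarrow> smap n (F j)"
    and Q: "open Q" "depends_upto m (\<lambda>g. g \<in> Q)" and dep: "depends_upto m \<Phi>"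
    and \<Phi>: "\<And>d. charts m d \<Longrightarrow> C_k k m {y \<in> dom m d. pt m d y \<in> Q} (\<lambda>y. \<Phi> (pt m d y))"
  shows "C_k k n {x \<in> dom n c. (\<lambda>j. F j (pt n c x)) \<in> Q} (\<lambda>x. \<Phi> (\<lambda>j. F j (pt n c x)))"
proof (rule C_k_local)
  fix x0 assume x0: "x0 \<in> {x \<in> dom n c. (\<lambda>j. F j (pt n c x)) \<in> Q}"
  have "\<forall>j. \<exists>d. d \<in> atlas G \<and> F j (pt n c x0) \<in> fst d" using chart_at by blast
  from choice[OF this] obtain d where "\<forall>j. d j \<in> atlas G \<and> F j (pt n c x0) \<in> fst (d j)" ..
  then have d: "\<And>j. d j \<in> atlas G \<and> F j (pt n c x0) \<in> fst (d j)" by (rule spec)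
  then have chd: "charts m d" by (simp add: charts_def)
  \<comment> \<open>Constant entries beyond \<open>m\<close> make the tuple continuous in the
    product topology; neither \<open>Q\<close> nor \<open>\<Phi>\<close> sees them.\<close>
  define F' where "F' j g = (if j \<in> {1..m} then F j g else \<one>)" for j g
  have F'c: "continuous_on UNIV (\<lambda>g j. F' j g)"
  proof (rule continuous_on_family[where J = "{1..m}" and z = "\<lambda>_. \<one>"])
    fix j assume j: "j \<in> {1..m}"
    then have "F' j = F j" by (simp add: F'_def fun_eq_iff)
    then show "continuous_on UNIV (F' j)" using smap_continuous[OF F[OF j]] by simp
  qed (simp only: F'_def if_False)
  have Q': "(\<lambda>j. F' j g) \<in> Q \<longleftrightarrow> (\<lambda>j. F j g) \<in> Q" for g
    by (rule depends_uptoD[OF Q(2)]) (simp add: F'_def)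
  have \<Phi>': "\<Phi> (\<lambda>j. F' j g) = \<Phi> (\<lambda>j. F j g)" for g
    by (rule depends_uptoD[OF dep]) (simp add: F'_def)
  define U where "U = {x \<in> dom n c. (\<lambda>j. F' j (pt n c x)) \<in> Q \<inter> {g. \<forall>j\<in>{1..m}. g j \<in> fst (d j)}}"
  have "open {g :: nat \<Rightarrow> 'g. \<forall>j\<in>{1..m}. g j \<in> fst (d j)}"
    by (rule product_topology_basis'[where x = "\<lambda>i. i"]) (use d chart_open in auto)
  then have oU: "open U" unfolding U_def
    by (intro open_preimage_pt[OF c F'c]) (use Q(1) in blast)
  have "(\<lambda>j. F' j (pt n c x0)) \<in> Q" using x0 by (simp only: Q' mem_Collect_eq)
  moreover have "\<forall>j\<in>{1..m}. F' j (pt n c x0) \<in> fst (d j)" using d by (simp add: F'_def)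
  ultimately have x0U: "x0 \<in> U" using x0 by (simp add: U_def)
  let ?T = "{y \<in> dom m d. pt m d y \<in> Q}"
  let ?F = "\<lambda>j x. if j \<in> {1..m} then snd (d j) (F j (pt n c x)) else 0"
  have pt_F: "pt m d (\<lambda>j. ?F j x) = (\<lambda>j. F' j (pt n c x))" if "x \<in> U" for x
    using that d chart_homeo(3) by (auto simp: pt_def F'_def U_def fun_eq_iff)
  have Tx: "(\<lambda>j. ?F j x) \<in> ?T" if "x \<in> U" for x
    using that pt_F[OF that] by (auto simp: U_def dom_def F'_def)
  have "C_k k n U (\<lambda>x. \<Phi> (pt m d (\<lambda>j. ?F j x)))"
  proof (rule C_k_compose[OF fd_e oU _ \<Phi>[OF chd], where z = "\<lambda>_. 0"])
    show "open ?T"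
      using open_preimage_pt[OF chd, of "\<lambda>x. x" Q] Q(1) by simp
    fix j assume j: "j \<in> {1..m}"
    have "U \<subseteq> {x \<in> dom n c. F j (pt n c x) \<in> fst (d j)}" using j by (auto simp: U_def F'_def)
    from C_k_subset[OF smapD[OF F[OF j] c] this] d
    have "C_k k n U (\<lambda>x. snd (d j) (F j (pt n c x)))" by blast
    then show "C_k k n U (?F j)" using j by simp
  next
    show "?F j x = 0" if "j \<notin> {1..m}" for x j using that by (simp only: if_False)
    show "(\<lambda>j. ?F j x) \<in> ?T" if "x \<in> U" for x by (rule Tx[OF that])
  qed
  from C_k_cong_imp[OF oU _ this, of "\<lambda>x. \<Phi> (\<lambda>j. F j (pt n c x))"]
  have "C_k k n U (\<lambda>x. \<Phi> (\<lambda>j. F j (pt n c x)))" by (simp only: pt_F \<Phi>')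
  then show "\<exists>U. open U \<and> x0 \<in> U \<and> C_k k n U (\<lambda>x. \<Phi> (\<lambda>j. F j (pt n c x)))"
    using oU x0U by (intro exI conjI)
qed

lemma depends_upto_compose:
  fixes F :: "nat \<Rightarrow> (nat \<Rightarrow> 'x) \<Rightarrow> 'y"
  assumes "depends_upto m f" "\<And>j. j \<in> {1..m} \<Longrightarrow> depends_upto n (F j)"
  shows "depends_upto n (\<lambda>g. f (\<lambda>j. F j g))"
proof (rule depends_uptoI)
  fix g h :: "nat \<Rightarrow> 'x" assume gh: "\<And>i. 1 \<le> i \<Longrightarrow> i \<le> n \<Longrightarrow> g i = h i"
  show "f (\<lambda>j. F j g) = f (\<lambda>j. F j h)"
    by (rule depends_uptoD[OF assms(1)], rule depends_uptoD[OF assms(2)]) (simp_all add: gh)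
qed

lemma cochains_compose:
  assumes f: "f \<in> cochains G m" and F: "\<And>j. j \<in> {1..m} \<Longrightarrow> smap n (F j)"
  shows "(\<lambda>g. f (\<lambda>j. F j g)) \<in> cochains G n"
proof (rule cochainsI)
  show "depends_upto n (\<lambda>g. f (\<lambda>j. F j g))"
    by (rule depends_upto_compose[OF cochains_depends[OF f] smap_depends[OF F]])
  fix c k assume c: "charts n c"
  have "C_k k n {x \<in> dom n c. (\<lambda>j. F j (pt n c x)) \<in> UNIV} (\<lambda>x. f (\<lambda>j. F j (pt n c x)))"
    by (rule local_compose[OF c F _ _ cochains_depends[OF f]])
       (use cochainsD[OF f] in \<open>simp_all add: depends_upto_def\<close>)
  then show "C_k k n (dom n c) (\<lambda>x. f (\<lambda>j. F j (pt n c x)))" by simp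
qed

lemma smap_compose:
  assumes H: "smap m H" and F: "\<And>j. j \<in> {1..m} \<Longrightarrow> smap n (F j)"
  shows "smap n (\<lambda>g. H (\<lambda>j. F j g))"
  unfolding smap_iff
proof (intro conjI allI impI)
  show "depends_upto n (\<lambda>g. H (\<lambda>j. F j g))"
    by (rule depends_upto_compose[OF smap_depends[OF H] smap_depends[OF F]])
  define F' where "F' j g = (if j \<in> {1..m} then F j g else \<one>)" for j g
  have F'c: "continuous_on UNIV (\<lambda>g j. F' j g)"
  proof (rule continuous_on_family[where J = "{1..m}" and z = "\<lambda>_. \<one>"])
    fix j assume j: "j \<in> {1..m}"
    then have "F' j = F j" by (simp add: F'_def fun_eq_iff)
    then show "continuous_on UNIV (F' j)" using smap_continuous[OF F[OF j]] by simp
  qed (simp only: F'_def if_False)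
  have "H (\<lambda>j. F' j g) = H (\<lambda>j. F j g)" for g
    by (rule depends_uptoD[OF smap_depends[OF H]]) (simp add: F'_def)
  moreover have "continuous_on UNIV (\<lambda>g. H (\<lambda>j. F' j g))"
    by (rule continuous_on_compose2[OF smap_continuous[OF H] F'c]) simp
  ultimately show "continuous_on UNIV (\<lambda>g. H (\<lambda>j. F j g))" by simp
  fix c d k assume c: "charts n c" and d: "d \<in> atlas G"
  have "C_k k n {x \<in> dom n c. (\<lambda>j. F j (pt n c x)) \<in> H -` fst d} (\<lambda>x. (\<lambda>g. snd d (H g)) (\<lambda>j. F j (pt n c x)))"
  proof (rule local_compose[OF c F])
    show "open (H -` fst d)" using smap_continuous[OF H] chart_open(1)[OF d] by (simp add: continuous_on_open_vimage)
    show "depends_upto m (\<lambda>g. g \<in> H -` fst d)" "depends_upto m (\<lambda>g. snd d (H g))"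
      using depends_upto_comp1[OF smap_depends[OF H], of "\<lambda>x. x \<in> fst d"]
        depends_upto_comp1[OF smap_depends[OF H], of "snd d"] by simp_all
    fix d' assume "charts m d'"
    from smapD[OF H this d]
    show "C_k k m {y \<in> dom m d'. pt m d' y \<in> H -` fst d} (\<lambda>y. snd d (H (pt m d' y)))" by simp
  qed
  then show "C_k k n {x \<in> dom n c. H (\<lambda>j. F j (pt n c x)) \<in> fst d} (\<lambda>x. snd d (H (\<lambda>j. F j (pt n c x))))"
    by simp
qed

lemma smap_const: "smap n (\<lambda>_. a)"
  unfolding smap_iff
proof (intro conjI allI impI)
  fix c k and d :: "('g, 'e) chart" assume c: "charts n c"
  have "open {x \<in> dom n c. a \<in> fst d}" by (cases "a \<in> fst d") (simp_all add: open_dom[OF c])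
  then show "C_k k n {x \<in> dom n c. a \<in> fst d} (\<lambda>x. snd d a)" by (rule C_k_const)
qed (simp_all add: depends_upto_def)

text \<open>Read in charts, a projection is a transition map; this is where the compatibility of the
  charts enters.\<close>

lemma smap_proj: assumes i: "1 \<le> i" "i \<le> n" shows "smap n (\<lambda>g. g i)"
  unfolding smap_iff
proof (intro conjI allI impI)
  show "depends_upto n (\<lambda>g. g i :: 'g)" using i by (auto simp: depends_upto_def)
  show "continuous_on UNIV (\<lambda>g. g i :: 'g)" by simp
  fix c d k assume c: "charts n c" and d: "d \<in> atlas G"
  have ci: "c i \<in> atlas G" using c i by (simp add: charts_def)
  let ?S = "{x \<in> dom n c. pt n c x i \<in> fst d}"
  let ?T = "{x :: nat \<Rightarrow> 'e. x 1 \<in> snd (c i) ` (fst (c i) \<inter> fst d)}"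
  have img: "snd (c i) ` (fst (c i) \<inter> fst d) = chart_image (c i) \<inter> chart_inv (c i) -` fst d"
    using chart_homeo(3-5)[OF ci] by (auto simp: image_iff)
  have "open (snd (c i) ` (fst (c i) \<inter> fst d))" unfolding img
    by (rule continuous_open_preimage[OF chart_homeo(2)[OF ci] chart_open(2)[OF ci] chart_open(1)[OF d]])
  then have oT: "open ?T"
    using product_topology_basis'[of "{1::nat}" "\<lambda>_. snd (c i) ` (fst (c i) \<inter> fst d)" "\<lambda>i. i"] by simp
  have oS: "open ?S" by (rule open_preimage_pt[OF c _ chart_open(1)[OF d]]) simp
  have tr: "C_k k 1 ?T (\<lambda>x. snd d (chart_inv (c i) (x 1)))"
    using atlas ci d unfolding smooth_atlas_def smooth_transition_def C_infinity_def by blast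
  have "C_k k n ?S (\<lambda>x. (\<lambda>x. snd d (chart_inv (c i) (x (1::nat)))) (\<lambda>j. if j = 1 then x i else 0))"
  proof (rule C_k_compose[OF fd_e oS oT tr, where z = "\<lambda>_. 0" and F = "\<lambda>j x. if j = 1 then x i else 0"])
    fix j :: nat assume "j \<in> {1..1}"
    then have eq: "(\<lambda>x :: nat \<Rightarrow> 'e. if j = 1 then x i else 0) = (\<lambda>x. x i)" by (simp add: fun_eq_iff)
    show "C_k k n ?S (\<lambda>x. if j = 1 then x i else 0)" unfolding eq by (rule C_k_coord[OF oS])
  next
    fix x assume x: "x \<in> ?S"
    then have "x i \<in> chart_image (c i)" "chart_inv (c i) (x i) \<in> fst d" using i by (auto simp: dom_def pt_def)
    then show "(\<lambda>j. if j = 1 then x i else 0) \<in> ?T" unfolding img by simp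
  qed simp
  then show "C_k k n ?S (\<lambda>x. snd d (pt n c x i))" using i by (simp add: pt_def)
qed

lemma smap_mult: assumes "smap n A" "smap n B" shows "smap n (\<lambda>g. A g \<otimes> B g)"
proof -
  have "smap 2 (\<lambda>g. g 1 \<otimes> g 2)"
    unfolding smap_def using smooth_mult by (auto simp: depends_upto_def)
  then have "smap n (\<lambda>g. (\<lambda>g. g (1::nat) \<otimes> g (2::nat)) (\<lambda>j. (if j = 1 then A else B) g))"
    by (rule smap_compose) (use assms in simp)
  then show ?thesis by simp
qed

lemma smap_inv: assumes "smap n A" shows "smap n (\<lambda>g. inv (A g))"
proof -
  have "smap 1 (\<lambda>g. inv (g 1))"
    unfolding smap_def using smooth_inv by (auto simp: depends_upto_def)
  then have "smap n (\<lambda>g. (\<lambda>g. inv (g 1)) (\<lambda>j. A g))"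
    by (rule smap_compose) (use assms in simp)
  then show ?thesis by simp
qed

lemma smap_if: "(P \<Longrightarrow> smap n A) \<Longrightarrow> (\<not> P \<Longrightarrow> smap n B) \<Longrightarrow> smap n (\<lambda>g. if P then A g else B g)"
  by (cases P) simp_all

lemmas smap_intros = smap_mult smap_inv smap_const smap_proj

section \<open>Closure properties of smooth cochains\<close>

lemma cochains_const: "(\<lambda>_. a) \<in> cochains G n"
  by (rule cochainsI) (simp_all add: depends_upto_def C_k_const open_dom)

lemma cochains_add:
  assumes "f \<in> cochains G n" "h \<in> cochains G n" shows "(\<lambda>g. f g + h g) \<in> cochains G n"
proof (rule cochainsI)
  show "depends_upto n (\<lambda>g. f g + h g)"
    by (rule depends_upto_comp2[OF assms[THEN cochains_depends]])
  show "C_k k n (dom n c) (\<lambda>x. f (pt n c x) + h (pt n c x))" if "charts n c" for c k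
    by (rule C_k_add[OF open_dom[OF that] cochainsD[OF assms(1) that] cochainsD[OF assms(2) that]])
qed

lemma cochains_linear:
  assumes "f \<in> cochains G n" "bounded_linear L" shows "(\<lambda>g. L (f g)) \<in> cochains G n"
proof (rule cochainsI)
  show "depends_upto n (\<lambda>g. L (f g))"
    by (rule depends_upto_comp1[OF cochains_depends[OF assms(1)]])
  show "C_k k n (dom n c) (\<lambda>x. L (f (pt n c x)))" if "charts n c" for c k
    by (rule C_k_linear[OF open_dom[OF that] assms(2) cochainsD[OF assms(1) that]])
qed

lemma cochains_scaleR_const: "f \<in> cochains G n \<Longrightarrow> (\<lambda>g. r *\<^sub>R f g) \<in> cochains G n"
  by (rule cochains_linear[OF _ bounded_linear_scaleR_right])

lemma cochains_scaleR:
  assumes "u \<in> cochains G n" "f \<in> cochains G n" shows "(\<lambda>g. (u g :: real) *\<^sub>R f g) \<in> cochains G n"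
proof (rule cochainsI)
  show "depends_upto n (\<lambda>g. u g *\<^sub>R f g)"
    by (rule depends_upto_comp2[OF assms[THEN cochains_depends]])
  show "C_k k n (dom n c) (\<lambda>x. u (pt n c x) *\<^sub>R f (pt n c x))" if "charts n c" for c k
    by (rule C_k_scaleR[OF open_dom[OF that] cochainsD[OF assms(1) that] cochainsD[OF assms(2) that]])
qed

lemma cochains_sum:
  assumes "\<And>a. a \<in> A \<Longrightarrow> f a \<in> cochains G n" shows "(\<lambda>g. \<Sum>a\<in>A. f a g) \<in> cochains G n"
  using assms
  by (induction A rule: infinite_finite_induct) (simp_all add: cochains_const cochains_add)

lemma cochains_weaken: assumes "f \<in> cochains G m" "m \<le> n" shows "f \<in> cochains G n"
  using cochains_compose[OF assms(1), of n "\<lambda>j g. g j"] assms(2) by (simp add: smap_proj)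

end

section \<open>Derivatives at the neutral element\<close>

text \<open>A directional derivative is not linear in its direction by definition. Here linearity
  results from the chain rule, applied to the straight line in direction \<open>v\<close>.\<close>

lemma partial_deriv_expand:
  fixes F :: "(nat \<Rightarrow> 'e::real_normed_vector) \<Rightarrow> 'b::real_normed_vector"
  assumes fd: "finite_dim (UNIV :: 'e set)" and S: "open S" and F: "C_k (Suc 0) n S F"
    and i: "i \<in> {1..n}" and x: "x \<in> S"
  shows "partial_deriv i v F x = (\<Sum>b\<in>fbasis. fcoord b v *\<^sub>R partial_deriv i b F x)"
proof -
  have c0: "fcoord b 0 = 0" for b :: 'e by (rule linear_0[OF linear_fcoord[OF fd]])
  let ?y = "\<lambda>t::real. x(i := x i + t *\<^sub>R v)" and ?y' = "\<lambda>j. if j = i then v else 0"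
  have "((\<lambda>t. F (?y t)) has_vector_derivative
     (\<Sum>j=1..n. \<Sum>b\<in>fbasis. fcoord b (?y' j) *\<^sub>R partial_deriv j b F (?y 0))) (at 0)"
  proof (rule C_1_curve[OF fd S F])
    fix j
    show "((\<lambda>t. (?y t) j) has_vector_derivative (?y' j)) (at 0)"
      by (cases "j = i") (auto intro!: derivative_eq_intros)
  qed (use x i in auto)
  moreover have "(\<Sum>j=1..n. \<Sum>b\<in>fbasis. fcoord b (?y' j) *\<^sub>R partial_deriv j b F (?y 0))
     = (\<Sum>j=1..n. if j = i then (\<Sum>b\<in>fbasis. fcoord b v *\<^sub>R partial_deriv i b F x) else 0)"
    by (intro sum.cong) (simp_all add: c0)
  ultimately have "((\<lambda>t. F (?y t)) has_vector_derivative
     (\<Sum>b\<in>fbasis. fcoord b v *\<^sub>R partial_deriv i b F x)) (at 0)" using i by simp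
  from vector_derivative_at[OF this] show ?thesis unfolding partial_deriv_def .
qed

context lie
begin

abbreviation "C0 \<equiv> ident_chart G"
abbreviation "base \<equiv> (\<lambda>_::nat. ic \<one>)"

definition ediff :: "('g \<Rightarrow> 'b::real_normed_vector) \<Rightarrow> 'e \<Rightarrow> 'b" where
  "ediff \<phi> \<xi> = vector_derivative (\<lambda>t. \<phi> (exp_chart G (t *\<^sub>R \<xi>))) (at 0)"

text \<open>Two arguments are kept apart for the sake of the product rule: in the actions one curve
  enters both the representation and the function. Functions of one argument are the case in which
  the second is ignored.\<close>

definition smooth_at_e2 :: "('g \<Rightarrow> 'g \<Rightarrow> 'b::real_normed_vector) \<Rightarrow> bool" where
  "smooth_at_e2 w \<longleftrightarrow> (\<exists>T. open T \<and> base \<in> T \<and>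
     C_k (Suc 0) 2 T (\<lambda>x. w (chart_inv C0 (x 1)) (chart_inv C0 (x 2))))"

abbreviation "smooth_at_e \<phi> \<equiv> smooth_at_e2 (\<lambda>a _. \<phi> a)"

text \<open>Continuity of \<open>\<gamma>\<close> is a separate demand: \<open>ic\<close> takes
  arbitrary values off its chart, so differentiable coordinates alone do not keep the curve near the
  neutral element.\<close>

definition velocity :: "(real \<Rightarrow> 'g) \<Rightarrow> 'e \<Rightarrow> bool" where
  "velocity \<gamma> \<xi> \<longleftrightarrow> \<gamma> 0 = \<one> \<and> isCont \<gamma> 0 \<and> ((\<lambda>t. ic (\<gamma> t)) has_vector_derivative \<xi>) (at 0)"

lemma ic_one: "ic \<one> \<in> chart_image C0" "chart_inv C0 (ic \<one>) = \<one>"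
  using one_in_ident chart_homeo(3)[OF ident_chart] by auto

lemma exp_chart_0 [simp]: "exp_chart G 0 = \<one>"
  by (simp add: exp_chart_def ic_one)

lemma velocity_eventually:
  assumes "velocity \<gamma> \<xi>" shows "\<forall>\<^sub>F t in nhds 0. chart_inv C0 (ic (\<gamma> t)) = \<gamma> t"
proof -
  have "(\<gamma> \<longlongrightarrow> \<gamma> 0) (nhds 0)"
    using assms unfolding velocity_def isCont_def by (metis tendsto_nhds_iff)
  then have "\<forall>\<^sub>F t in nhds 0. \<gamma> t \<in> fst C0"
    by (rule topological_tendstoD) (use assms chart_open(1)[OF ident_chart] one_in_ident in \<open>auto simp: velocity_def\<close>)
  then show ?thesis by (rule eventually_mono) (rule chart_homeo(3)[OF ident_chart])
qed

lemma velocity_exp: "velocity (\<lambda>t. exp_chart G (t *\<^sub>R \<xi>)) \<xi>"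
proof -
  have "continuous_on UNIV (\<lambda>t::real. ic \<one> + t *\<^sub>R \<xi>)" by (intro continuous_intros)
  then have c: "isCont (\<lambda>t::real. ic \<one> + t *\<^sub>R \<xi>) 0" by (simp add: continuous_on_eq_continuous_at)
  have "isCont (chart_inv C0) (ic \<one> + 0 *\<^sub>R \<xi>)"
    using chart_homeo(2)[OF ident_chart] one_in_ident
    unfolding continuous_on_eq_continuous_at[OF chart_open(2)[OF ident_chart]] by simp
  from isCont_o2[OF c this] have 1: "isCont (\<lambda>t. exp_chart G (t *\<^sub>R \<xi>)) 0"
    unfolding exp_chart_def .
  have "\<forall>\<^sub>F t in nhds 0. ic \<one> + t *\<^sub>R \<xi> \<in> chart_image C0"
    using eventually_line[of "{x :: nat \<Rightarrow> 'e. \<forall>i\<in>{1}. x i \<in> chart_image C0}" base 1 \<xi>]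
      product_topology_basis'[of "{1::nat}" "\<lambda>_. chart_image C0" "\<lambda>i. i"] chart_open(2)[OF ident_chart] ic_one(1)
    by simp
  then have ev: "\<forall>\<^sub>F t in nhds 0. ic (exp_chart G (t *\<^sub>R \<xi>)) = ic \<one> + t *\<^sub>R \<xi>"
    by (rule eventually_mono) (simp only: exp_chart_def chart_homeo(4)[OF ident_chart])
  have "((\<lambda>t. ic \<one> + t *\<^sub>R \<xi>) has_vector_derivative \<xi>) (at 0)"
    by (auto intro!: derivative_eq_intros)
  then have "((\<lambda>t. ic (exp_chart G (t *\<^sub>R \<xi>))) has_vector_derivative \<xi>) (at 0)"
    unfolding has_vector_derivative_cong_eventually[OF ev] .
  with 1 show ?thesis by (simp add: velocity_def)
qed

lemma ediff_partial_deriv: "ediff \<phi> \<xi> = partial_deriv 1 \<xi> (\<lambda>x. \<phi> (chart_inv C0 (x 1))) base"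
  unfolding ediff_def partial_deriv_def exp_chart_def by simp

lemma ediff_expand:
  assumes "smooth_at_e \<phi>"
  shows "ediff \<phi> \<xi> = (\<Sum>b\<in>fbasis. fcoord b \<xi> *\<^sub>R ediff \<phi> b)"
proof -
  obtain T where T: "open T" "base \<in> T" "C_k (Suc 0) 2 T (\<lambda>x. \<phi> (chart_inv C0 (x 1)))"
    using assms unfolding smooth_at_e2_def by (elim exE conjE)
  show ?thesis unfolding ediff_partial_deriv by (rule partial_deriv_expand[OF fd_e T(1) T(3) _ T(2)]) simp
qed

lemma linear_ediff: assumes "smooth_at_e \<phi>" shows "linear (ediff \<phi>)"
proof (rule linearI)
  fix \<xi> \<eta> :: 'e and r :: real
  note l = linear_fcoord[OF fd_e]
  show "ediff \<phi> (\<xi> + \<eta>) = ediff \<phi> \<xi> + ediff \<phi> \<eta>"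
    unfolding ediff_expand[OF assms, of "\<xi> + \<eta>"] ediff_expand[OF assms, of \<xi>] ediff_expand[OF assms, of \<eta>]
    by (simp add: linear_add[OF l] scaleR_add_left sum.distrib)
  show "ediff \<phi> (r *\<^sub>R \<xi>) = r *\<^sub>R ediff \<phi> \<xi>"
    unfolding ediff_expand[OF assms, of "r *\<^sub>R \<xi>"] ediff_expand[OF assms, of \<xi>]
    by (simp add: linear_scale[OF l] scaleR_sum_right)
qed

text \<open>In coordinates this is the chain rule for a curve in two slots. Since the result depends
  only on the velocities, \<open>exp_chart\<close> may be replaced by conjugated or inverted curves
  and by curves inside a subgroup.\<close>

lemma curve2_derivative:
  assumes w: "smooth_at_e2 w" and \<gamma>: "velocity \<gamma> \<xi>" and \<delta>: "velocity \<delta> \<eta>"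
  shows "((\<lambda>t. w (\<gamma> t) (\<delta> t)) has_vector_derivative ediff (\<lambda>a. w a \<one>) \<xi> + ediff (w \<one>) \<eta>) (at 0)"
proof -
  let ?W = "\<lambda>x. w (chart_inv C0 (x (1::nat))) (chart_inv C0 (x 2))"
  obtain T where T: "open T" "base \<in> T" "C_k (Suc 0) 2 T ?W"
    using w unfolding smooth_at_e2_def by (elim exE conjE)
  define y where "y t j = (if j = 1 then ic (\<gamma> t) else if j = 2 then ic (\<delta> t) else ic \<one>)" for t and j :: nat
  have y0: "y 0 = base" using \<gamma> \<delta> by (auto simp: y_def velocity_def fun_eq_iff)
  have "((\<lambda>t. ?W (y t)) has_vector_derivative
     (\<Sum>j=1..2. \<Sum>b\<in>fbasis. fcoord b ((\<lambda>j. if j = 1 then \<xi> else \<eta>) j) *\<^sub>R partial_deriv j b ?W (y 0))) (at 0)"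
  proof (rule C_1_curve[OF fd_e T(1) T(3)])
    show "y 0 \<in> T" using T(2) by (simp only: y0)
    fix j :: nat assume "j \<in> {1..2}"
    then consider "j = 1" | "j = 2" by fastforce
    then show "((\<lambda>t. y t j) has_vector_derivative (\<lambda>j. if j = 1 then \<xi> else \<eta>) j) (at 0)"
      by cases (use \<gamma> \<delta> in \<open>simp_all add: y_def velocity_def\<close>)
  qed (auto simp: y_def)
  also have "(\<Sum>j=1..2. \<Sum>b\<in>fbasis. fcoord b ((\<lambda>j. if j = 1 then \<xi> else \<eta>) j) *\<^sub>R partial_deriv j b ?W (y 0))
     = partial_deriv 1 \<xi> ?W base + partial_deriv 2 \<eta> ?W base"
    unfolding y0 using partial_deriv_expand[OF fd_e T(1) T(3) _ T(2), of 1 \<xi>]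
      partial_deriv_expand[OF fd_e T(1) T(3) _ T(2), of 2 \<eta>]
    by (simp add: numeral_2_eq_2)
  also have "partial_deriv 1 \<xi> ?W base = ediff (\<lambda>a. w a \<one>) \<xi>"
    unfolding ediff_def partial_deriv_def exp_chart_def by (simp add: ic_one)
  also have "partial_deriv 2 \<eta> ?W base = ediff (w \<one>) \<eta>"
    unfolding ediff_def partial_deriv_def exp_chart_def by (simp add: ic_one)
  finally have 1: "((\<lambda>t. ?W (y t)) has_vector_derivative ediff (\<lambda>a. w a \<one>) \<xi> + ediff (w \<one>) \<eta>) (at 0)" .
  have ev: "\<forall>\<^sub>F t in nhds 0. w (\<gamma> t) (\<delta> t) = ?W (y t)"
    using velocity_eventually[OF \<gamma>] velocity_eventually[OF \<delta>]
    by eventually_elim (simp add: y_def)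
  show ?thesis unfolding has_vector_derivative_cong_eventually[OF ev] by (rule 1)
qed

lemma ediff_const [simp]: "ediff (\<lambda>_. c) \<xi> = 0"
  by (simp add: ediff_def)

lemma curve_derivative:
  assumes "smooth_at_e \<phi>" "velocity \<gamma> \<xi>"
  shows "((\<lambda>t. \<phi> (\<gamma> t)) has_vector_derivative ediff \<phi> \<xi>) (at 0)"
  using curve2_derivative[OF assms(1) assms(2) assms(2)] by simp

lemma ediff_has_derivative:
  assumes "smooth_at_e \<phi>"
  shows "((\<lambda>t. \<phi> (exp_chart G (t *\<^sub>R \<xi>))) has_vector_derivative ediff \<phi> \<xi>) (at 0)"
  by (rule curve_derivative[OF assms velocity_exp])

lemma cochains_smooth_at_e2:
  assumes "(\<lambda>g. w (g 1) (g 2)) \<in> cochains G 2" shows "smooth_at_e2 w"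
proof -
  have c: "charts 2 (\<lambda>_. C0)" by (simp add: charts_def ident_chart)
  have "C_k (Suc 0) 2 (dom 2 (\<lambda>_. C0)) (\<lambda>x. w (chart_inv C0 (x 1)) (chart_inv C0 (x 2)))"
    using cochainsD[OF assms c, of "Suc 0"] by (simp add: pt_def)
  moreover have "base \<in> dom 2 (\<lambda>_. C0)" using ic_one by (simp add: dom_def)
  ultimately show ?thesis unfolding smooth_at_e2_def using open_dom[OF c] by (intro exI conjI)
qed

lemma cochains_smooth_at_e: "(\<lambda>g. \<phi> (g 1)) \<in> cochains G 1 \<Longrightarrow> smooth_at_e \<phi>"
  by (rule cochains_smooth_at_e2, rule cochains_weaken[of _ 1 2]) simp_all

lemma smap_smooth_at_e2:
  assumes F: "smap 2 (\<lambda>g. F (g 1) (g 2))" and d: "d \<in> atlas G" "F \<one> \<one> \<in> fst d"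
  shows "smooth_at_e2 (\<lambda>a b. snd d (F a b))"
proof -
  have c: "charts 2 (\<lambda>_. C0)" by (simp add: charts_def ident_chart)
  let ?T = "{x \<in> dom 2 (\<lambda>_. C0). F (pt 2 (\<lambda>_. C0) x 1) (pt 2 (\<lambda>_. C0) x 2) \<in> fst d}"
  have "C_k (Suc 0) 2 ?T (\<lambda>x. snd d (F (chart_inv C0 (x 1)) (chart_inv C0 (x 2))))"
    using smapD[OF F c d(1), of "Suc 0"] by (simp add: pt_def)
  moreover have "base \<in> ?T" using ic_one d by (simp add: dom_def pt_def)
  moreover have "open ?T" by (rule open_preimage_pt[OF c smap_continuous[OF F] chart_open(1)[OF d(1)]])
  ultimately show ?thesis unfolding smooth_at_e2_def by (intro exI conjI)
qed

lemma smap_smooth_at_e: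
  assumes F: "smap 1 (\<lambda>g. F (g 1))" and d: "d \<in> atlas G" "F \<one> \<in> fst d"
  shows "smooth_at_e (\<lambda>a. snd d (F a))"
proof (rule smap_smooth_at_e2[where F = "\<lambda>a _. F a", OF _ d])
  show "smap 2 (\<lambda>g. F (g 1))"
    using smap_compose[OF F, of 2 "\<lambda>j g. g j"] by (simp add: smap_proj)
qed

lemma smap_isCont:
  assumes F: "smap 1 (\<lambda>g. F (g 1))" shows "isCont F a"
proof -
  have "continuous_on UNIV (\<lambda>a :: 'g. (\<lambda>_::nat. a))"
    by (intro continuous_on_coordinatewise_then_product continuous_intros)
  from continuous_on_compose2[OF smap_continuous[OF F] this]
  show ?thesis by (simp add: continuous_on_eq_continuous_at)
qed

lemma velocity_map:
  assumes F: "smap 1 (\<lambda>g. F (g 1))" "F \<one> = \<one>" and \<gamma>: "velocity \<gamma> \<xi>"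
  shows "velocity (\<lambda>t. F (\<gamma> t)) (ediff (\<lambda>a. ic (F a)) \<xi>)"
proof -
  have "smooth_at_e (\<lambda>a. ic (F a))"
    by (rule smap_smooth_at_e[OF F(1) ident_chart]) (simp add: F(2) one_in_ident)
  from curve_derivative[OF this \<gamma>]
  have 1: "((\<lambda>t. ic (F (\<gamma> t))) has_vector_derivative ediff (\<lambda>a. ic (F a)) \<xi>) (at 0)" .
  have "isCont \<gamma> 0" using \<gamma> by (simp add: velocity_def)
  from isCont_o2[OF this smap_isCont[OF F(1)]] have "isCont (\<lambda>t. F (\<gamma> t)) 0" .
  with 1 \<gamma> F(2) show ?thesis by (simp add: velocity_def)
qed

lemma velocity_unique: "velocity \<gamma> \<xi> \<Longrightarrow> velocity \<gamma> \<eta> \<Longrightarrow> \<xi> = \<eta>"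
  unfolding velocity_def by (blast intro: vector_derivative_unique_at)

lemma ediff_ic: "ediff ic \<xi> = \<xi>"
  using velocity_exp[of \<xi>] unfolding velocity_def ediff_def by (simp add: vector_derivative_at)

text \<open>Differentiate the constant curve formed by the products of \<open>\<gamma> t\<close>
  with its inverse.\<close>

lemma velocity_inv: assumes \<gamma>: "velocity \<gamma> \<xi>" shows "velocity (\<lambda>t. inv (\<gamma> t)) (- \<xi>)"
proof -
  have v: "velocity (\<lambda>t. inv (\<gamma> t)) (ediff (\<lambda>a. ic (inv a)) \<xi>)"
    by (rule velocity_map[OF _ _ \<gamma>]) (simp_all add: smap_inv smap_proj)
  have "smap 2 (\<lambda>g. g 1 \<otimes> g 2)" by (intro smap_mult smap_proj) simp_all
  then have "smooth_at_e2 (\<lambda>a b. ic (a \<otimes> b))"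
    by (rule smap_smooth_at_e2[OF _ ident_chart]) (simp add: one_in_ident)
  from curve2_derivative[OF this \<gamma> v]
  have "((\<lambda>t::real. ic \<one>) has_vector_derivative \<xi> + ediff (\<lambda>a. ic (inv a)) \<xi>) (at 0)"
    by (simp add: ediff_ic)
  from vector_derivative_unique_at[OF this has_vector_derivative_const]
  have "ediff (\<lambda>a. ic (inv a)) \<xi> = - \<xi>" by (simp add: eq_neg_iff_add_eq_0 add.commute)
  with v show ?thesis by simp
qed

section \<open>Derivatives and integrals in the last entry\<close>

lemma cochains_composeI:
  "f \<in> cochains G m \<Longrightarrow> (\<And>j. 1 \<le> j \<Longrightarrow> j \<le> m \<Longrightarrow> smap n (\<lambda>g. \<Phi> g j)) \<Longrightarrow> (\<lambda>g. f (\<Phi> g)) \<in> cochains G n"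
  using cochains_compose[of f m n "\<lambda>j g. \<Phi> g j"] by simp

lemma cochains_slice: assumes "H \<in> cochains G n" shows "(\<lambda>h. H (g(i := h 1))) \<in> cochains G 1"
proof (rule cochains_composeI[OF assms])
  fix j
  show "smap 1 (\<lambda>h. (g(i := h 1)) j)"
    unfolding fun_upd_apply by (intro smap_if smap_const smap_proj) simp_all
qed

text \<open>The entry to be differentiated gets the identity chart. The derivative is then a partial
  derivative in slot \<open>n + 1\<close>, evaluated at the fixed coordinates of the neutral
  element.\<close>

lemma ediff_cochains:
  assumes H: "H \<in> cochains G (Suc n)"
  shows "(\<lambda>g. ediff (\<lambda>a. H (g(Suc n := a))) \<xi>) \<in> cochains G n"
proof (rule cochainsI)
  show "depends_upto n (\<lambda>g. ediff (\<lambda>a. H (g(Suc n := a))) \<xi>)"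
  proof (rule depends_uptoI)
    fix g h :: "nat \<Rightarrow> 'g" assume gh: "\<And>i. 1 \<le> i \<Longrightarrow> i \<le> n \<Longrightarrow> g i = h i"
    have "H (g(Suc n := a)) = H (h(Suc n := a))" for a
      by (rule depends_uptoD[OF cochains_depends[OF H]]) (simp add: gh)
    then show "ediff (\<lambda>a. H (g(Suc n := a))) \<xi> = ediff (\<lambda>a. H (h(Suc n := a))) \<xi>" by simp
  qed
  fix c k assume c: "charts n c"
  define c' where "c' = c(Suc n := C0)"
  have c': "charts (Suc n) c'" using c ident_chart by (auto simp: charts_def c'_def)
  define Ft where "Ft j x = (if j \<in> {1..n} then x j else if j = Suc n then ic \<one> else 0)" for j and x :: "nat \<Rightarrow> 'e"
  let ?P = "partial_deriv (Suc n) \<xi> (\<lambda>y. H (pt (Suc n) c' y))"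
  have P: "C_k k (Suc n) (dom (Suc n) c') ?P"
    by (rule C_k_partial[OF cochainsD[OF H c']]) simp
  have "C_k k n (dom n c) (\<lambda>x. ?P (\<lambda>j. Ft j x))"
  proof (rule C_k_compose[OF fd_e open_dom[OF c] open_dom[OF c'] P, where z = "\<lambda>_. 0"])
    fix j
    show "C_k k n (dom n c) (Ft j)"
    proof (cases "j \<in> {1..n}")
      case True
      then have "Ft j = (\<lambda>x. x j)" by (simp add: Ft_def fun_eq_iff)
      then show ?thesis using C_k_coord[OF open_dom[OF c]] by simp
    next
      case False
      then have "Ft j = (\<lambda>x. if j = Suc n then ic \<one> else 0)"
        unfolding Ft_def fun_eq_iff by (simp only: if_False) simp
      then show ?thesis using C_k_const[OF open_dom[OF c], of k n] by (cases "j = Suc n") simp_all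
    qed
    show "Ft j x = 0" if "j \<notin> {1..Suc n}" for x using that by (auto simp: Ft_def)
  next
    fix x assume x: "x \<in> dom n c"
    show "(\<lambda>j. Ft j x) \<in> dom (Suc n) c'"
      using x ic_one(1) by (auto simp: dom_def Ft_def c'_def)
  qed
  moreover have "?P (\<lambda>j. Ft j x) = ediff (\<lambda>a. H ((pt n c x)(Suc n := a))) \<xi>" for x
  proof -
    have "pt (Suc n) c' ((\<lambda>j. Ft j x)(Suc n := Ft (Suc n) x + t *\<^sub>R \<xi>)) = (pt n c x)(Suc n := exp_chart G (t *\<^sub>R \<xi>))" for t
      by (auto simp: pt_def Ft_def c'_def exp_chart_def fun_eq_iff)
    then show ?thesis unfolding partial_deriv_def ediff_def by (simp only:)
  qed
  ultimately show "C_k k n (dom n c) (\<lambda>x. ediff (\<lambda>a. H ((pt n c x)(Suc n := a))) \<xi>)" by (simp only:)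
qed

lemma C_kp_cochains:
  assumes H: "H \<in> cochains G (Suc n)" and c: "charts n c"
  shows "C_kp k n (dom n c) K (\<lambda>x k. H ((pt n c x)(Suc n := k)))"
proof (rule C_kp_local[OF open_dom[OF c]])
  fix k0 assume "k0 \<in> K"
  obtain d where d: "d \<in> atlas G" "k0 \<in> fst d" using chart_at by blast
  define c' where "c' = c(Suc n := d)"
  have c': "charts (Suc n) c'" using c d(1) by (auto simp: charts_def c'_def)
  have "C_kp k n (dom n c) (fst d) (\<lambda>x k. H ((pt n c x)(Suc n := k)))"
  proof (rule C_kp_of_C_k[OF chart_homeo(1)[OF d(1)] _ cochainsD[OF H c']])
    fix x k assume "x \<in> dom n c" "k \<in> fst d"
    then show "x(Suc n := snd d k) \<in> dom (Suc n) c'" by (auto simp: dom_def c'_def)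
  next
    fix x k assume k: "k \<in> fst d"
    have "(pt n c x)(Suc n := k) = pt (Suc n) c' (x(Suc n := snd d k))"
      using chart_homeo(3)[OF d(1) k] by (auto simp: pt_def c'_def fun_eq_iff)
    then show "H ((pt n c x)(Suc n := k)) = H (pt (Suc n) c' (x(Suc n := snd d k)))" by (simp only:)
  qed
  then show "\<exists>U. open U \<and> k0 \<in> U \<and> C_kp k n (dom n c) U (\<lambda>x k. H ((pt n c x)(Suc n := k)))"
    using d chart_open(1)[OF d(1)] by (intro exI[of _ "fst d"] conjI)
qed

lemma integral_cochains:
  fixes H :: "(nat \<Rightarrow> 'g) \<Rightarrow> 'v::{banach, second_countable_topology}"
  assumes K: "compact_prob K \<mu>" and H: "H \<in> cochains G (Suc n)"
  shows "(\<lambda>g. \<integral>k. H (g(Suc n := k)) \<partial>\<mu>) \<in> cochains G n"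
proof (rule cochainsI)
  interpret compact_prob K \<mu> by (rule K)
  show "depends_upto n (\<lambda>g. \<integral>k. H (g(Suc n := k)) \<partial>\<mu>)"
  proof (rule depends_uptoI)
    fix g h :: "nat \<Rightarrow> 'g" assume gh: "\<And>i. 1 \<le> i \<Longrightarrow> i \<le> n \<Longrightarrow> g i = h i"
    have "H (g(Suc n := a)) = H (h(Suc n := a))" for a
      by (rule depends_uptoD[OF cochains_depends[OF H]]) (simp add: gh)
    then show "(\<integral>k. H (g(Suc n := k)) \<partial>\<mu>) = (\<integral>k. H (h(Suc n := k)) \<partial>\<mu>)" by simp
  qed
  fix c k assume c: "charts n c"
  show "C_k k n (dom n c) (\<lambda>x. \<integral>k. H ((pt n c x)(Suc n := k)) \<partial>\<mu>)"
    by (rule C_k_integral[OF open_dom[OF c] C_kp_cochains[OF H c]])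
qed

lemma ediff_integral:
  fixes q :: "'g \<Rightarrow> 'g \<Rightarrow> 'v::{banach, second_countable_topology}"
  assumes K: "compact_prob K \<mu>" and q: "(\<lambda>g. q (g 1) (g 2)) \<in> cochains G 2"
  shows "ediff (\<lambda>a. \<integral>k. q a k \<partial>\<mu>) \<xi> = (\<integral>k. ediff (\<lambda>a. q a k) \<xi> \<partial>\<mu>)"
proof -
  interpret compact_prob K \<mu> by (rule K)
  have c: "charts 1 (\<lambda>_. C0)" by (simp add: charts_def ident_chart)
  have q': "(\<lambda>g. q (g 1) (g 2)) \<in> cochains G (Suc 1)" using q by (simp add: numeral_2_eq_2)
  have "C_kp (Suc 0) 1 (dom 1 (\<lambda>_. C0)) K (\<lambda>x k. q (chart_inv C0 (x 1)) k)"
    using C_kp_cochains[OF q' c, of "Suc 0" K] by (simp add: pt_def numeral_2_eq_2)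
  from has_partial_deriv_integral[OF open_dom[OF c] this, of 1 base \<xi>]
  have "((\<lambda>t. \<integral>k. q (exp_chart G (t *\<^sub>R \<xi>)) k \<partial>\<mu>) has_vector_derivative
      (\<integral>k. partial_deriv 1 \<xi> (\<lambda>x. q (chart_inv C0 (x 1)) k) base \<partial>\<mu>)) (at 0)"
    using ic_one(1) by (simp add: dom_def exp_chart_def)
  from vector_derivative_at[OF this] show ?thesis
    unfolding ediff_def[of "\<lambda>a. \<integral>k. q a k \<partial>\<mu>"] ediff_partial_deriv[of "\<lambda>a. q a k" for k] .
qed

section \<open>The adjoint action and the bracket\<close>

lemma Ad_ediff: "Ad G a \<xi> = ediff (\<lambda>b. ic (a \<otimes> b \<otimes> inv a)) \<xi>"
  by (simp add: Ad_def ediff_def)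

lemma smap_conj: "smap 1 (\<lambda>g. a \<otimes> g 1 \<otimes> inv a)"
  by (intro smap_mult smap_const smap_proj) simp_all

lemma velocity_conj: "velocity \<gamma> \<xi> \<Longrightarrow> velocity (\<lambda>t. a \<otimes> \<gamma> t \<otimes> inv a) (Ad G a \<xi>)"
  unfolding Ad_ediff by (rule velocity_map[where F = "\<lambda>b. a \<otimes> b \<otimes> inv a", OF smap_conj]) simp_all

lemma linear_Ad: "linear (Ad G a)"
proof -
  have "linear (ediff (\<lambda>b. ic (a \<otimes> b \<otimes> inv a)))"
    by (intro linear_ediff smap_smooth_at_e smap_conj ident_chart) (simp add: one_in_ident)
  moreover have "Ad G a = ediff (\<lambda>b. ic (a \<otimes> b \<otimes> inv a))" by (rule ext) (rule Ad_ediff)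
  ultimately show ?thesis by simp
qed

text \<open>Both sides are velocities of the same curve, the conjugate of \<open>exp_chart\<close>
  by \<open>a \<otimes> b\<close>.\<close>

lemma Ad_mult: "Ad G (a \<otimes> b) \<xi> = Ad G a (Ad G b \<xi>)"
proof (rule velocity_unique)
  show "velocity (\<lambda>t. a \<otimes> (b \<otimes> exp_chart G (t *\<^sub>R \<xi>) \<otimes> inv b) \<otimes> inv a) (Ad G a (Ad G b \<xi>))"
    by (intro velocity_conj velocity_exp)
  show "velocity (\<lambda>t. a \<otimes> (b \<otimes> exp_chart G (t *\<^sub>R \<xi>) \<otimes> inv b) \<otimes> inv a) (Ad G (a \<otimes> b) \<xi>)"
    using velocity_conj[OF velocity_exp, of "a \<otimes> b" \<xi>] by (simp add: m_assoc inv_mult_group)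
qed

lemma Ad_one [simp]: "Ad G \<one> \<xi> = \<xi>"
  by (rule velocity_unique[of "\<lambda>t. exp_chart G (t *\<^sub>R \<xi>)"])
     (use velocity_conj[OF velocity_exp, of \<one> \<xi>] velocity_exp in simp_all)

lemma Ad_inv [simp]: "Ad G (inv a) (Ad G a \<xi>) = \<xi>" "Ad G a (Ad G (inv a) \<xi>) = \<xi>"
  by (simp_all flip: Ad_mult)

text \<open>Differentiate \<open>(a, b, c) \<mapsto> a b c\<^sup>-\<^sup>1\<close> first in \<open>b\<close> along \<open>\<eta>\<close>, then in \<open>a\<close> and \<open>c\<close> along \<open>\<xi>\<close>. The derivative in \<open>a\<close> gives
  the first term of the bracket; in \<open>c\<close>, the two derivatives are exchanged to give the second.\<close>

lemma Ad_curve_derivative: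
  assumes \<gamma>: "velocity \<gamma> \<xi>"
  shows "((\<lambda>t. Ad G (\<gamma> t) \<eta>) has_vector_derivative lie_bracket G \<xi> \<eta>) (at 0)"
proof -
  define c where "c = (\<lambda>_::nat. C0)"
  have c: "charts 3 c" by (simp add: charts_def ident_chart c_def)
  define m where "m g = g 1 \<otimes> g 2 \<otimes> inv (g 3)" for g :: "nat \<Rightarrow> 'g"
  have m: "smap 3 m" unfolding m_def by (intro smap_intros) simp_all
  define T where "T = {x \<in> dom 3 c. m (pt 3 c x) \<in> fst C0}"
  have oT: "open T" unfolding T_def by (rule open_preimage_pt[OF c smap_continuous[OF m] chart_open(1)[OF ident_chart]])
  have pt: "pt 3 c x 1 = chart_inv C0 (x 1)" "pt 3 c x 2 = chart_inv C0 (x 2)" "pt 3 c x 3 = chart_inv C0 (x 3)" for x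
    by (simp_all add: pt_def c_def)
  have bT: "base \<in> T" unfolding T_def m_def mem_Collect_eq pt ic_one by (simp add: one_in_ident dom_def c_def ic_one)
  define u where "u = (\<lambda>x. ic (m (pt 3 c x)))"
  have u: "C_k (Suc (Suc 0)) 3 T u" unfolding T_def u_def by (rule smapD[OF m c ident_chart])
  let ?P = "partial_deriv 2 \<eta> u"
  have P: "C_k (Suc 0) 3 T ?P" by (rule C_k_partial[OF u]) simp
  \<comment> \<open>Slot 2 rests at the neutral element, because the derivative in it has already
    been taken.\<close>
  define y where "y t j = (if j = 1 \<or> j = 3 then ic (\<gamma> t) else ic \<one>)" for t and j :: nat
  have y0: "y 0 = base" using \<gamma> by (auto simp: y_def velocity_def fun_eq_iff)
  let ?v = "\<lambda>j::nat. if j = 2 then 0 else \<xi>"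
  have "((\<lambda>t. ?P (y t)) has_vector_derivative
     (\<Sum>j=1..3. \<Sum>b\<in>fbasis. fcoord b (?v j) *\<^sub>R partial_deriv j b ?P (y 0))) (at 0)"
  proof (rule C_1_curve[OF fd_e oT P])
    show "y 0 \<in> T" using bT by (simp only: y0)
    fix j :: nat assume "j \<in> {1..3}"
    then consider "j = 1" | "j = 2" | "j = 3" by fastforce
    then show "((\<lambda>t. y t j) has_vector_derivative ?v j) (at 0)"
      by cases (use \<gamma> in \<open>simp_all add: y_def velocity_def\<close>)
  qed (auto simp: y_def)
  also have "(\<Sum>j=1..3. \<Sum>b\<in>fbasis. fcoord b (?v j) *\<^sub>R partial_deriv j b ?P (y 0))
     = (\<Sum>j=1..3. partial_deriv j (?v j) ?P base)"
    unfolding y0 by (intro sum.cong refl) (rule partial_deriv_expand[OF fd_e oT P _ bT, symmetric])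
  also have "\<dots> = partial_deriv 1 \<xi> ?P base + partial_deriv 3 \<xi> ?P base"
    by (simp add: numeral_3_eq_3 numeral_2_eq_2) (simp add: partial_deriv_def)
  also have "partial_deriv 1 \<xi> ?P base = vector_derivative (\<lambda>s. left_field G \<eta> (s *\<^sub>R \<xi>)) (at 0)"
    unfolding partial_deriv_def left_field_def left_deriv_def u_def m_def pt
    by (simp add: exp_chart_def ic_one)
  also have "partial_deriv 3 \<xi> ?P base = partial_deriv 2 \<eta> (partial_deriv 3 \<xi> u) base"
    by (rule partial_deriv_commute[OF oT u _ _ _ bT]) simp_all
  also have "\<dots> = - vector_derivative (\<lambda>s. left_field G \<xi> (s *\<^sub>R \<eta>)) (at 0)"
  proof -
    \<comment> \<open>For a fixed second factor, the inverse in the third one reverses the velocity,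
      which produces minus the left-invariant field. This needs the second factor to lie in the
      identity chart, hence the restriction to small \<open>s\<close>.\<close>
    have ev: "\<forall>\<^sub>F s in nhds 0. left_field G \<xi> (s *\<^sub>R \<eta>) = - partial_deriv 3 \<xi> u (base(2 := base 2 + s *\<^sub>R \<eta>))"
    proof -
      have "(\<lambda>t. exp_chart G (t *\<^sub>R \<eta>)) \<midarrow>0\<rightarrow> \<one>"
        using velocity_exp[of \<eta>] by (simp add: velocity_def isCont_def)
      then have "((\<lambda>t. exp_chart G (t *\<^sub>R \<eta>)) \<longlongrightarrow> \<one>) (nhds 0)" by (simp add: tendsto_nhds_iff)
      from topological_tendstoD[OF this chart_open(1)[OF ident_chart] one_in_ident]
      show ?thesis
      proof (rule eventually_mono)
        fix s assume s: "exp_chart G (s *\<^sub>R \<eta>) \<in> fst C0"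
        let ?b = "exp_chart G (s *\<^sub>R \<eta>)"
        have "smap 1 (\<lambda>g. ?b \<otimes> g 1)" by (intro smap_intros) simp_all
        then have sm: "smooth_at_e (\<lambda>a. ic (?b \<otimes> a))"
          by (rule smap_smooth_at_e[OF _ ident_chart]) (simp add: s)
        have "partial_deriv 3 \<xi> u (base(2 := base 2 + s *\<^sub>R \<eta>))
          = vector_derivative (\<lambda>t. ic (?b \<otimes> inv (exp_chart G (t *\<^sub>R \<xi>)))) (at 0)"
          unfolding partial_deriv_def u_def m_def pt by (simp add: exp_chart_def ic_one)
        also have "\<dots> = ediff (\<lambda>a. ic (?b \<otimes> a)) (- \<xi>)"
          by (rule vector_derivative_at[OF curve_derivative[OF sm velocity_inv[OF velocity_exp]]])
        also have "\<dots> = - ediff (\<lambda>a. ic (?b \<otimes> a)) \<xi>" by (rule linear_neg[OF linear_ediff[OF sm]])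
        finally show "left_field G \<xi> (s *\<^sub>R \<eta>) = - partial_deriv 3 \<xi> u (base(2 := base 2 + s *\<^sub>R \<eta>))"
          by (simp add: left_field_def left_deriv_def ediff_def)
      qed
    qed
    have "((\<lambda>s. partial_deriv 3 \<xi> u (base(2 := base 2 + s *\<^sub>R \<eta>))) has_vector_derivative
        partial_deriv 2 \<eta> (partial_deriv 3 \<xi> u) base) (at 0)"
      by (rule has_partial_deriv[OF C_k_partial[OF u] _ bT]) simp_all
    from has_vector_derivative_minus[OF this]
    have "((\<lambda>s. left_field G \<xi> (s *\<^sub>R \<eta>)) has_vector_derivative
        - partial_deriv 2 \<eta> (partial_deriv 3 \<xi> u) base) (at 0)"
      unfolding has_vector_derivative_cong_eventually[OF ev] .
    from vector_derivative_at[OF this] show ?thesis by simp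
  qed
  finally have 1: "((\<lambda>t. ?P (y t)) has_vector_derivative lie_bracket G \<xi> \<eta>) (at 0)"
    by (simp add: lie_bracket_def)
  have ev: "\<forall>\<^sub>F t in nhds 0. Ad G (\<gamma> t) \<eta> = ?P (y t)"
    using velocity_eventually[OF \<gamma>]
  proof (rule eventually_mono)
    fix t assume "chart_inv C0 (ic (\<gamma> t)) = \<gamma> t"
    then show "Ad G (\<gamma> t) \<eta> = ?P (y t)"
      unfolding Ad_def partial_deriv_def u_def m_def pt by (simp add: y_def exp_chart_def)
  qed
  show ?thesis unfolding has_vector_derivative_cong_eventually[OF ev] by (rule 1)
qed

lemma bracket_antisym: "lie_bracket G \<xi> \<eta> = - lie_bracket G \<eta> \<xi>"
  by (simp add: lie_bracket_def)

text \<open>The bracket is the derivative of \<open>Ad\<close> along a curve, and \<open>Ad\<close>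
  is linear in its vector argument; the coordinate definition by derivatives of vector fields does
  not show this directly.\<close>

lemma linear_bracket_right: "linear (lie_bracket G \<xi>)"
proof (rule linearI)
  note d = Ad_curve_derivative[OF velocity_exp[of \<xi>]]
  show "lie_bracket G \<xi> (\<eta> + \<zeta>) = lie_bracket G \<xi> \<eta> + lie_bracket G \<xi> \<zeta>" for \<eta> \<zeta>
    by (rule vector_derivative_unique_at[OF d])
       (use has_vector_derivative_add[OF d[of \<eta>] d[of \<zeta>]] in \<open>simp add: linear_add[OF linear_Ad]\<close>)
  show "lie_bracket G \<xi> (r *\<^sub>R \<eta>) = r *\<^sub>R lie_bracket G \<xi> \<eta>" for r \<eta>
    by (rule vector_derivative_unique_at[OF d])
       (use bounded_linear.has_vector_derivative[OF bounded_linear_scaleR_right[of r] d[of \<eta>]] in \<open>simp add: linear_scale[OF linear_Ad]\<close>)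
qed

lemma linear_bracket_left: "linear (\<lambda>\<xi>. lie_bracket G \<xi> \<eta>)"
  using linear_compose_neg[OF linear_bracket_right[of \<eta>]] by (simp flip: bracket_antisym)

lemma bracket_self [simp]: "lie_bracket G \<xi> \<xi> = 0"
  by (simp add: lie_bracket_def)

text \<open>Differentiate \<open>Ad\<close> along the conjugated curve
  \<open>a \<otimes> exp_chart G (t *\<^sub>R \<xi>) \<otimes> inv a\<close>, applied to
  \<open>Ad G a \<eta>\<close>, in two ways.\<close>

lemma Ad_bracket: "Ad G a (lie_bracket G \<xi> \<eta>) = lie_bracket G (Ad G a \<xi>) (Ad G a \<eta>)"
proof (rule vector_derivative_unique_at)
  have bl: "bounded_linear (Ad G a)" by (rule linear_imp_bounded_linear[OF fd_e linear_Ad])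
  show "((\<lambda>t. Ad G a (Ad G (exp_chart G (t *\<^sub>R \<xi>)) \<eta>)) has_vector_derivative Ad G a (lie_bracket G \<xi> \<eta>)) (at 0)"
    by (rule bounded_linear.has_vector_derivative[OF bl Ad_curve_derivative[OF velocity_exp]])
  have "Ad G (a \<otimes> exp_chart G (t *\<^sub>R \<xi>) \<otimes> inv a) (Ad G a \<eta>) = Ad G a (Ad G (exp_chart G (t *\<^sub>R \<xi>)) \<eta>)" for t
    by (simp add: Ad_mult)
  then show "((\<lambda>t. Ad G a (Ad G (exp_chart G (t *\<^sub>R \<xi>)) \<eta>)) has_vector_derivative
      lie_bracket G (Ad G a \<xi>) (Ad G a \<eta>)) (at 0)"
    using Ad_curve_derivative[OF velocity_conj[OF velocity_exp[of \<xi>], of a], of "Ad G a \<eta>"] by simp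
qed

end

section \<open>The Chevalley-Eilenberg formula\<close>

lemma alt_formsD:
  assumes "\<omega> \<in> alt_forms q"
  shows "depends_upto q \<omega>" "1 \<le> i \<Longrightarrow> i \<le> q \<Longrightarrow> linear (\<lambda>v. \<omega> (\<xi>(i := v)))"
    and "1 \<le> i \<Longrightarrow> i \<le> q \<Longrightarrow> 1 \<le> j \<Longrightarrow> j \<le> q \<Longrightarrow> i \<noteq> j \<Longrightarrow> \<xi> i = \<xi> j \<Longrightarrow> \<omega> \<xi> = 0"
proof -
  have *: "depends_upto q \<omega>" "\<forall>i\<in>{1..q}. \<forall>\<xi>. linear (\<lambda>v. \<omega> (\<xi>(i := v)))"
    "\<forall>\<xi>. \<forall>i\<in>{1..q}. \<forall>j\<in>{1..q}. i \<noteq> j \<and> \<xi> i = \<xi> j \<longrightarrow> \<omega> \<xi> = 0"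
    using assms unfolding alt_forms_def by blast+
  show "depends_upto q \<omega>" by (rule *(1))
  show "linear (\<lambda>v. \<omega> (\<xi>(i := v)))" if "1 \<le> i" "i \<le> q" using *(2) that by simp
  show "\<omega> \<xi> = 0" if "1 \<le> i" "i \<le> q" "1 \<le> j" "j \<le> q" "i \<noteq> j" "\<xi> i = \<xi> j"
    by (rule *(3)[rule_format, of i j]) (use that in auto)
qed

lemma alt_forms_zero: "(\<lambda>_. 0) \<in> alt_forms q"
  by (simp add: alt_forms_def depends_upto_def linear_iff)

lemma alt_forms_add:
  assumes "\<omega> \<in> alt_forms q" "\<tau> \<in> alt_forms q" shows "(\<lambda>\<xi>. \<omega> \<xi> + \<tau> \<xi>) \<in> alt_forms q"
  unfolding alt_forms_def
proof (intro CollectI conjI ballI allI impI)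
  show "depends_upto q (\<lambda>\<xi>. \<omega> \<xi> + \<tau> \<xi>)"
    by (rule depends_upto_comp2[OF alt_formsD(1)[OF assms(1)] alt_formsD(1)[OF assms(2)]])
  show "linear (\<lambda>v. \<omega> (\<xi>(i := v)) + \<tau> (\<xi>(i := v)))" if "i \<in> {1..q}" for \<xi> i
    using that by (intro linear_compose_add alt_formsD(2)[OF assms(1)] alt_formsD(2)[OF assms(2)]) auto
  show "\<omega> \<xi> + \<tau> \<xi> = 0" if "i \<in> {1..q}" "j \<in> {1..q}" "i \<noteq> j \<and> \<xi> i = \<xi> j" for \<xi> i j
    using that alt_formsD(3)[OF assms(1), of i j \<xi>] alt_formsD(3)[OF assms(2), of i j \<xi>] by simp
qed

lemma alt_forms_scaleR:
  assumes "\<omega> \<in> alt_forms q" shows "(\<lambda>\<xi>. r *\<^sub>R \<omega> \<xi>) \<in> alt_forms q"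
  unfolding alt_forms_def
proof (intro CollectI conjI ballI allI impI)
  show "depends_upto q (\<lambda>\<xi>. r *\<^sub>R \<omega> \<xi>)" by (rule depends_upto_comp1[OF alt_formsD(1)[OF assms(1)]])
  show "linear (\<lambda>v. r *\<^sub>R \<omega> (\<xi>(i := v)))" if "i \<in> {1..q}" for \<xi> i
    using that by (intro linear_compose_scale_right alt_formsD(2)[OF assms(1)]) auto
  show "r *\<^sub>R \<omega> \<xi> = 0" if "i \<in> {1..q}" "j \<in> {1..q}" "i \<noteq> j \<and> \<xi> i = \<xi> j" for \<xi> i j
    using that alt_formsD(3)[OF assms(1), of i j \<xi>] by simp
qed

lemma alt_forms_diff:
  assumes "\<omega> \<in> alt_forms q" "\<tau> \<in> alt_forms q" shows "(\<lambda>\<xi>. \<omega> \<xi> - \<tau> \<xi>) \<in> alt_forms q"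
  using alt_forms_add[OF assms(1) alt_forms_scaleR[OF assms(2), of "-1"]] by simp

text \<open>Polarisation: the form vanishes with \<open>a + b\<close> in both slots, and this value
  is expanded.\<close>

lemma alt_forms_swap:
  assumes w: "\<omega> \<in> alt_forms q" and i: "1 \<le> i" "i \<le> q" and j: "1 \<le> j" "j \<le> q" and ij: "i \<noteq> j"
  shows "\<omega> (\<xi>(i := a, j := b)) = - \<omega> (\<xi>(i := b, j := a))"
proof -
  have lj: "linear (\<lambda>v. \<omega> (\<zeta>(j := v)))" for \<zeta> by (rule alt_formsD(2)[OF w j])
  have li: "linear (\<lambda>v. \<omega> (\<xi>(i := v, j := c)))" for c
    using alt_formsD(2)[OF w i, of "\<xi>(j := c)"] ij by (simp add: fun_upd_twist)
  have z: "\<omega> (\<xi>(i := c, j := c)) = 0" for c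
    by (rule alt_formsD(3)[OF w i j ij]) (use ij in simp)
  have "0 = \<omega> (\<xi>(i := a + b, j := a + b))" by (rule z[symmetric])
  also have "\<dots> = \<omega> (\<xi>(i := a + b, j := a)) + \<omega> (\<xi>(i := a + b, j := b))" by (rule linear_add[OF lj])
  also have "\<omega> (\<xi>(i := a + b, j := a)) = \<omega> (\<xi>(i := a, j := a)) + \<omega> (\<xi>(i := b, j := a))" by (rule linear_add[OF li])
  also have "\<omega> (\<xi>(i := a + b, j := b)) = \<omega> (\<xi>(i := a, j := b)) + \<omega> (\<xi>(i := b, j := b))" by (rule linear_add[OF li])
  finally have "0 = \<omega> (\<xi>(i := b, j := a)) + \<omega> (\<xi>(i := a, j := b))"
    by (simp only: z add_0_left add_0_right)
  then show ?thesis by (simp add: eq_neg_iff_add_eq_0 add.commute)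
qed

lemma prepend_simps:
  "prepend \<eta> \<xi> (Suc 0) = \<eta>" "1 \<le> k \<Longrightarrow> prepend \<eta> \<xi> (Suc k) = \<xi> k"
  by (auto simp: prepend_def)

lemma prepend_upd: "1 \<le> i \<Longrightarrow> prepend \<eta> (\<xi>(i := v)) = (prepend \<eta> \<xi>)(Suc i := v)"
  by (auto simp: prepend_def fun_eq_iff)

lemma prepend_upd_1: "depends_upto q \<omega> \<Longrightarrow> \<omega> ((prepend \<eta> \<xi>)(Suc 0 := v)) = \<omega> (prepend v \<xi>)"
  by (rule depends_uptoD) (auto simp: prepend_def)

text \<open>Since \<open>prepend\<close> overwrites entry 0 as well, the two tuples may differ
  there; the equation holds only after a form that reads the entries from 1 on has been
  applied.\<close>

lemma prepend_tail:
  assumes "depends_upto q \<omega>" shows "\<omega> \<xi> = \<omega> (prepend (\<xi> 1) (\<lambda>k. \<xi> (Suc k)))"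
proof (rule depends_uptoD[OF assms])
  fix i :: nat assume "1 \<le> i" then show "\<xi> i = prepend (\<xi> 1) (\<lambda>k. \<xi> (Suc k)) i" by (cases i) (auto simp: prepend_def)
qed

lemma omit_prepend: "1 \<le> i \<Longrightarrow> omit (Suc i) (prepend \<eta> \<xi>) = prepend \<eta> (omit i \<xi>)"
  by (auto simp: omit_def prepend_def fun_eq_iff)

lemma omit_1_prepend: "depends_upto q \<omega> \<Longrightarrow> \<omega> (omit (Suc 0) (prepend \<eta> \<xi>)) = \<omega> \<xi>"
  by (rule depends_uptoD) (auto simp: prepend_def omit_def)

lemma prepend_omit_1_prepend: "prepend b (omit (Suc 0) (prepend \<eta> \<xi>)) = prepend b \<xi>"
  by (auto simp: prepend_def omit_def fun_eq_iff)

lemma alt_forms_contract: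
  assumes w: "\<omega> \<in> alt_forms (Suc q)" shows "(\<lambda>\<xi>. \<omega> (prepend \<eta> \<xi>)) \<in> alt_forms q"
  unfolding alt_forms_def
proof (intro CollectI conjI ballI allI impI)
  show "depends_upto q (\<lambda>\<xi>. \<omega> (prepend \<eta> \<xi>))"
  proof (rule depends_uptoI)
    fix g h :: "nat \<Rightarrow> 'a" assume gh: "\<And>i. 1 \<le> i \<Longrightarrow> i \<le> q \<Longrightarrow> g i = h i"
    show "\<omega> (prepend \<eta> g) = \<omega> (prepend \<eta> h)"
      by (rule depends_uptoD[OF alt_formsD(1)[OF w]]) (auto simp: prepend_def gh)
  qed
  show "linear (\<lambda>v. \<omega> (prepend \<eta> (\<xi>(i := v))))" if "i \<in> {1..q}" for \<xi> i
    using that alt_formsD(2)[OF w, of "Suc i" "prepend \<eta> \<xi>"] by (simp add: prepend_upd)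
  show "\<omega> (prepend \<eta> \<xi>) = 0" if "i \<in> {1..q}" "j \<in> {1..q}" "i \<noteq> j \<and> \<xi> i = \<xi> j" for \<xi> i j
    by (rule alt_formsD(3)[OF w, of "Suc i" "Suc j"]) (use that in \<open>auto simp: prepend_simps\<close>)
qed

lemma alt_forms_prepend_linear:
  assumes w: "\<omega> \<in> alt_forms (Suc q)" shows "linear (\<lambda>\<eta>. \<omega> (prepend \<eta> \<xi>))"
  using alt_formsD(2)[OF w, of 1 "prepend 0 \<xi>"] by (simp add: prepend_upd_1[OF alt_formsD(1)[OF w]])

text \<open>Carrying the first argument to slot \<open>j\<close> costs \<open>j - 1\<close>
  transpositions of neighbours.\<close>

lemma alt_forms_move:
  assumes w: "\<omega> \<in> alt_forms q"
  shows "1 \<le> j \<Longrightarrow> j \<le> q \<Longrightarrow> \<omega> (prepend b (omit j \<xi>)) = (-1) ^ (j + 1) *\<^sub>R \<omega> (\<xi>(j := b))"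
proof (induction j arbitrary: \<xi> rule: nat_induct_at_least)
  case base
  have "\<omega> (prepend b (omit 1 \<xi>)) = \<omega> (\<xi>(1 := b))"
    by (rule depends_uptoD[OF alt_formsD(1)[OF w]]) (auto simp: prepend_def omit_def)
  moreover have "(-1 :: real) ^ (1 + 1) = 1" by simp
  ultimately show ?case by (simp only: scaleR_one)
next
  case (Suc j)
  \<comment> \<open>With \<open>\<xi> j\<close> copied into slot \<open>j + 1\<close>, omitting slot
    \<open>j\<close> of \<open>\<zeta>\<close> leaves the same entries as omitting slot
    \<open>j + 1\<close> of \<open>\<xi>\<close>.\<close>
  define \<zeta> where "\<zeta> = \<xi>(Suc j := \<xi> j)"
  have "prepend b (omit (Suc j) \<xi>) i = prepend b (omit j \<zeta>) i" if "1 \<le> i" for i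
    using that Suc.hyps by (auto simp: prepend_def omit_def \<zeta>_def less_Suc_eq)
  then have "\<omega> (prepend b (omit (Suc j) \<xi>)) = \<omega> (prepend b (omit j \<zeta>))"
    by (intro depends_uptoD[OF alt_formsD(1)[OF w]]) simp
  also have "\<dots> = (-1) ^ (j + 1) *\<^sub>R \<omega> (\<zeta>(j := b))" by (rule Suc.IH) (use Suc.prems in simp)
  also have "\<zeta>(j := b) = \<xi>(j := b, Suc j := \<xi> j)" by (auto simp: \<zeta>_def fun_eq_iff)
  also have "\<omega> (\<xi>(j := b, Suc j := \<xi> j)) = - \<omega> (\<xi>(j := \<xi> j, Suc j := b))"
    by (rule alt_forms_swap[OF w]) (use Suc in auto)
  finally have "\<omega> (prepend b (omit (Suc j) \<xi>)) = (-1) ^ (j + 1) *\<^sub>R - \<omega> (\<xi>(j := \<xi> j, Suc j := b))" .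
  moreover have "\<xi>(j := \<xi> j, Suc j := b) = \<xi>(Suc j := b)" by auto
  moreover have "(-1) ^ (j + 1) *\<^sub>R - x = (-1) ^ (Suc j + 1) *\<^sub>R x" for x :: 'b by simp
  ultimately show ?case by (simp only:)
qed

text \<open>A criterion made for induction with Cartan's formula. As the contractions are already
  alternating, the only coincidences left are those of the first argument with another one, and
  these can be moved into the first two slots.\<close>

lemma alt_formsI:
  assumes dep: "depends_upto (Suc q) \<omega>"
    and con: "\<And>\<eta>. (\<lambda>\<xi>. \<omega> (prepend \<eta> \<xi>)) \<in> alt_forms q"
    and lin: "\<And>\<xi>. linear (\<lambda>\<eta>. \<omega> (prepend \<eta> \<xi>))"
    and van: "\<And>\<eta> \<xi>. q > 0 \<Longrightarrow> \<omega> (prepend \<eta> (prepend \<eta> \<xi>)) = 0"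
  shows "\<omega> \<in> alt_forms (Suc q)"
proof -
  define tl where "tl \<xi> = (\<lambda>k. \<xi> (Suc k))" for \<xi> :: "nat \<Rightarrow> 'a"
  have tl: "\<omega> \<xi> = \<omega> (prepend (\<xi> 1) (tl \<xi>))" for \<xi>
    unfolding tl_def by (rule prepend_tail[OF dep])
  have first: "\<omega> \<xi> = 0" if j: "2 \<le> j" "j \<le> Suc q" "\<xi> 1 = \<xi> j" for \<xi> j
  proof (cases "j = 2")
    case True
    have "\<omega> \<xi> = \<omega> (prepend (\<xi> 1) (prepend (tl \<xi> 1) (tl (tl \<xi>))))"
      using tl[of \<xi>] prepend_tail[OF alt_formsD(1)[OF con], of "\<xi> 1" "tl \<xi>"] unfolding tl_def by simp
    also have "tl \<xi> 1 = \<xi> 1" using True j by (simp add: tl_def numeral_2_eq_2)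
    also have "\<omega> (prepend (\<xi> 1) (prepend (\<xi> 1) (tl (tl \<xi>)))) = 0" by (rule van) (use j in simp)
    finally show ?thesis .
  next
    case False
    then obtain k where k: "j = Suc k" "2 \<le> k" "k \<le> q" using j by (cases j) auto
    let ?t = "tl \<xi>"
    have "\<omega> \<xi> = \<omega> (prepend (\<xi> 1) (?t(1 := ?t 1, k := ?t k)))" using tl[of \<xi>] by simp
    \<comment> \<open>Inside the contraction the repeated argument is swapped to the front, next to
      its copy in the first slot.\<close>
    also have "\<dots> = - \<omega> (prepend (\<xi> 1) (?t(1 := ?t k, k := ?t 1)))"
      by (rule alt_forms_swap[OF con]) (use k in auto)
    also have "\<omega> (prepend (\<xi> 1) (?t(1 := ?t k, k := ?t 1)))
       = \<omega> (prepend (\<xi> 1) (prepend ((?t(1 := ?t k, k := ?t 1)) 1) (tl (?t(1 := ?t k, k := ?t 1)))))"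
      unfolding tl_def[of "?t(1 := ?t k, k := ?t 1)"] by (rule prepend_tail[OF alt_formsD(1)[OF con]])
    also have "(?t(1 := ?t k, k := ?t 1)) 1 = \<xi> 1" using k j by (simp add: tl_def)
    also have "\<omega> (prepend (\<xi> 1) (prepend (\<xi> 1) (tl (?t(1 := ?t k, k := ?t 1))))) = 0" by (rule van) (use k in simp)
    finally show ?thesis by simp
  qed
  show ?thesis unfolding alt_forms_def
  proof (intro CollectI conjI ballI allI impI dep)
    fix i and \<xi> :: "nat \<Rightarrow> 'a" assume i: "i \<in> {1..Suc q}"
    show "linear (\<lambda>v. \<omega> (\<xi>(i := v)))"
    proof (cases "i = 1")
      case True
      have "\<omega> (\<xi>(i := v)) = \<omega> (prepend v (tl \<xi>))" for v
        by (rule depends_uptoD[OF dep]) (auto simp: True prepend_def tl_def)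
      then show ?thesis using lin by simp
    next
      case False
      then obtain k where k: "i = Suc k" "1 \<le> k" "k \<le> q" using i by (cases i) auto
      have "\<omega> (\<xi>(i := v)) = \<omega> (prepend (\<xi> 1) ((tl \<xi>)(k := v)))" for v
        by (rule depends_uptoD[OF dep]) (use k in \<open>auto simp: prepend_def tl_def\<close>)
      then show ?thesis using alt_formsD(2)[OF con k(2,3)] by simp
    qed
    fix j assume j: "j \<in> {1..Suc q}" and ij: "i \<noteq> j \<and> \<xi> i = \<xi> j"
    consider "i = 1" "2 \<le> j" | "j = 1" "2 \<le> i" | "2 \<le> i" "2 \<le> j" using i j ij by fastforce
    then show "\<omega> \<xi> = 0"
    proof cases
      case 1 then show ?thesis using first[of j \<xi>] j ij by simp
    next
      case 2 then show ?thesis using first[of i \<xi>] i ij by simp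
    next
      case 3
      have "\<omega> (prepend (\<xi> 1) (tl \<xi>)) = 0"
        by (rule alt_formsD(3)[OF con, of "i - 1" "j - 1"]) (use 3 i j ij in \<open>auto simp: tl_def\<close>)
      then show ?thesis by (simp only: tl[of \<xi>])
    qed
  qed
qed

text \<open>\<open>CEa B q \<alpha> w\<close> is the value at one point of the differential of a q-form: \<open>w\<close> is the form at this
  point and \<open>\<alpha> \<zeta>\<close> the form on which \<open>\<zeta>\<close> has acted.\<close>

definition CEa :: "('e \<Rightarrow> 'e \<Rightarrow> 'e) \<Rightarrow> nat \<Rightarrow> ('e \<Rightarrow> ('e, 'v::real_vector) form) \<Rightarrow> ('e, 'v) form \<Rightarrow> ('e, 'v) form" where
  "CEa B q \<alpha> w \<xi> = (\<Sum>i=1..q+1. (-1) ^ (i + 1) *\<^sub>R \<alpha> (\<xi> i) (omit i \<xi>))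
     + (\<Sum>j=1..q+1. \<Sum>i=1..<j. (-1) ^ (i + j) *\<^sub>R w (prepend (B (\<xi> i) (\<xi> j)) (omit i (omit j \<xi>))))"

section \<open>Cartan's formula and the alternation of the differential\<close>

definition Lie_deriv :: "('e \<Rightarrow> 'e \<Rightarrow> 'e) \<Rightarrow> nat \<Rightarrow> 'e \<Rightarrow> ('e \<Rightarrow> ('e, 'v::real_vector) form) \<Rightarrow> ('e, 'v) form \<Rightarrow> ('e, 'v) form" where
  "Lie_deriv B q \<eta> \<alpha> w \<xi> = \<alpha> \<eta> \<xi> - (\<Sum>i=1..q. w (\<xi>(i := B \<eta> (\<xi> i))))"

lemma CE_CEa: "CE G act q \<omega> x \<xi> = CEa (lie_bracket G) q (\<lambda>\<zeta> \<theta>. act \<zeta> (\<lambda>y. \<omega> y \<theta>) x) (\<omega> x) \<xi>"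
  unfolding CE_def CEa_def ..

lemma CEa_0_prepend:
  assumes "depends_upto 0 (\<alpha> \<eta>)" shows "CEa B 0 \<alpha> w (prepend \<eta> \<xi>) = \<alpha> \<eta> \<xi>"
  using omit_1_prepend[OF assms, of \<eta> \<xi>] by (simp add: CEa_def prepend_simps)

text \<open>Cartan's formula, obtained by sorting the sums by the position of \<open>\<eta>\<close>.
  The action of \<open>\<eta>\<close> and the brackets of \<open>\<eta>\<close> with one argument
  make up the Lie derivative. The other terms give minus the differential of the contraction: in the
  action sum the sign comes from the index shift, in the bracket sum from moving
  \<open>\<eta>\<close> in front of the bracket.\<close>

lemma CEa_prepend:
  fixes w :: "('e::real_vector, 'v::real_vector) form"
  assumes w: "w \<in> alt_forms (Suc q)" and \<alpha>: "depends_upto (Suc q) (\<alpha> \<eta>)"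
  shows "CEa B (Suc q) \<alpha> w (prepend \<eta> \<xi>) = Lie_deriv B (Suc q) \<eta> \<alpha> w \<xi>
     - CEa B q (\<lambda>\<zeta> \<theta>. \<alpha> \<zeta> (prepend \<eta> \<theta>)) (\<lambda>\<theta>. w (prepend \<eta> \<theta>)) \<xi>"
proof -
  let ?X = "prepend \<eta> \<xi>"
  have A: "(\<Sum>i=1..Suc q+1. (-1) ^ (i + 1) *\<^sub>R \<alpha> (?X i) (omit i ?X))
     = \<alpha> \<eta> \<xi> - (\<Sum>i=1..q+1. (-1) ^ (i + 1) *\<^sub>R \<alpha> (\<xi> i) (prepend \<eta> (omit i \<xi>)))"
  proof -
    have "(\<Sum>i=1..Suc q+1. (-1) ^ (i + 1) *\<^sub>R \<alpha> (?X i) (omit i ?X))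
      = (-1) ^ (1 + 1) *\<^sub>R \<alpha> (?X 1) (omit 1 ?X) + (\<Sum>i=Suc 1..Suc (q+1). (-1) ^ (i + 1) *\<^sub>R \<alpha> (?X i) (omit i ?X))"
      by (subst sum.atLeast_Suc_atMost) auto
    also have "(\<Sum>i=Suc 1..Suc (q+1). (-1) ^ (i + 1) *\<^sub>R \<alpha> (?X i) (omit i ?X))
      = (\<Sum>i=1..q+1. (-1) ^ (Suc i + 1) *\<^sub>R \<alpha> (?X (Suc i)) (omit (Suc i) ?X))"
      by (rule sum.shift_bounds_cl_Suc_ivl)
    also have "\<dots> = (\<Sum>i=1..q+1. - ((-1) ^ (i + 1) *\<^sub>R \<alpha> (\<xi> i) (prepend \<eta> (omit i \<xi>))))"
      by (rule sum.cong) (simp_all add: prepend_simps omit_prepend)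
    finally show ?thesis by (simp add: prepend_simps omit_1_prepend[OF \<alpha>] sum_negf)
  qed
  have B: "(\<Sum>j=1..Suc q+1. \<Sum>i=1..<j. (-1) ^ (i + j) *\<^sub>R w (prepend (B (?X i) (?X j)) (omit i (omit j ?X))))
    = - (\<Sum>j=1..Suc q. w (\<xi>(j := B \<eta> (\<xi> j))))
      - (\<Sum>j=1..q+1. \<Sum>i=1..<j. (-1) ^ (i + j) *\<^sub>R w (prepend \<eta> (prepend (B (\<xi> i) (\<xi> j)) (omit i (omit j \<xi>)))))"
  proof -
    let ?t = "\<lambda>j i. (-1) ^ (i + j) *\<^sub>R w (prepend (B (?X i) (?X j)) (omit i (omit j ?X)))"
    have "(\<Sum>j=1..Suc q+1. \<Sum>i=1..<j. ?t j i) = (\<Sum>i=1..<1. ?t 1 i) + (\<Sum>j=Suc 1..Suc (q+1). \<Sum>i=1..<j. ?t j i)"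
      by (subst sum.atLeast_Suc_atMost) auto
    also have "(\<Sum>j=Suc 1..Suc (q+1). \<Sum>i=1..<j. ?t j i) = (\<Sum>j=1..q+1. \<Sum>i=1..<Suc j. ?t (Suc j) i)"
      by (rule sum.shift_bounds_cl_Suc_ivl)
    also have "\<dots> = (\<Sum>j=1..q+1. - w (\<xi>(j := B \<eta> (\<xi> j)))
        - (\<Sum>i=1..<j. (-1) ^ (i + j) *\<^sub>R w (prepend \<eta> (prepend (B (\<xi> i) (\<xi> j)) (omit i (omit j \<xi>))))))"
    proof (rule sum.cong)
      fix j assume "j \<in> {1..q+1}"
      then have j: "1 \<le> j" "j \<le> Suc q" by auto
      have "(\<Sum>i=1..<Suc j. ?t (Suc j) i) = ?t (Suc j) 1 + (\<Sum>i=Suc 1..<Suc j. ?t (Suc j) i)"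
        using j by (subst sum.atLeast_Suc_lessThan) auto
      also have "(\<Sum>i=Suc 1..<Suc j. ?t (Suc j) i) = (\<Sum>i=1..<j. ?t (Suc j) (Suc i))"
        by (rule sum.shift_bounds_Suc_ivl)
      also have "\<dots> = (\<Sum>i=1..<j. - ((-1) ^ (i + j) *\<^sub>R w (prepend \<eta> (prepend (B (\<xi> i) (\<xi> j)) (omit i (omit j \<xi>))))))"
      proof (rule sum.cong)
        fix i assume "i \<in> {1..<j}"
        then have i: "1 \<le> i" "i < j" by auto
        let ?b = "B (\<xi> i) (\<xi> j)" and ?c = "omit i (omit j \<xi>)"
        \<comment> \<open>Two shifted indices leave the power of -1 unchanged, so the sign has to
          come from this exchange; the zeros only provide slots to be updated.\<close>
        have "w (prepend ?b (prepend \<eta> ?c)) = w ((prepend 0 (prepend 0 ?c))(1 := ?b, 2 := \<eta>))"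
          by (rule depends_uptoD[OF alt_formsD(1)[OF w]]) (auto simp: prepend_def)
        also have "\<dots> = - w ((prepend 0 (prepend 0 ?c))(1 := \<eta>, 2 := ?b))"
          by (rule alt_forms_swap[OF w]) (use i j in auto)
        also have "w ((prepend 0 (prepend 0 ?c))(1 := \<eta>, 2 := ?b)) = w (prepend \<eta> (prepend ?b ?c))"
          by (rule depends_uptoD[OF alt_formsD(1)[OF w]]) (auto simp: prepend_def)
        finally have "w (prepend ?b (prepend \<eta> ?c)) = - w (prepend \<eta> (prepend ?b ?c))" .
        then show "?t (Suc j) (Suc i) = - ((-1) ^ (i + j) *\<^sub>R w (prepend \<eta> (prepend ?b ?c)))"
          using i j by (simp add: prepend_simps omit_prepend)
      qed simp
      \<comment> \<open>Moving the bracket into slot \<open>j\<close> contributes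
        \<open>(-1) ^ (j + 1)\<close>, against the sign \<open>(-1) ^ j\<close> of the term.\<close>
      also have "?t (Suc j) 1 = - w (\<xi>(j := B \<eta> (\<xi> j)))"
      proof -
        have "?t (Suc j) 1 = (-1) ^ j *\<^sub>R w (prepend (B \<eta> (\<xi> j)) (omit j \<xi>))"
          using j by (simp add: prepend_simps omit_prepend prepend_omit_1_prepend)
        also have "\<dots> = (-1) ^ j *\<^sub>R ((-1) ^ (j + 1) *\<^sub>R w (\<xi>(j := B \<eta> (\<xi> j))))"
          by (simp only: alt_forms_move[OF w j])
        also have "\<dots> = - w (\<xi>(j := B \<eta> (\<xi> j)))"
          by (simp flip: power_mult_distrib)
        finally show ?thesis .
      qed
      finally show "(\<Sum>i=1..<Suc j. ?t (Suc j) i) = - w (\<xi>(j := B \<eta> (\<xi> j)))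
        - (\<Sum>i=1..<j. (-1) ^ (i + j) *\<^sub>R w (prepend \<eta> (prepend (B (\<xi> i) (\<xi> j)) (omit i (omit j \<xi>)))))"
        by (simp add: sum_negf)
    qed simp
    finally show ?thesis by (simp only: sum_subtractf sum_negf Suc_eq_plus1) simp
  qed
  show ?thesis unfolding CEa_def Lie_deriv_def A B by (simp add: algebra_simps)
qed

lemma CEa_depends:
  assumes \<alpha>: "\<And>\<zeta>. depends_upto q (\<alpha> \<zeta>)" and w: "depends_upto q w"
  shows "depends_upto (Suc q) (CEa B q \<alpha> w)"
proof (rule depends_uptoI)
  fix g h :: "nat \<Rightarrow> 'a" assume gh: "\<And>i. 1 \<le> i \<Longrightarrow> i \<le> Suc q \<Longrightarrow> g i = h i"
  have 1: "\<alpha> (g i) (omit i g) = \<alpha> (h i) (omit i h)" if "i \<in> {1..q+1}" for i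
  proof -
    have "g i = h i" using that gh by simp
    moreover have "\<alpha> (h i) (omit i g) = \<alpha> (h i) (omit i h)"
      by (rule depends_uptoD[OF \<alpha>]) (auto simp: omit_def gh)
    ultimately show ?thesis by simp
  qed
  have 2: "w (prepend (B (g i) (g j)) (omit i (omit j g))) = w (prepend (B (h i) (h j)) (omit i (omit j h)))"
    if "j \<in> {1..q+1}" "i \<in> {1..<j}" for i j
  proof -
    have "g i = h i" "g j = h j" using that gh by auto
    then show ?thesis by (intro depends_uptoD[OF w]) (auto simp: prepend_def omit_def gh)
  qed
  show "CEa B q \<alpha> w g = CEa B q \<alpha> w h"
    unfolding CEa_def by (intro arg_cong2[where f = "(+)"] sum.cong refl) (simp_all only: 1 2)
qed

text \<open>If the arguments in slots \<open>k\<close> and \<open>l\<close> agree, the summands with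
  the bracket in another slot vanish, and the two with the bracket in slot \<open>k\<close> or
  \<open>l\<close> cancel by antisymmetry.\<close>

lemma Lie_deriv_alt:
  assumes w: "w \<in> alt_forms q" and \<alpha>: "\<alpha> \<eta> \<in> alt_forms q" and B: "linear (B \<eta>)"
  shows "Lie_deriv B q \<eta> \<alpha> w \<in> alt_forms q"
proof -
  let ?s = "\<lambda>\<xi>. \<Sum>i=1..q. w (\<xi>(i := B \<eta> (\<xi> i)))"
  have "?s \<in> alt_forms q" unfolding alt_forms_def
  proof (intro CollectI conjI ballI allI impI)
    show "depends_upto q ?s"
    proof (rule depends_uptoI)
      fix g h :: "nat \<Rightarrow> 'a" assume gh: "\<And>i. 1 \<le> i \<Longrightarrow> i \<le> q \<Longrightarrow> g i = h i"
      show "?s g = ?s h"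
      proof (rule sum.cong[OF refl])
        fix i assume i: "i \<in> {1..q}"
        show "w (g(i := B \<eta> (g i))) = w (h(i := B \<eta> (h i)))"
          by (rule depends_uptoD[OF alt_formsD(1)[OF w]]) (use i gh in auto)
      qed
    qed
  next
    fix k and \<xi> :: "nat \<Rightarrow> 'a" assume k: "k \<in> {1..q}"
    show "linear (\<lambda>v. \<Sum>i=1..q. w ((\<xi>(k := v))(i := B \<eta> ((\<xi>(k := v)) i))))"
    proof (rule linear_compose_sum, intro ballI)
      fix i assume i: "i \<in> {1..q}"
      show "linear (\<lambda>v. w ((\<xi>(k := v))(i := B \<eta> ((\<xi>(k := v)) i))))"
      proof (cases "i = k")
        case True
        have "linear (\<lambda>v. w (\<xi>(k := v)))" by (rule alt_formsD(2)[OF w]) (use k in auto)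
        from linear_compose[OF B this] have "linear (\<lambda>v. w (\<xi>(k := B \<eta> v)))" unfolding o_def .
        then show ?thesis using True by simp
      next
        case False
        have "linear (\<lambda>v. w ((\<xi>(i := B \<eta> (\<xi> i)))(k := v)))" by (rule alt_formsD(2)[OF w]) (use k in auto)
        then show ?thesis using False by (simp add: fun_upd_twist)
      qed
    qed
  next
    fix k l and \<xi> :: "nat \<Rightarrow> 'a" assume k: "k \<in> {1..q}" and l: "l \<in> {1..q}" and kl: "k \<noteq> l \<and> \<xi> k = \<xi> l"
    have other: "w (\<xi>(i := B \<eta> (\<xi> i))) = 0" if "i \<in> {1..q} - {k} - {l}" for i
      by (rule alt_formsD(3)[OF w, of k l]) (use that k l kl in auto)
    have "?s \<xi> = w (\<xi>(k := B \<eta> (\<xi> k))) + (w (\<xi>(l := B \<eta> (\<xi> l))) + (\<Sum>i\<in>{1..q} - {k} - {l}. w (\<xi>(i := B \<eta> (\<xi> i)))))"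
      using k l kl by (simp add: sum.remove[where x = k] sum.remove[where x = l])
    also have "(\<Sum>i\<in>{1..q} - {k} - {l}. w (\<xi>(i := B \<eta> (\<xi> i)))) = 0" by (rule sum.neutral) (use other in blast)
    also have "w (\<xi>(k := B \<eta> (\<xi> k))) = w (\<xi>(k := B \<eta> (\<xi> k), l := \<xi> k))" using kl by (metis fun_upd_idem_iff fun_upd_other)
    also have "\<dots> = - w (\<xi>(k := \<xi> k, l := B \<eta> (\<xi> k)))"
      by (rule alt_forms_swap[OF w]) (use k l kl in auto)
    also have "\<xi>(k := \<xi> k, l := B \<eta> (\<xi> k)) = \<xi>(l := B \<eta> (\<xi> l))" using kl by (auto simp: fun_eq_iff)
    finally show "?s \<xi> = 0" by (simp only: add_0_right left_minus)
  qed
  from alt_forms_diff[OF \<alpha> this] show ?thesis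
    unfolding Lie_deriv_def[abs_def] .
qed

text \<open>Induction on the degree by Cartan's formula. Contracting the differential twice with
  \<open>\<eta>\<close> leaves the contraction of the Lie derivative minus the Lie derivative of the
  contraction, since a form contracted twice with \<open>\<eta>\<close> is zero. The difference
  vanishes because \<open>B \<eta> \<eta> = 0\<close>.\<close>

lemma CEa_alt_forms:
  fixes B :: "'e::real_vector \<Rightarrow> 'e \<Rightarrow> 'e" and w :: "('e, 'v::real_vector) form"
  assumes Br: "\<And>\<eta>. linear (B \<eta>)" and Bl: "\<And>\<eta>. linear (\<lambda>\<zeta>. B \<zeta> \<eta>)" and Bz: "\<And>\<eta>. B \<eta> \<eta> = 0"
  shows "w \<in> alt_forms q \<Longrightarrow> (\<And>\<zeta>. \<alpha> \<zeta> \<in> alt_forms q) \<Longrightarrow> (\<And>\<theta>. linear (\<lambda>\<zeta>. \<alpha> \<zeta> \<theta>)) \<Longrightarrow>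
    CEa B q \<alpha> w \<in> alt_forms (Suc q)"
proof (induction q arbitrary: \<alpha> w)
  case 0
  have dep: "depends_upto 0 (\<alpha> \<zeta>)" for \<zeta> by (rule alt_formsD(1)[OF 0(2)])
  have p: "CEa B 0 \<alpha> w (prepend \<eta> \<xi>) = \<alpha> \<eta> \<xi>" for \<eta> \<xi> by (rule CEa_0_prepend[OF dep])
  show ?case
  proof (rule alt_formsI)
    show "depends_upto (Suc 0) (CEa B 0 \<alpha> w)" by (rule CEa_depends[OF dep alt_formsD(1)[OF 0(1)]])
    show "(\<lambda>\<xi>. CEa B 0 \<alpha> w (prepend \<eta> \<xi>)) \<in> alt_forms 0" for \<eta> unfolding p by (rule 0(2))
    show "linear (\<lambda>\<eta>. CEa B 0 \<alpha> w (prepend \<eta> \<xi>))" for \<xi> unfolding p by (rule 0(3))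
  qed simp
next
  case (Suc q)
  have dep: "depends_upto (Suc q) (\<alpha> \<zeta>)" for \<zeta> by (rule alt_formsD(1)[OF Suc.prems(2)])
  note p = CEa_prepend[where \<alpha> = \<alpha> and B = B, OF Suc.prems(1) dep]
  let ?a = "\<lambda>\<eta> \<zeta> \<theta>. \<alpha> \<zeta> (prepend \<eta> \<theta>)" and ?w = "\<lambda>\<eta> \<theta>. w (prepend \<eta> \<theta>)"
  show ?case
  proof (rule alt_formsI)
    show "depends_upto (Suc (Suc q)) (CEa B (Suc q) \<alpha> w)"
      by (rule CEa_depends[OF dep alt_formsD(1)[OF Suc.prems(1)]])
    show "(\<lambda>\<xi>. CEa B (Suc q) \<alpha> w (prepend \<eta> \<xi>)) \<in> alt_forms (Suc q)" for \<eta>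
      unfolding p
    proof (rule alt_forms_diff)
      show "Lie_deriv B (Suc q) \<eta> \<alpha> w \<in> alt_forms (Suc q)"
        by (rule Lie_deriv_alt[where \<alpha> = \<alpha>, OF Suc.prems(1) Suc.prems(2) Br])
      show "CEa B q (?a \<eta>) (?w \<eta>) \<in> alt_forms (Suc q)"
        by (rule Suc.IH[OF alt_forms_contract[OF Suc.prems(1)] alt_forms_contract[OF Suc.prems(2)] Suc.prems(3)])
    qed
    show "linear (\<lambda>\<eta>. CEa B (Suc q) \<alpha> w (prepend \<eta> \<xi>))" for \<xi>
      unfolding p
    proof (rule linear_compose_sub)
      have "linear (\<lambda>\<eta>. w (\<xi>(i := B \<eta> (\<xi> i))))" if "i \<in> {1..Suc q}" for i
      proof -
        have "linear (\<lambda>v. w (\<xi>(i := v)))" by (rule alt_formsD(2)[OF Suc.prems(1)]) (use that in auto)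
        from linear_compose[OF Bl[of "\<xi> i"] this] show ?thesis unfolding o_def .
      qed
      then show "linear (\<lambda>\<eta>. Lie_deriv B (Suc q) \<eta> \<alpha> w \<xi>)"
        unfolding Lie_deriv_def by (intro linear_compose_sub linear_compose_sum Suc.prems(3)) blast
      show "linear (\<lambda>\<eta>. CEa B q (?a \<eta>) (?w \<eta>) \<xi>)"
        unfolding CEa_def
        by (intro linear_compose_add linear_compose_sum ballI linear_compose_scale_right
            alt_forms_prepend_linear[OF Suc.prems(2)] alt_forms_prepend_linear[OF Suc.prems(1)])
    qed
    show "CEa B (Suc q) \<alpha> w (prepend \<eta> (prepend \<eta> \<xi>)) = 0" for \<eta> \<xi>
    proof -
      have ww: "w (prepend \<eta> (prepend \<eta> \<theta>)) = 0" if "q > 0" for \<theta>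
        by (rule alt_formsD(3)[OF Suc.prems(1), of 1 2]) (use that in \<open>auto simp: prepend_def\<close>)
      have aa: "\<alpha> \<zeta> (prepend \<eta> (prepend \<eta> \<theta>)) = 0" if "q > 0" for \<zeta> \<theta>
        by (rule alt_formsD(3)[OF Suc.prems(2), of 1 2]) (use that in \<open>auto simp: prepend_def\<close>)
      have cq: "CEa B q (?a \<eta>) (?w \<eta>) (prepend \<eta> \<xi>) = Lie_deriv B q \<eta> (?a \<eta>) (?w \<eta>) \<xi>"
      proof (cases q)
        case 0
        have "depends_upto 0 (?a \<eta> \<eta>)" using alt_formsD(1)[OF alt_forms_contract[OF Suc.prems(2)]] 0 by simp
        from CEa_0_prepend[of "?a \<eta>", OF this] show ?thesis by (simp add: 0 Lie_deriv_def)
      next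
        case q: (Suc r)
        have "CEa B q (?a \<eta>) (?w \<eta>) (prepend \<eta> \<xi>) = Lie_deriv B q \<eta> (?a \<eta>) (?w \<eta>) \<xi>
          - CEa B r (\<lambda>\<zeta> \<theta>. \<alpha> \<zeta> (prepend \<eta> (prepend \<eta> \<theta>))) (\<lambda>\<theta>. w (prepend \<eta> (prepend \<eta> \<theta>))) \<xi>"
          using CEa_prepend[where \<alpha> = "?a \<eta>" and w = "?w \<eta>" and B = B and q = r and \<eta> = \<eta> and \<xi> = \<xi>]
            alt_forms_contract[OF Suc.prems(1)] alt_formsD(1)[OF alt_forms_contract[OF Suc.prems(2)]]
          by (simp add: q)
        then show ?thesis using ww aa by (simp add: q CEa_def)
      qed
      have "Lie_deriv B (Suc q) \<eta> \<alpha> w (prepend \<eta> \<xi>) = Lie_deriv B q \<eta> (?a \<eta>) (?w \<eta>) \<xi>"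
      proof -
        let ?X = "prepend \<eta> \<xi>"
        have "(\<Sum>i=1..Suc q. w (?X(i := B \<eta> (?X i)))) = w (?X(1 := B \<eta> (?X 1))) + (\<Sum>i=Suc 1..Suc q. w (?X(i := B \<eta> (?X i))))"
          by (subst sum.atLeast_Suc_atMost) auto
        also have "w (?X(1 := B \<eta> (?X 1))) = 0"
        proof -
          have "w (?X(1 := 0)) = 0" by (rule linear_0[OF alt_formsD(2)[OF Suc.prems(1)]]) simp_all
          moreover have "B \<eta> (?X 1) = 0" by (simp add: prepend_simps Bz)
          ultimately show ?thesis by (simp only:)
        qed
        also have "(\<Sum>i=Suc 1..Suc q. w (?X(i := B \<eta> (?X i)))) = (\<Sum>i=1..q. w (?X(Suc i := B \<eta> (?X (Suc i)))))"
          by (rule sum.shift_bounds_cl_Suc_ivl)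
        also have "\<dots> = (\<Sum>i=1..q. w (prepend \<eta> (\<xi>(i := B \<eta> (\<xi> i)))))"
          by (rule sum.cong) (simp_all add: prepend_upd prepend_simps)
        finally show ?thesis unfolding Lie_deriv_def by (simp only: add_0_left)
      qed
      then show ?thesis unfolding p cq by simp
    qed
  qed
qed

section \<open>The differentials of the commuting actions\<close>

text \<open>A product rule that releases one slot at a time. Expanding the argument of the new slot
  in a basis leaves products of a scalar curve with the form that has a basis vector frozen in this
  slot; the induction hypothesis applies to the latter, hence the generality in
  \<open>\<zeta>\<close>.\<close>

lemma (in lie) multilinear_curve_derivative:
  fixes w :: "('e, 'v::real_normed_vector) form"
  assumes w: "w \<in> alt_forms q"
    and c: "\<And>k. ((\<lambda>t. c t k) has_vector_derivative c' k) (at 0)"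
  shows "((\<lambda>t. w (c t)) has_vector_derivative (\<Sum>i=1..q. w ((c 0)(i := c' i)))) (at 0)"
proof -
  define M where "M m t \<zeta> = (\<lambda>k. if 1 \<le> k \<and> k \<le> m then c t k else \<zeta> k)" for m t and \<zeta> :: "nat \<Rightarrow> 'e"
  have main: "m \<le> q \<Longrightarrow> ((\<lambda>t. w (M m t \<zeta>)) has_vector_derivative
     (\<Sum>i=1..m. w ((M m 0 \<zeta>)(i := c' i)))) (at 0)" for m \<zeta>
  proof (induction m arbitrary: \<zeta>)
    case 0
    have "M 0 t \<zeta> = \<zeta>" for t by (auto simp: M_def)
    then show ?case by simp
  next
    case (Suc m)
    have lin: "linear (\<lambda>v. w (\<xi>(Suc m := v)))" for \<xi> by (rule alt_formsD(2)[OF w]) (use Suc.prems in auto)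
    have M1: "M (Suc m) t \<zeta> = (M m s \<zeta>')(Suc m := c t (Suc m))" if "s = t" "\<zeta>' = \<zeta>" for t s \<zeta>'
      using that by (auto simp: M_def fun_eq_iff)
    have M2: "(M m t \<zeta>)(Suc m := b) = M m t (\<zeta>(Suc m := b))" for t b
      by (auto simp: M_def fun_eq_iff)
    have e: "w (M (Suc m) t \<zeta>) = (\<Sum>b\<in>fbasis. fcoord b (c t (Suc m)) *\<^sub>R w (M m t (\<zeta>(Suc m := b))))" for t
      using linear_expand[OF fd_e lin[of "M m t \<zeta>"], of "c t (Suc m)"] unfolding M1[OF refl refl] M2 .
    have db: "((\<lambda>t. fcoord b (c t (Suc m)) *\<^sub>R w (M m t (\<zeta>(Suc m := b)))) has_vector_derivative
        fcoord b (c 0 (Suc m)) *\<^sub>R (\<Sum>i=1..m. w ((M m 0 (\<zeta>(Suc m := b)))(i := c' i)))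
        + fcoord b (c' (Suc m)) *\<^sub>R w (M m 0 (\<zeta>(Suc m := b)))) (at 0)" for b
      by (rule has_vector_derivative_scaleR[OF
            bounded_linear.has_vector_derivative[OF bounded_linear_fcoord[OF fd_e] c, folded has_real_derivative_iff_has_vector_derivative]
            Suc.IH]) (use Suc.prems in simp)
    have "((\<lambda>t. w (M (Suc m) t \<zeta>)) has_vector_derivative
        (\<Sum>b\<in>fbasis. fcoord b (c 0 (Suc m)) *\<^sub>R (\<Sum>i=1..m. w ((M m 0 (\<zeta>(Suc m := b)))(i := c' i)))
        + fcoord b (c' (Suc m)) *\<^sub>R w (M m 0 (\<zeta>(Suc m := b))))) (at 0)"
      unfolding e by (rule has_vector_derivative_sum) (rule db)
    also have "(\<Sum>b\<in>fbasis. fcoord b (c 0 (Suc m)) *\<^sub>R (\<Sum>i=1..m. w ((M m 0 (\<zeta>(Suc m := b)))(i := c' i)))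
        + fcoord b (c' (Suc m)) *\<^sub>R w (M m 0 (\<zeta>(Suc m := b))))
      = (\<Sum>i=1..m. \<Sum>b\<in>fbasis. fcoord b (c 0 (Suc m)) *\<^sub>R w ((M m 0 (\<zeta>(Suc m := b)))(i := c' i)))
        + (\<Sum>b\<in>fbasis. fcoord b (c' (Suc m)) *\<^sub>R w (M m 0 (\<zeta>(Suc m := b))))"
      by (simp only: sum.distrib scaleR_sum_right) (subst sum.swap, rule refl)
    also have "(\<Sum>b\<in>fbasis. fcoord b (c' (Suc m)) *\<^sub>R w (M m 0 (\<zeta>(Suc m := b)))) = w ((M (Suc m) 0 \<zeta>)(Suc m := c' (Suc m)))"
      unfolding M1[OF refl refl] fun_upd_upd unfolding M2[symmetric] by (rule linear_expand[OF fd_e lin, symmetric])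
    also have "(\<Sum>i=1..m. \<Sum>b\<in>fbasis. fcoord b (c 0 (Suc m)) *\<^sub>R w ((M m 0 (\<zeta>(Suc m := b)))(i := c' i)))
       = (\<Sum>i=1..m. w ((M (Suc m) 0 \<zeta>)(i := c' i)))"
    proof (rule sum.cong[OF refl])
      fix i assume i: "i \<in> {1..m}"
      have 1: "(M m 0 (\<zeta>(Suc m := b)))(i := c' i) = ((M m 0 \<zeta>)(i := c' i))(Suc m := b)" for b
        using i by (auto simp: M_def fun_eq_iff)
      have 2: "(M (Suc m) 0 \<zeta>)(i := c' i) = ((M m 0 \<zeta>)(i := c' i))(Suc m := c 0 (Suc m))"
        using i by (auto simp: M_def fun_eq_iff)
      show "(\<Sum>b\<in>fbasis. fcoord b (c 0 (Suc m)) *\<^sub>R w ((M m 0 (\<zeta>(Suc m := b)))(i := c' i))) = w ((M (Suc m) 0 \<zeta>)(i := c' i))"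
        unfolding 1 2 by (rule linear_expand[OF fd_e lin, symmetric])
    qed
    also have "(\<Sum>i=1..m. w ((M (Suc m) 0 \<zeta>)(i := c' i))) + w ((M (Suc m) 0 \<zeta>)(Suc m := c' (Suc m)))
      = (\<Sum>i=1..Suc m. w ((M (Suc m) 0 \<zeta>)(i := c' i)))" by (simp only: sum.cl_ivl_Suc) simp
    finally show ?case .
  qed
  have a: "w (M q t (c 0)) = w (c t)" for t
    by (rule depends_uptoD[OF alt_formsD(1)[OF w]]) (simp add: M_def)
  have b: "M q 0 (c 0) = c 0" by (auto simp: M_def)
  from main[of q "c 0"] show ?thesis unfolding a b by simp
qed

section \<open>The conjugation actions and their derivatives\<close>

locale lie_rep = lie G for G :: "('g::{t2_space,second_countable_topology}, 'e::real_normed_vector) charted_group" (structure) +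
  fixes \<rho> :: "'g \<Rightarrow> 'v::{banach, second_countable_topology} \<Rightarrow> 'v"
  assumes rep: "smooth_rep G \<rho>"
begin

lemma fd_v: "finite_dim (UNIV :: 'v set)" and linear_rho: "linear (\<rho> a)" and rho_one [simp]: "\<rho> \<one> v = v"
  and rho_mult: "\<rho> (a \<otimes> b) v = \<rho> a (\<rho> b v)"
  and rho_smooth: "smooth_fun G 1 (\<lambda>g. \<rho> (g 1) v)"
  using rep unfolding smooth_rep_def by simp_all

lemma bounded_linear_rho: "bounded_linear (\<rho> a)"
  by (rule linear_imp_bounded_linear[OF fd_v linear_rho])

lemma rho_inv [simp]: "\<rho> (inv a) (\<rho> a v) = v" "\<rho> a (\<rho> (inv a) v) = v"
  by (simp_all flip: rho_mult)

lemma rho_0 [simp]: "\<rho> a 0 = 0"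
  by (rule linear_0[OF linear_rho])

text \<open>Smoothness of the representation is given for fixed vectors only; a varying vector is
  expanded in a basis.\<close>

lemma rho_cochains:
  assumes A: "smap n A" and f: "f \<in> cochains G n"
  shows "(\<lambda>g. \<rho> (A g) (f g)) \<in> cochains G n"
proof -
  have "(\<lambda>g. \<rho> (g 1) b) \<in> cochains G 1" for b
    unfolding cochains_def using rho_smooth by (auto simp: depends_upto_def)
  then have "(\<lambda>g. \<rho> ((\<lambda>_. A g) (1::nat)) b) \<in> cochains G n" for b
    by (rule cochains_composeI) (rule A)
  moreover have "(\<lambda>g. fcoord b (f g)) \<in> cochains G n" for b
    by (rule cochains_linear[OF f bounded_linear_fcoord[OF fd_v]])
  ultimately have "(\<lambda>g. \<Sum>b\<in>fbasis. fcoord b (f g) *\<^sub>R \<rho> (A g) b) \<in> cochains G n"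
    by (intro cochains_sum cochains_scaleR) simp_all
  moreover have "(\<Sum>b\<in>fbasis. fcoord b (f g) *\<^sub>R \<rho> (A g) b) = \<rho> (A g) (f g)" for g
    by (rule linear_expand[OF fd_v linear_rho, symmetric])
  ultimately show ?thesis by simp
qed

text \<open>For \<open>i = 0\<close> the entry that gets multiplied is never read, and what remains
  is the simultaneous conjugation of all entries. This label yields the invariance of the final form
  under \<open>K\<close>.\<close>

definition conj_point :: "nat \<Rightarrow> nat \<Rightarrow> 'g \<Rightarrow> (nat \<Rightarrow> 'g) \<Rightarrow> nat \<Rightarrow> 'g" where
  "conj_point p i a g = (\<lambda>l. if l = i then g l \<otimes> a else if i < l \<and> l \<le> p then inv a \<otimes> g l \<otimes> a else g l)"

lemma conj_act_conj_point: "conj_act G \<rho> p i a f g = \<rho> a (f (conj_point p i a g))"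
proof -
  have "(\<lambda>l. if l = i then g i \<otimes> a else if i < l \<and> l \<le> p then inv a \<otimes> g l \<otimes> a else g l) = conj_point p i a g"
    by (auto simp: conj_point_def fun_eq_iff)
  then show ?thesis by (simp only: conj_act_def)
qed

abbreviation "actD p i \<equiv> conj_act_deriv G \<rho> p i"

lemma actD_ediff: "actD p i \<xi> f g = ediff (\<lambda>a. conj_act G \<rho> p i a f g) \<xi>"
  by (simp add: conj_act_deriv_def ediff_def)

lemma smap_conj_point:
  assumes "smap m A" "smap m (\<lambda>g. \<Phi> g l)"
  shows "smap m (\<lambda>g. conj_point p i (A g) (\<Phi> g) l)"
  unfolding conj_point_def by (intro smap_if smap_mult smap_inv assms)

lemma conj_act_cochains_general:
  assumes f: "f \<in> cochains G n" and A: "smap m A" and \<Phi>: "\<And>l. 1 \<le> l \<Longrightarrow> l \<le> n \<Longrightarrow> smap m (\<lambda>g. \<Phi> g l)"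
  shows "(\<lambda>g. conj_act G \<rho> p i (A g) f (\<Phi> g)) \<in> cochains G m"
  unfolding conj_act_conj_point by (intro rho_cochains A cochains_composeI[OF f] smap_conj_point \<Phi>)

lemma conj_act_cochains: "f \<in> cochains G n \<Longrightarrow> conj_act G \<rho> p i a f \<in> cochains G n"
  using conj_act_cochains_general[where \<Phi> = "\<lambda>g. g" and A = "\<lambda>_. a"] smap_const smap_proj by blast

text \<open>The acting group element becomes the last variable, so that differentiating or
  integrating over it is an operation in slot \<open>n + 1\<close>.\<close>

lemma conj_act_cochains_param:
  "f \<in> cochains G n \<Longrightarrow> (\<lambda>g. conj_act G \<rho> p i (g (Suc n)) f g) \<in> cochains G (Suc n)"
  by (rule conj_act_cochains_general[where \<Phi> = "\<lambda>g. g"], assumption) (rule smap_proj; simp)+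

lemma conj_act_upd:
  assumes f: "f \<in> cochains G n" and "p \<le> n" "i \<le> p"
  shows "conj_act G \<rho> p i a f (g(Suc n := b)) = conj_act G \<rho> p i a f g"
proof -
  have "f (conj_point p i a (g(Suc n := b))) = f (conj_point p i a g)"
    by (rule depends_uptoD[OF cochains_depends[OF f]]) (use assms in \<open>auto simp: conj_point_def\<close>)
  then show ?thesis by (simp add: conj_act_conj_point)
qed

lemma conj_act_smooth: "f \<in> cochains G n \<Longrightarrow> smooth_at_e (\<lambda>a. conj_act G \<rho> p i a f g)"
  by (rule cochains_smooth_at_e, rule conj_act_cochains_general[where \<Phi> = "\<lambda>_. g" and A = "\<lambda>h. h 1"])
     (simp_all add: smap_proj smap_const)

lemma actD_cochains:
  assumes f: "f \<in> cochains G n" and "p \<le> n" "i \<le> p"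
  shows "actD p i \<xi> f \<in> cochains G n"
proof -
  have "(\<lambda>g. ediff (\<lambda>a. conj_act G \<rho> p i ((g(Suc n := a)) (Suc n)) f (g(Suc n := a))) \<xi>) \<in> cochains G n"
    by (rule ediff_cochains[OF conj_act_cochains_param[OF f]])
  then have "(\<lambda>g. ediff (\<lambda>a. conj_act G \<rho> p i a f g) \<xi>) \<in> cochains G n"
    by (simp only: conj_act_upd[OF assms] fun_upd_same)
  moreover have "(\<lambda>g. ediff (\<lambda>a. conj_act G \<rho> p i a f g) \<xi>) = actD p i \<xi> f"
    by (simp add: actD_ediff fun_eq_iff)
  ultimately show ?thesis by simp
qed

lemma linear_actD: "f \<in> cochains G n \<Longrightarrow> linear (\<lambda>\<xi>. actD p i \<xi> f g)"
  unfolding actD_ediff by (rule linear_ediff[OF conj_act_smooth])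

lemma actD_zero [simp]: "actD p i \<xi> (\<lambda>_. 0) g = 0"
  by (simp add: actD_ediff conj_act_conj_point)

lemma actD_add:
  assumes f: "f \<in> cochains G n" and h: "h \<in> cochains G n"
  shows "actD p i \<xi> (\<lambda>y. f y + h y) g = actD p i \<xi> f g + actD p i \<xi> h g"
proof -
  have "conj_act G \<rho> p i a (\<lambda>y. f y + h y) g = conj_act G \<rho> p i a f g + conj_act G \<rho> p i a h g" for a
    by (simp add: conj_act_conj_point linear_add[OF linear_rho])
  with has_vector_derivative_add[OF ediff_has_derivative[OF conj_act_smooth[OF f]] ediff_has_derivative[OF conj_act_smooth[OF h]]]
  show ?thesis unfolding actD_ediff ediff_def[of "\<lambda>a. conj_act G \<rho> p i a (\<lambda>y. f y + h y) g"]
    by (intro vector_derivative_at) (simp only:)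
qed

lemma actD_scaleR:
  assumes f: "f \<in> cochains G n"
  shows "actD p i \<xi> (\<lambda>y. r *\<^sub>R f y) g = r *\<^sub>R actD p i \<xi> f g"
proof -
  have "conj_act G \<rho> p i a (\<lambda>y. r *\<^sub>R f y) g = r *\<^sub>R conj_act G \<rho> p i a f g" for a
    by (simp add: conj_act_conj_point linear_scale[OF linear_rho])
  with bounded_linear.has_vector_derivative[OF bounded_linear_scaleR_right[of r] ediff_has_derivative[OF conj_act_smooth[OF f]]]
  show ?thesis unfolding actD_ediff ediff_def[of "\<lambda>a. conj_act G \<rho> p i a (\<lambda>y. r *\<^sub>R f y) g"]
    by (intro vector_derivative_at) (simp only:)
qed

lemma actD_alt_forms:
  fixes \<omega> :: "(nat \<Rightarrow> 'g) \<Rightarrow> ('e, 'v) form"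
  assumes alt: "\<And>y. \<omega> y \<in> alt_forms q" and sm: "\<And>\<theta>. (\<lambda>y. \<omega> y \<theta>) \<in> cochains G n"
  shows "(\<lambda>\<theta>. actD p i \<zeta> (\<lambda>y. \<omega> y \<theta>) g) \<in> alt_forms q"
  unfolding alt_forms_def
proof (intro CollectI conjI ballI allI impI)
  show "depends_upto q (\<lambda>\<theta>. actD p i \<zeta> (\<lambda>y. \<omega> y \<theta>) g)"
  proof (rule depends_uptoI)
    fix \<theta> \<theta>' :: "nat \<Rightarrow> 'e" assume e: "\<And>i. 1 \<le> i \<Longrightarrow> i \<le> q \<Longrightarrow> \<theta> i = \<theta>' i"
    have "\<omega> y \<theta> = \<omega> y \<theta>'" for y by (rule depends_uptoD[OF alt_formsD(1)[OF alt] e])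
    then show "actD p i \<zeta> (\<lambda>y. \<omega> y \<theta>) g = actD p i \<zeta> (\<lambda>y. \<omega> y \<theta>') g" by simp
  qed
  fix k and \<theta> :: "nat \<Rightarrow> 'e" assume k: "k \<in> {1..q}"
  have lin: "linear (\<lambda>v. \<omega> y (\<theta>(k := v)))" for y by (rule alt_formsD(2)[OF alt]) (use k in auto)
  show "linear (\<lambda>v. actD p i \<zeta> (\<lambda>y. \<omega> y (\<theta>(k := v))) g)"
    by (rule linearI) (simp_all only: linear_add[OF lin] linear_scale[OF lin] actD_add[OF sm sm] actD_scaleR[OF sm])
  fix l assume l: "l \<in> {1..q}" "k \<noteq> l \<and> \<theta> k = \<theta> l"
  have "\<omega> y \<theta> = 0" for y by (rule alt_formsD(3)[OF alt, of k l]) (use k l in auto)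
  then show "actD p i \<zeta> (\<lambda>y. \<omega> y \<theta>) g = 0" by simp
qed

text \<open>For \<open>i = j\<close> this is the law of a group action. For \<open>i < j\<close> the
  entries from \<open>j\<close> on are conjugated by \<open>a\<close>, which turns the action of
  \<open>b\<close> into that of its conjugate.\<close>

lemma conj_act_conj_act:
  assumes "i \<le> j" "j \<le> p"
  shows "conj_act G \<rho> p i a (conj_act G \<rho> p j b f) g
     = conj_act G \<rho> p j (a \<otimes> b \<otimes> inv a) (conj_act G \<rho> p i a f) g"
proof -
  have "conj_point p j b (conj_point p i a g) = conj_point p i a (conj_point p j (a \<otimes> b \<otimes> inv a) g)"
  proof -
    have c: "a \<otimes> (inv a \<otimes> x) = x" "inv a \<otimes> (a \<otimes> x) = x" for x by (simp_all flip: m_assoc)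
    show ?thesis using assms by (auto simp: conj_point_def fun_eq_iff m_assoc inv_mult_group c)
  qed
  then show ?thesis by (simp add: conj_act_conj_point m_assoc flip: rho_mult)
qed

text \<open>Differentiate the previous rule in \<open>b\<close> at the neutral element; the
  conjugated curve has velocity \<open>Ad G a \<xi>\<close>.\<close>

lemma conj_act_actD:
  assumes f: "f \<in> cochains G n" and ij: "i \<le> j" "j \<le> p"
  shows "conj_act G \<rho> p i a (actD p j \<xi> f) g = actD p j (Ad G a \<xi>) (conj_act G \<rho> p i a f) g"
proof -
  have 1: "((\<lambda>t. conj_act G \<rho> p i a (conj_act G \<rho> p j (exp_chart G (t *\<^sub>R \<xi>)) f) g) has_vector_derivative
      conj_act G \<rho> p i a (actD p j \<xi> f) g) (at 0)"
    unfolding conj_act_conj_point[of p i] actD_ediff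
    by (rule bounded_linear.has_vector_derivative[OF bounded_linear_rho ediff_has_derivative[OF conj_act_smooth[OF f]]])
  have 2: "((\<lambda>t. conj_act G \<rho> p j (a \<otimes> exp_chart G (t *\<^sub>R \<xi>) \<otimes> inv a) (conj_act G \<rho> p i a f) g) has_vector_derivative
      actD p j (Ad G a \<xi>) (conj_act G \<rho> p i a f) g) (at 0)"
    unfolding actD_ediff
    by (rule curve_derivative[OF conj_act_smooth[OF conj_act_cochains[OF f]] velocity_conj[OF velocity_exp]])
  from vector_derivative_unique_at[OF 1[unfolded conj_act_conj_act[OF ij]] 2] show ?thesis .
qed

lemma cochains_continuous_slice:
  assumes "f \<in> cochains G n" shows "continuous_on S (\<lambda>k. f (g(i := k)))"
proof (rule continuous_on_subset[of UNIV], rule continuous_on_local)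
  fix k0 :: 'g
  obtain d where d: "d \<in> atlas G" "k0 \<in> fst d" using chart_at by blast
  have c: "charts 1 (\<lambda>_. d)" using d(1) by (simp add: charts_def)
  have "continuous_on (dom 1 (\<lambda>_. d)) (\<lambda>x. f (g(i := pt 1 (\<lambda>_. d) x 1)))"
    using cochainsD[OF cochains_slice[OF assms, of g i] c, of 0] by simp
  moreover have "continuous_on (fst d) (\<lambda>k. (\<lambda>_::nat. snd d k))"
    by (intro continuous_on_coordinatewise_then_product) (rule chart_homeo(1)[OF d(1)])
  moreover have "(\<lambda>k. (\<lambda>_::nat. snd d k)) ` fst d \<subseteq> dom 1 (\<lambda>_. d)" by (auto simp: dom_def)
  ultimately have "continuous_on (fst d) (\<lambda>k. f (g(i := pt 1 (\<lambda>_. d) (\<lambda>_. snd d k) 1)))"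
    by (rule continuous_on_compose2)
  moreover have "pt 1 (\<lambda>_. d) (\<lambda>_. snd d k) 1 = k" if "k \<in> fst d" for k
    using chart_homeo(3)[OF d(1) that] by (simp add: pt_def)
  ultimately have "continuous_on (fst d) (\<lambda>k. f (g(i := k)))"
    using continuous_on_cong[of "fst d" "fst d" "\<lambda>k. f (g(i := pt 1 (\<lambda>_. d) (\<lambda>_. snd d k) 1))" "\<lambda>k. f (g(i := k))"] by simp
  then show "\<exists>U. open U \<and> k0 \<in> U \<and> continuous_on U (\<lambda>k. f (g(i := k)))"
    using d chart_open(1)[OF d(1)] by (intro exI conjI)
qed simp

lemma conj_point_upd: "j \<le> p \<Longrightarrow> p \<le> n \<Longrightarrow> conj_point p j a (g(Suc n := k)) = (conj_point p j a g)(Suc n := k)"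
  by (auto simp: conj_point_def fun_eq_iff)

lemma actD_slice:
  assumes "j \<le> p" "p \<le> n"
  shows "actD p j \<xi> (\<lambda>h. F (h(Suc n := k))) g = actD p j \<xi> F (g(Suc n := k))"
  unfolding actD_ediff conj_act_conj_point conj_point_upd[OF assms] ..

lemma actD_integral:
  assumes K: "compact_prob K \<mu>" and F: "F \<in> cochains G (Suc n)" and jp: "j \<le> p" "p \<le> n"
  shows "actD p j \<xi> (\<lambda>g. \<integral>k. F (g(Suc n := k)) \<partial>\<mu>) g = (\<integral>k. actD p j \<xi> F (g(Suc n := k)) \<partial>\<mu>)"
proof -
  interpret compact_prob K \<mu> by (rule K)
  have "conj_act G \<rho> p j a (\<lambda>g. \<integral>k. F (g(Suc n := k)) \<partial>\<mu>) g = (\<integral>k. conj_act G \<rho> p j a F (g(Suc n := k)) \<partial>\<mu>)" for a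
    unfolding conj_act_conj_point conj_point_upd[OF jp]
    by (rule integral_bounded_linear[OF bounded_linear_rho integrable[OF cochains_continuous_slice[OF F]], symmetric])
  moreover have "(\<lambda>h. conj_act G \<rho> p j (h 1) F (g(Suc n := h 2))) \<in> cochains G 2"
  proof (rule conj_act_cochains_general[OF F])
    show "smap 2 (\<lambda>h. (g(Suc n := h 2)) l)" for l
      unfolding fun_upd_apply by (intro smap_if smap_const smap_proj) simp_all
  qed (simp add: smap_proj)
  ultimately show ?thesis unfolding actD_ediff
    using ediff_integral[OF K, of "\<lambda>a k. conj_act G \<rho> p j a F (g(Suc n := k))" \<xi>] by simp
qed

section \<open>The iterated differentials \<open>D_j\<close> and their equivariance\<close>

definition d_from :: "nat \<Rightarrow> nat \<Rightarrow> ((nat \<Rightarrow> 'g) \<Rightarrow> 'v) \<Rightarrow> (nat \<Rightarrow> 'g) \<Rightarrow> ('e, 'v) form" where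
  "d_from p j f = foldr (\<lambda>i. d_i G \<rho> p i (p - i)) [j..<p + 1] (\<lambda>g \<xi>. f g)"

lemma d_from_Suc: "d_from p (Suc p) f g \<xi> = f g"
  by (simp add: d_from_def)

lemma d_from_step:
  "j \<le> p \<Longrightarrow> d_from p j f g \<xi> = CEa (lie_bracket G) (p - j) (\<lambda>\<zeta> \<theta>. actD p j \<zeta> (\<lambda>y. d_from p (Suc j) f y \<theta>) g) (d_from p (Suc j) f g) \<xi>"
  unfolding d_from_def by (subst upt_conv_Cons) (simp_all add: d_i_def CE_CEa)

text \<open>The two properties descend from \<open>j = p + 1\<close> together: smoothness of the
  preceding form makes its derivatives linear, and this linearity is what keeps the next
  differential alternating.\<close>

lemma d_from_alt_smooth:
  assumes f: "f \<in> cochains G n" and pn: "p \<le> n"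
  shows "j \<le> Suc p \<Longrightarrow> (\<forall>g. d_from p j f g \<in> alt_forms (Suc p - j)) \<and> (\<forall>\<theta>. (\<lambda>g. d_from p j f g \<theta>) \<in> cochains G n)"
proof (induction j rule: inc_induct)
  case base
  have "d_from p (Suc p) f g \<in> alt_forms 0" for g
    by (simp add: d_from_Suc alt_forms_def depends_upto_def)
  moreover have "(\<lambda>g. d_from p (Suc p) f g \<theta>) = f" for \<theta> by (simp add: d_from_Suc fun_eq_iff)
  ultimately show ?case using f by (simp only: diff_self_eq_0) simp
next
  case (step j)
  then have jp: "j \<le> p" by simp
  have q: "Suc p - Suc j = p - j" "Suc p - j = Suc (p - j)" using jp by auto
  have IH: "\<And>g. d_from p (Suc j) f g \<in> alt_forms (p - j)" "\<And>\<theta>. (\<lambda>g. d_from p (Suc j) f g \<theta>) \<in> cochains G n"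
    using step.IH unfolding q by blast+
  let ?\<alpha> = "\<lambda>g \<zeta> \<theta>. actD p j \<zeta> (\<lambda>y. d_from p (Suc j) f y \<theta>) g"
  have D: "d_from p j f g = CEa (lie_bracket G) (p - j) (?\<alpha> g) (d_from p (Suc j) f g)" for g
    by (rule ext) (rule d_from_step[OF jp])
  have "d_from p j f g \<in> alt_forms (Suc p - j)" for g
    unfolding D q
    by (rule CEa_alt_forms[OF linear_bracket_right linear_bracket_left bracket_self IH(1) actD_alt_forms[OF IH] linear_actD[OF IH(2)]])
  moreover have "(\<lambda>g. d_from p j f g \<theta>) \<in> cochains G n" for \<theta>
    unfolding D CEa_def
    by (intro cochains_add cochains_sum cochains_scaleR_const IH(2) actD_cochains[OF _ pn jp])
  ultimately show ?case by blast
qed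

lemma d_from_alt: "f \<in> cochains G n \<Longrightarrow> p \<le> n \<Longrightarrow> j \<le> Suc p \<Longrightarrow> d_from p j f g \<in> alt_forms (Suc p - j)"
  and d_from_cochains: "f \<in> cochains G n \<Longrightarrow> p \<le> n \<Longrightarrow> j \<le> Suc p \<Longrightarrow> (\<lambda>g. d_from p j f g \<theta>) \<in> cochains G n"
  using d_from_alt_smooth by blast+

text \<open>Downward induction on \<open>j\<close>: an action with label \<open>i \<le> j\<close>
  intertwines the derivatives up to \<open>Ad\<close>, and \<open>Ad\<close> is compatible with the
  bracket terms.\<close>

lemma d_from_natural:
  assumes f: "f \<in> cochains G n" and pn: "p \<le> n" and i: "i \<le> p"
  shows "j \<le> Suc p \<Longrightarrow> i \<le> j \<Longrightarrow> d_from p j (conj_act G \<rho> p i a f) g \<xi>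
     = \<rho> a (d_from p j f (conj_point p i a g) (\<lambda>k. Ad G (inv a) (\<xi> k)))"
proof (induction j arbitrary: g \<xi> rule: inc_induct)
  case base
  show ?case by (simp add: d_from_Suc conj_act_conj_point)
next
  case (step j)
  then have jp: "j \<le> p" by simp
  let ?A = "\<lambda>\<xi> k. Ad G (inv a) (\<xi> k)"
  have IH: "d_from p (Suc j) (conj_act G \<rho> p i a f) g \<xi> = \<rho> a (d_from p (Suc j) f (conj_point p i a g) (?A \<xi>))" for g \<xi>
    using step by simp
  have A1: "actD p j \<zeta> (\<lambda>y. d_from p (Suc j) (conj_act G \<rho> p i a f) y \<theta>) g
     = \<rho> a (actD p j (Ad G (inv a) \<zeta>) (\<lambda>y. d_from p (Suc j) f y (?A \<theta>)) (conj_point p i a g))" for \<zeta> \<theta>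
  proof -
    have "(\<lambda>y. d_from p (Suc j) (conj_act G \<rho> p i a f) y \<theta>) = conj_act G \<rho> p i a (\<lambda>y. d_from p (Suc j) f y (?A \<theta>))"
      by (rule ext) (simp only: IH conj_act_conj_point)
    moreover have "(\<lambda>y. d_from p (Suc j) f y (?A \<theta>)) \<in> cochains G n" by (rule d_from_cochains[OF f pn]) (use jp in simp)
    from conj_act_actD[OF this step.prems jp, of a "Ad G (inv a) \<zeta>" g]
    have "actD p j \<zeta> (conj_act G \<rho> p i a (\<lambda>y. d_from p (Suc j) f y (?A \<theta>))) g
      = \<rho> a (actD p j (Ad G (inv a) \<zeta>) (\<lambda>y. d_from p (Suc j) f y (?A \<theta>)) (conj_point p i a g))"
      by (simp add: conj_act_conj_point)
    ultimately show ?thesis by (simp only:)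
  qed
  have A2: "?A (omit k \<xi>) = omit k (?A \<xi>)" for k \<xi> by (auto simp: omit_def)
  have A3: "?A (prepend b \<xi>) = prepend (Ad G (inv a) b) (?A \<xi>)" for b \<xi> by (auto simp: prepend_def)
  show ?case
    unfolding d_from_step[OF jp] CEa_def unfolding IH unfolding A1[unfolded IH] unfolding A2 A3 Ad_bracket
    by (simp only: linear_add[OF linear_rho] linear_sum[OF linear_rho] linear_scale[OF linear_rho])
qed

text \<open>The parameter sits in an entry beyond \<open>p\<close>, which no conjugation action
  moves.\<close>

lemma d_from_slice:
  assumes pn: "p \<le> n"
  shows "j \<le> Suc p \<Longrightarrow> d_from p j (\<lambda>h. F (h(Suc n := k))) g \<xi> = d_from p j F (g(Suc n := k)) \<xi>"
proof (induction j arbitrary: g \<xi> rule: inc_induct)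
  case base
  show ?case by (simp add: d_from_Suc)
next
  case (step j)
  then have jp: "j \<le> p" by simp
  show ?case unfolding d_from_step[OF jp] step.IH
      actD_slice[OF jp pn, where F = "\<lambda>h. d_from p (Suc j) F h \<theta>" for \<theta>] by (simp only: CEa_def step.IH)
qed

text \<open>Each differential is a finite sum of derivatives and values, and every one of them
  passes under the integral.\<close>

lemma d_from_integral:
  assumes K: "compact_prob K \<mu>" and F: "F \<in> cochains G (Suc n)" and pn: "p \<le> n"
  shows "j \<le> Suc p \<Longrightarrow> d_from p j (\<lambda>g. \<integral>k. F (g(Suc n := k)) \<partial>\<mu>) g \<xi> = (\<integral>k. d_from p j F (g(Suc n := k)) \<xi> \<partial>\<mu>)"
proof (induction j arbitrary: g \<xi> rule: inc_induct)
  case base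
  show ?case by (simp add: d_from_Suc)
next
  case (step j)
  interpret compact_prob K \<mu> by (rule K)
  have jp: "j \<le> p" using step by simp
  have pn': "p \<le> Suc n" using pn by simp
  have sm: "(\<lambda>y. d_from p (Suc j) F y \<theta>) \<in> cochains G (Suc n)" for \<theta> by (rule d_from_cochains[OF F pn']) (use jp in simp)
  have A: "actD p j \<zeta> (\<lambda>y. d_from p (Suc j) (\<lambda>g. \<integral>k. F (g(Suc n := k)) \<partial>\<mu>) y \<theta>) g
    = (\<integral>k. actD p j \<zeta> (\<lambda>y. d_from p (Suc j) F y \<theta>) (g(Suc n := k)) \<partial>\<mu>)" for \<zeta> \<theta>
    unfolding step.IH by (rule actD_integral[OF K sm jp pn])
  have i1: "integrable \<mu> (\<lambda>k. actD p j \<zeta> (\<lambda>y. d_from p (Suc j) F y \<theta>) (g(Suc n := k)))" for \<zeta> \<theta>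
    by (rule integrable[OF cochains_continuous_slice[OF actD_cochains[OF sm pn' jp]]])
  have i2: "integrable \<mu> (\<lambda>k. d_from p (Suc j) F (g(Suc n := k)) \<theta>)" for \<theta>
    by (rule integrable[OF cochains_continuous_slice[OF sm]])
  show ?case unfolding d_from_step[OF jp] CEa_def A unfolding step.IH
    by (subst Bochner_Integration.integral_add, (intro Bochner_Integration.integrable_sum integrable_scaleR_right i1 i2)+,
        subst Bochner_Integration.integral_sum, intro integrable_scaleR_right i1,
        subst Bochner_Integration.integral_sum, intro Bochner_Integration.integrable_sum integrable_scaleR_right i2,
        subst Bochner_Integration.integral_sum, intro integrable_scaleR_right i2)
       (simp only: integral_scaleR_right)
qed

text \<open>By invariance, letting \<open>\<gamma> t\<close> act on the form amounts to applying
  \<open>Ad G (\<gamma> t)\<close> to the arguments. The derivatives of the two sides at 0 are the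
  two parts of the Lie derivative.\<close>

lemma Lie_deriv_invariant:
  assumes alt: "\<And>y. \<omega> y \<in> alt_forms q" and sm: "\<And>\<theta>. (\<lambda>y. \<omega> y \<theta>) \<in> cochains G n"
    and inv: "\<And>a y \<theta>. a \<in> K \<Longrightarrow> \<rho> a (\<omega> (conj_point p j a y) (\<lambda>k. Ad G (inv a) (\<theta> k))) = \<omega> y \<theta>"
    and \<eta>: "\<eta> \<in> lie_subalgebra G K"
  shows "Lie_deriv (lie_bracket G) q \<eta> (\<lambda>\<zeta> \<theta>. actD p j \<zeta> (\<lambda>y. \<omega> y \<theta>) g) (\<omega> g) \<xi> = 0"
proof -
  obtain \<gamma> where \<gamma>: "range \<gamma> \<subseteq> K" "velocity \<gamma> \<eta>"
    using \<eta> unfolding lie_subalgebra_def velocity_def by blast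
  have e: "conj_act G \<rho> p j (\<gamma> t) (\<lambda>y. \<omega> y \<xi>) g = \<omega> g (\<lambda>k. Ad G (\<gamma> t) (\<xi> k))" for t
    using inv[of "\<gamma> t" g "\<lambda>k. Ad G (\<gamma> t) (\<xi> k)"] \<gamma>(1) by (auto simp: conj_act_conj_point)
  have 1: "((\<lambda>t. conj_act G \<rho> p j (\<gamma> t) (\<lambda>y. \<omega> y \<xi>) g) has_vector_derivative actD p j \<eta> (\<lambda>y. \<omega> y \<xi>) g) (at 0)"
    unfolding actD_ediff by (rule curve_derivative[OF conj_act_smooth[OF sm] \<gamma>(2)])
  have 2: "((\<lambda>t. \<omega> g (\<lambda>k. Ad G (\<gamma> t) (\<xi> k))) has_vector_derivative
      (\<Sum>i=1..q. \<omega> g ((\<lambda>k. Ad G (\<gamma> 0) (\<xi> k))(i := lie_bracket G \<eta> (\<xi> i))))) (at 0)"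
    by (rule multilinear_curve_derivative[OF alt, where c = "\<lambda>t k. Ad G (\<gamma> t) (\<xi> k)"]) (rule Ad_curve_derivative[OF \<gamma>(2)])
  have "(\<lambda>k. Ad G (\<gamma> 0) (\<xi> k)) = \<xi>" using \<gamma>(2) by (simp add: velocity_def)
  with vector_derivative_unique_at[OF 1[unfolded e] 2] show ?thesis unfolding Lie_deriv_def by simp
qed

text \<open>In Cartan's formula the Lie derivative vanishes by invariance of
  \<open>D_(j+1) f\<close>, and the differential of the contraction vanishes by the induction
  hypothesis. The base is \<open>j = p\<close>, where \<open>D_(p+1) f\<close> has degree 0 and
  nothing is left to contract.\<close>

lemma d_from_horizontal:
  assumes f: "f \<in> cochains G n" and pn: "p \<le> n" and \<eta>: "\<eta> \<in> lie_subalgebra G K"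
  shows "j \<le> p \<Longrightarrow> (\<And>l a. j \<le> l \<Longrightarrow> l \<le> p \<Longrightarrow> a \<in> K \<Longrightarrow> conj_act G \<rho> p l a f = f) \<Longrightarrow> d_from p j f g (prepend \<eta> \<xi>) = 0"
proof (induction j arbitrary: g \<xi> rule: inc_induct)
  case base
  have alt: "d_from p (Suc p) f y \<in> alt_forms 0" for y using d_from_alt[OF f pn, of "Suc p"] by simp
  have sm: "(\<lambda>y. d_from p (Suc p) f y \<theta>) \<in> cochains G n" for \<theta> by (rule d_from_cochains[OF f pn]) simp
  have inv: "\<rho> a (d_from p (Suc p) f (conj_point p p a y) (\<lambda>k. Ad G (inv a) (\<theta> k))) = d_from p (Suc p) f y \<theta>" if "a \<in> K" for a y \<theta>
    using d_from_natural[OF f pn, of p "Suc p" a y \<theta>] base[of p a] that by simp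
  let ?\<alpha> = "\<lambda>\<zeta> \<theta>. actD p p \<zeta> (\<lambda>y. d_from p (Suc p) f y \<theta>) g"
  have "d_from p p f g (prepend \<eta> \<xi>) = CEa (lie_bracket G) 0 ?\<alpha> (d_from p (Suc p) f g) (prepend \<eta> \<xi>)"
    using d_from_step[of p p f g "prepend \<eta> \<xi>"] by simp
  also have "\<dots> = ?\<alpha> \<eta> \<xi>"
    by (rule CEa_0_prepend) (rule alt_formsD(1)[OF actD_alt_forms[OF alt sm]])
  also have "\<dots> = Lie_deriv (lie_bracket G) 0 \<eta> ?\<alpha> (d_from p (Suc p) f g) \<xi>" by (simp add: Lie_deriv_def)
  also have "\<dots> = 0" by (rule Lie_deriv_invariant[OF alt sm inv \<eta>])
  finally show ?case .
next
  case (step j)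
  then have jp: "j \<le> p" by simp
  obtain q where q: "p - j = Suc q" using step.hyps by (metis Suc_diff_Suc)
  have q': "Suc p - Suc j = Suc q" using q by simp
  have alt: "d_from p (Suc j) f y \<in> alt_forms (Suc q)" for y using d_from_alt[OF f pn, of "Suc j"] jp unfolding q' by simp
  have sm: "(\<lambda>y. d_from p (Suc j) f y \<theta>) \<in> cochains G n" for \<theta> by (rule d_from_cochains[OF f pn]) (use jp in simp)
  have inv: "\<rho> a (d_from p (Suc j) f (conj_point p j a y) (\<lambda>k. Ad G (inv a) (\<theta> k))) = d_from p (Suc j) f y \<theta>" if "a \<in> K" for a y \<theta>
    using d_from_natural[OF f pn jp, of "Suc j" a y \<theta>] step.prems[of j a] jp that by simp
  let ?\<alpha> = "\<lambda>\<zeta> \<theta>. actD p j \<zeta> (\<lambda>y. d_from p (Suc j) f y \<theta>) g"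
  have IH: "d_from p (Suc j) f y (prepend \<eta> \<theta>) = 0" for y \<theta>
    by (rule step.IH) (use step.prems in simp)
  have "d_from p j f g (prepend \<eta> \<xi>) = CEa (lie_bracket G) (Suc q) ?\<alpha> (d_from p (Suc j) f g) (prepend \<eta> \<xi>)"
    unfolding d_from_step[OF jp] q ..
  also have "\<dots> = Lie_deriv (lie_bracket G) (Suc q) \<eta> ?\<alpha> (d_from p (Suc j) f g) \<xi>
     - CEa (lie_bracket G) q (\<lambda>\<zeta> \<theta>. ?\<alpha> \<zeta> (prepend \<eta> \<theta>)) (\<lambda>\<theta>. d_from p (Suc j) f g (prepend \<eta> \<theta>)) \<xi>"
    by (rule CEa_prepend[OF alt]) (rule alt_formsD(1)[OF actD_alt_forms[OF alt sm]])
  also have "Lie_deriv (lie_bracket G) (Suc q) \<eta> ?\<alpha> (d_from p (Suc j) f g) \<xi> = 0"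
    by (rule Lie_deriv_invariant[OF alt sm inv \<eta>])
  finally show ?case by (simp add: IH CEa_def)
qed

end

section \<open>Haar measure and averaging\<close>

locale lie_haar = lie_rep G \<rho>
  for G :: "('g::{t2_space,second_countable_topology}, 'e::real_normed_vector) charted_group" (structure)
    and \<rho> :: "'g \<Rightarrow> 'v::{banach, second_countable_topology} \<Rightarrow> 'v" +
  fixes K :: "'g set" and \<mu> :: "'g measure"
  assumes K_subgroup: "subgroup K G" and K_compact: "compact K" and haar: "normalized_haar G K \<mu>"
begin

lemma compact_prob_K: "compact_prob K \<mu>"
  using K_compact haar unfolding normalized_haar_def compact_prob_def by blast

sublocale compact_prob K \<mu> by (rule compact_prob_K)

lemma K_mult: "a \<in> K \<Longrightarrow> b \<in> K \<Longrightarrow> a \<otimes> b \<in> K" and K_inv: "a \<in> K \<Longrightarrow> inv a \<in> K" and K_one: "\<one> \<in> K"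
  using K_subgroup by (auto simp: subgroup_def)

lemma continuous_mult: "continuous_on UNIV (\<lambda>x. fst x \<otimes> snd x)"
proof -
  have 1: "continuous_on UNIV (\<lambda>x::'g \<times> 'g. (\<lambda>i::nat. if i = 1 then fst x else snd x))"
  proof (rule continuous_on_coordinatewise_then_product)
    show "continuous_on UNIV (\<lambda>x::'g \<times> 'g. if i = 1 then fst x else snd x)" for i :: nat
      by (cases "i = 1") (auto intro!: continuous_intros)
  qed
  have 2: "continuous_on UNIV (\<lambda>g::nat \<Rightarrow> 'g. g 1 \<otimes> g 2)"
    using smooth_mult unfolding smooth_map_def by blast
  have "continuous_on UNIV (\<lambda>x::'g \<times> 'g. (\<lambda>g::nat \<Rightarrow> 'g. g 1 \<otimes> g 2) (\<lambda>i. if i = 1 then fst x else snd x))"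
    by (rule continuous_on_compose2[OF 2 1]) simp
  then show ?thesis by simp
qed

lemma isCont_inv: "isCont (\<lambda>a. inv a) a"
  by (rule smap_isCont) (intro smap_inv smap_proj; simp)

lemma measurable_point: "(\<lambda>k. k) \<in> borel_measurable \<mu>"
proof -
  have "(\<lambda>k. k) \<in> borel_measurable (restrict_space borel K)"
    by (rule measurable_restrict_space1) simp
  then show ?thesis using measurable_cong_sets[OF sets_\<mu> refl] by blast
qed

lemma measurable_into_K:
  assumes "f \<in> borel_measurable M" "\<And>x. x \<in> space M \<Longrightarrow> f x \<in> K"
  shows "f \<in> measurable M \<mu>"
proof -
  have "f \<in> measurable M (restrict_space borel K)"
    by (rule measurable_restrict_space2) (use assms in auto)
  then show ?thesis using measurable_cong_sets[OF refl sets_\<mu>] by blast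
qed

lemma measurable_continuous:
  assumes "continuous_on K \<phi>" shows "\<phi> \<in> borel_measurable \<mu>"
proof -
  have "\<phi> \<in> borel_measurable (restrict_space borel K)"
    by (rule borel_measurable_continuous_on_restrict[OF assms])
  then show ?thesis using measurable_cong_sets[OF sets_\<mu> refl] by blast
qed

lemma integral_left_translate:
  fixes \<phi> :: "'g \<Rightarrow> 'w::{banach, second_countable_topology}"
  assumes a: "a \<in> K" and \<phi>: "continuous_on K \<phi>"
  shows "(\<integral>k. \<phi> (a \<otimes> k) \<partial>\<mu>) = (\<integral>k. \<phi> k \<partial>\<mu>)"
proof -
  have "(\<lambda>k. a \<otimes> k) \<in> borel_measurable \<mu>"
    by (rule borel_measurable_continuous_Pair[OF _ measurable_point continuous_mult]) simp
  then have m: "(\<lambda>k. a \<otimes> k) \<in> measurable \<mu> \<mu>"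
    by (rule measurable_into_K) (simp add: space_\<mu> K_mult a)
  have "distr \<mu> \<mu> (\<lambda>k. a \<otimes> k) = \<mu>"
  proof (rule measure_eqI)
    fix A assume "A \<in> sets (distr \<mu> \<mu> (\<lambda>k. a \<otimes> k))"
    then have A: "A \<in> sets \<mu>" by simp
    have "A \<subseteq> K" using sets.sets_into_space[OF A] by (simp add: space_\<mu>)
    have "(\<lambda>k. a \<otimes> k) -` A \<inter> space \<mu> = inv a <# A"
    proof (rule equalityI; rule subsetI)
      fix k assume "k \<in> (\<lambda>k. a \<otimes> k) -` A \<inter> space \<mu>"
      then have "a \<otimes> k \<in> A" "k = inv a \<otimes> (a \<otimes> k)" by (simp_all flip: m_assoc)
      then show "k \<in> inv a <# A" unfolding l_coset_def by blast
    next
      fix k assume "k \<in> inv a <# A"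
      then obtain h where h: "h \<in> A" "k = inv a \<otimes> h" unfolding l_coset_def by blast
      then have "a \<otimes> k = h" by (simp flip: m_assoc)
      moreover have "k \<in> K" using h \<open>A \<subseteq> K\<close> K_mult K_inv a by auto
      ultimately show "k \<in> (\<lambda>k. a \<otimes> k) -` A \<inter> space \<mu>" using h by (simp add: space_\<mu>)
    qed
    then have "emeasure (distr \<mu> \<mu> (\<lambda>k. a \<otimes> k)) A = emeasure \<mu> (inv a <# A)"
      by (simp add: emeasure_distr[OF m A])
    also have "\<dots> = emeasure \<mu> A" using haar A K_inv[OF a] unfolding normalized_haar_def by blast
    finally show "emeasure (distr \<mu> \<mu> (\<lambda>k. a \<otimes> k)) A = emeasure \<mu> A" .
  qed simp
  then show ?thesis using integral_distr[OF m measurable_continuous[OF \<phi>]] by simp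
qed

text \<open>Integrate \<open>\<phi> (inv l \<otimes> k)\<close> over both variables: by left invariance the integral over \<open>k\<close> removes \<open>l\<close>,
  and the integral over \<open>l\<close> turns it into the integral of \<open>\<phi> \<circ> inv\<close>.\<close>

lemma integral_inverse:
  fixes \<phi> :: "'g \<Rightarrow> 'w::{banach, second_countable_topology}"
  assumes \<phi>: "continuous_on K \<phi>"
  shows "(\<integral>k. \<phi> (inv k) \<partial>\<mu>) = (\<integral>k. \<phi> k \<partial>\<mu>)"
proof -
  interpret prob_space \<mu> by (rule prob)
  interpret P: pair_sigma_finite \<mu> \<mu> ..
  interpret PP: pair_prob_space \<mu> \<mu> ..
  have ci: "continuous_on K (\<lambda>k. \<phi> (inv k))"
    by (rule continuous_on_compose2[OF \<phi>]) (auto intro: K_inv continuous_at_imp_continuous_on isCont_inv)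
  have sp: "space (\<mu> \<Otimes>\<^sub>M \<mu>) = K \<times> K" by (simp add: space_pair_measure space_\<mu>)
  have "(\<lambda>y. inv (fst y) \<otimes> snd y) \<in> borel_measurable (\<mu> \<Otimes>\<^sub>M \<mu>)"
  proof (rule borel_measurable_continuous_Pair[OF _ _ continuous_mult])
    have "(\<lambda>k. inv k) \<in> borel_measurable \<mu>"
      by (rule measurable_continuous) (auto intro: continuous_at_imp_continuous_on isCont_inv)
    then show "(\<lambda>y. inv (fst y)) \<in> borel_measurable (\<mu> \<Otimes>\<^sub>M \<mu>)" by (rule measurable_compose[OF measurable_fst])
    show "snd \<in> borel_measurable (\<mu> \<Otimes>\<^sub>M \<mu>)" by (rule measurable_compose[OF measurable_snd measurable_point])
  qed
  then have "(\<lambda>y. inv (fst y) \<otimes> snd y) \<in> measurable (\<mu> \<Otimes>\<^sub>M \<mu>) \<mu>"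
    by (rule measurable_into_K) (auto simp: sp K_mult K_inv)
  from measurable_compose[OF this measurable_continuous[OF \<phi>]]
  have m: "(\<lambda>y. \<phi> (inv (fst y) \<otimes> snd y)) \<in> borel_measurable (\<mu> \<Otimes>\<^sub>M \<mu>)" .
  have "bounded (\<phi> ` K)" by (rule compact_imp_bounded[OF compact_continuous_image[OF \<phi> compact_K]])
  then obtain B where B: "\<And>k. k \<in> K \<Longrightarrow> norm (\<phi> k) \<le> B" unfolding bounded_iff by auto
  have int: "Bochner_Integration.integrable (\<mu> \<Otimes>\<^sub>M \<mu>) (\<lambda>(l, k). \<phi> (inv l \<otimes> k))"
    unfolding case_prod_beta
    by (rule PP.integrable_const_bound[OF _ m, of B]) (rule AE_I2, auto simp: sp intro!: B K_mult K_inv)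
  have "(\<integral>k. \<phi> k \<partial>\<mu>) = (\<integral>l. (\<integral>k. \<phi> k \<partial>\<mu>) \<partial>\<mu>)" by (simp add: prob_space)
  also have "\<dots> = (\<integral>l. (\<integral>k. \<phi> (inv l \<otimes> k) \<partial>\<mu>) \<partial>\<mu>)"
    by (rule integral_cong_K) (rule integral_left_translate[OF K_inv \<phi>, symmetric])
  also have "\<dots> = (\<integral>k. (\<integral>l. \<phi> (inv l \<otimes> k) \<partial>\<mu>) \<partial>\<mu>)" by (rule P.Fubini_integral[OF int, symmetric])
  also have "\<dots> = (\<integral>k. (\<integral>l. \<phi> (inv l) \<partial>\<mu>) \<partial>\<mu>)"
  proof (rule integral_cong_K)
    fix k assume k: "k \<in> K"
    have "(\<integral>l. \<phi> (inv l \<otimes> k) \<partial>\<mu>) = (\<integral>l. \<phi> (inv (inv k \<otimes> l)) \<partial>\<mu>)" by (simp add: inv_mult_group)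
    also have "\<dots> = (\<integral>l. \<phi> (inv l) \<partial>\<mu>)" by (rule integral_left_translate[OF K_inv[OF k] ci])
    finally show "(\<integral>l. \<phi> (inv l \<otimes> k) \<partial>\<mu>) = (\<integral>l. \<phi> (inv l) \<partial>\<mu>)" .
  qed
  also have "\<dots> = (\<integral>l. \<phi> (inv l) \<partial>\<mu>)" by (simp add: prob_space)
  finally show ?thesis by simp
qed

end

section \<open>The averaging actions\<close>

context lie_rep
begin

text \<open>One formula for all cases of \<open>avg_act\<close>, valid for functions of the entries
  from 1 to \<open>p\<close>: with label 0 one factor lands in entry 0, which is never read, and
  label \<open>p\<close> has no right neighbour.\<close>

definition avg_point :: "nat \<Rightarrow> nat \<Rightarrow> 'g \<Rightarrow> (nat \<Rightarrow> 'g) \<Rightarrow> nat \<Rightarrow> 'g" where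
  "avg_point p i a g = (\<lambda>l. if l = i then g l \<otimes> a else if l = Suc i \<and> i < p then inv a \<otimes> g l else g l)"

lemma avg_act_avg_point:
  assumes f: "f \<in> cochains G p" and i: "i \<le> p"
  shows "avg_act G \<rho> p i a f g = (if i = p then \<rho> a (f (avg_point p i a g)) else f (avg_point p i a g))"
proof -
  note d = depends_uptoD[OF cochains_depends[OF f]]
  consider "p = 0" | "p > 0" "i = 0" | "0 < i" "i < p" | "p > 0" "i = p" using i by linarith
  then show ?thesis
  proof cases
    case 1
    then have "f g = f (avg_point p i a g)" by (intro d) simp
    then show ?thesis using 1 i by (simp add: avg_act_def)
  next
    case 2
    then have "f (g(1 := inv a \<otimes> g 1)) = f (avg_point p i a g)" by (intro d) (auto simp: avg_point_def)
    then show ?thesis using 2 by (simp add: avg_act_def)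
  next
    case 3
    then have "f (g(i := g i \<otimes> a, i + 1 := inv a \<otimes> g (i + 1))) = f (avg_point p i a g)" by (intro d) (auto simp: avg_point_def)
    then show ?thesis using 3 by (simp add: avg_act_def)
  next
    case 4
    then have "f (g(p := g p \<otimes> a)) = f (avg_point p i a g)" by (intro d) (auto simp: avg_point_def)
    then show ?thesis using 4 by (simp add: avg_act_def)
  qed
qed

lemma smap_avg_point:
  assumes "smap m A" "smap m (\<lambda>g. \<Phi> g l)"
  shows "smap m (\<lambda>g. avg_point p i (A g) (\<Phi> g) l)"
  unfolding avg_point_def by (intro smap_if smap_mult smap_inv assms)

lemma avg_act_cochains_general:
  assumes f: "f \<in> cochains G p" and i: "i \<le> p" and A: "smap m A" and \<Phi>: "\<And>l. 1 \<le> l \<Longrightarrow> l \<le> p \<Longrightarrow> smap m (\<lambda>g. \<Phi> g l)"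
  shows "(\<lambda>g. avg_act G \<rho> p i (A g) f (\<Phi> g)) \<in> cochains G m"
proof -
  have "(\<lambda>g. f (avg_point p i (A g) (\<Phi> g))) \<in> cochains G m"
    by (intro cochains_composeI[OF f] smap_avg_point A \<Phi>)
  with rho_cochains[OF A this] show ?thesis unfolding avg_act_avg_point[OF f i] by (cases "i = p") simp_all
qed

lemma avg_act_cochains: "f \<in> cochains G p \<Longrightarrow> i \<le> p \<Longrightarrow> avg_act G \<rho> p i a f \<in> cochains G p"
  using avg_act_cochains_general[where \<Phi> = "\<lambda>g. g" and A = "\<lambda>_. a" and m = p] smap_const smap_proj by blast

lemma avg_act_cochains_param:
  "f \<in> cochains G p \<Longrightarrow> i \<le> p \<Longrightarrow> (\<lambda>g. avg_act G \<rho> p i (g (Suc p)) f g) \<in> cochains G (Suc p)"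
  by (rule avg_act_cochains_general[where \<Phi> = "\<lambda>g. g"], assumption, assumption) (rule smap_proj; simp)+

lemma avg_act_upd:
  assumes f: "f \<in> cochains G p" and i: "i \<le> p"
  shows "avg_act G \<rho> p i a f (g(Suc p := k)) = avg_act G \<rho> p i a f g"
  by (rule depends_uptoD[OF cochains_depends[OF avg_act_cochains[OF f i]]]) simp

lemma avg_act_mult:
  assumes f: "f \<in> cochains G p" and i: "i \<le> p"
  shows "avg_act G \<rho> p i a (avg_act G \<rho> p i b f) g = avg_act G \<rho> p i (a \<otimes> b) f g"
proof -
  have "f (avg_point p i b (avg_point p i a g)) = f (avg_point p i (a \<otimes> b) g)"
    by (rule arg_cong[of _ _ f]) (auto simp: avg_point_def fun_eq_iff m_assoc inv_mult_group)
  then show ?thesis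
    unfolding avg_act_avg_point[OF avg_act_cochains[OF f i] i] avg_act_avg_point[OF f i] by (cases "i = p") (simp_all add: rho_mult)
qed

text \<open>Two different labels share at most one entry, and there one of them multiplies from the
  left and the other from the right.\<close>

lemma avg_act_commute:
  assumes f: "f \<in> cochains G p" and i: "i \<le> p" and l: "l \<le> p" and il: "i \<noteq> l"
  shows "avg_act G \<rho> p i a (avg_act G \<rho> p l b f) g = avg_act G \<rho> p l b (avg_act G \<rho> p i a f) g"
proof -
  have "f (avg_point p l b (avg_point p i a g)) = f (avg_point p i a (avg_point p l b g))"
    by (rule arg_cong[of _ _ f]) (use il in \<open>auto simp: avg_point_def fun_eq_iff m_assoc\<close>)
  then show ?thesis
    unfolding avg_act_avg_point[OF avg_act_cochains[OF f i] l] avg_act_avg_point[OF avg_act_cochains[OF f l] i]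
      avg_act_avg_point[OF f i] avg_act_avg_point[OF f l]
    using i l il by auto
qed

lemma conj_act_avg_act:
  assumes f: "f \<in> cochains G p"
  shows "i \<le> p \<Longrightarrow> (\<And>l. i < l \<Longrightarrow> l \<le> p \<Longrightarrow> avg_act G \<rho> p l a f = f) \<Longrightarrow> conj_act G \<rho> p i a f g = avg_act G \<rho> p i a f g"
proof (induction i arbitrary: g rule: inc_induct)
  case base
  have "conj_point p p a g = avg_point p p a g" by (auto simp: conj_point_def avg_point_def fun_eq_iff)
  then show ?case by (simp add: conj_act_conj_point avg_act_avg_point[OF f])
next
  case (step i)
  have "conj_act G \<rho> p (Suc i) a f h = avg_act G \<rho> p (Suc i) a f h" for h
    by (rule step.IH) (use step.prems in simp)
  then have eq: "conj_act G \<rho> p (Suc i) a f h = f h" for h using step.prems[of "Suc i"] step.hyps by simp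
  \<comment> \<open>The action with label \<open>i\<close> supplies the right factor of entry
    \<open>i\<close> and the left factor of entry \<open>i + 1\<close> that the conjugation with
    label \<open>i + 1\<close> is short of.\<close>
  have "conj_point p (Suc i) a (avg_point p i a g) = conj_point p i a g"
    using step.hyps by (auto simp: conj_point_def avg_point_def fun_eq_iff)
  then have "f (avg_point p i a g) = \<rho> a (f (conj_point p i a g))" using eq[of "avg_point p i a g"] by (simp add: conj_act_conj_point)
  then show ?case using step.hyps by (simp add: conj_act_conj_point avg_act_avg_point[OF f])
qed

end

context lie_haar
begin

lemma Av_i_cochains:
  assumes f: "f \<in> cochains G p" and i: "i \<le> p" shows "Av_i G \<rho> \<mu> p i f \<in> cochains G p"
proof -
  have "(\<lambda>g. \<integral>k. avg_act G \<rho> p i ((g(Suc p := k)) (Suc p)) f (g(Suc p := k)) \<partial>\<mu>) \<in> cochains G p"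
    by (rule integral_cochains[OF compact_prob_K avg_act_cochains_param[OF f i]])
  then have "(\<lambda>g. \<integral>k. avg_act G \<rho> p i k f g \<partial>\<mu>) \<in> cochains G p"
    by (simp only: avg_act_upd[OF f i] fun_upd_same)
  moreover have "Av_i G \<rho> \<mu> p i f = (\<lambda>g. \<integral>k. avg_act G \<rho> p i k f g \<partial>\<mu>)" by (simp add: Av_i_def fun_eq_iff)
  ultimately show ?thesis by simp
qed

lemma continuous_avg_act:
  assumes f: "f \<in> cochains G p" and i: "i \<le> p" shows "continuous_on S (\<lambda>k. avg_act G \<rho> p i k f g)"
  using cochains_continuous_slice[OF avg_act_cochains_param[OF f i], of S g "Suc p"]
  by (simp only: avg_act_upd[OF f i] fun_upd_same)

lemma avg_act_Av_i:
  assumes f: "f \<in> cochains G p" and i: "i \<le> p" and l: "l \<le> p"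
  shows "avg_act G \<rho> p l a (Av_i G \<rho> \<mu> p i f) g = (\<integral>k. avg_act G \<rho> p l a (avg_act G \<rho> p i k f) g \<partial>\<mu>)"
proof -
  have "\<rho> a (\<integral>k. avg_act G \<rho> p i k f h \<partial>\<mu>) = (\<integral>k. \<rho> a (avg_act G \<rho> p i k f h) \<partial>\<mu>)" for h
    by (rule integral_bounded_linear[OF bounded_linear_rho integrable[OF continuous_avg_act[OF f i]], symmetric])
  then show ?thesis
    unfolding avg_act_avg_point[OF Av_i_cochains[OF f i] l] avg_act_avg_point[OF avg_act_cochains[OF f i] l]
    by (simp add: Av_i_def)
qed

lemma avg_act_Av_i_same:
  assumes f: "f \<in> cochains G p" and i: "i \<le> p" and a: "a \<in> K"
  shows "avg_act G \<rho> p i a (Av_i G \<rho> \<mu> p i f) = Av_i G \<rho> \<mu> p i f"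
proof
  fix g
  show "avg_act G \<rho> p i a (Av_i G \<rho> \<mu> p i f) g = Av_i G \<rho> \<mu> p i f g"
    unfolding avg_act_Av_i[OF f i i] avg_act_mult[OF f i] Av_i_def
    by (rule integral_left_translate[OF a continuous_avg_act[OF f i]])
qed

text \<open>Since the actions commute, invariance that has been reached survives averaging over
  another label.\<close>

lemma avg_act_Av_i_other:
  assumes f: "f \<in> cochains G p" and i: "i \<le> p" and l: "l \<le> p" and il: "i \<noteq> l" and inv: "avg_act G \<rho> p l a f = f"
  shows "avg_act G \<rho> p l a (Av_i G \<rho> \<mu> p i f) = Av_i G \<rho> \<mu> p i f"
proof
  fix g
  show "avg_act G \<rho> p l a (Av_i G \<rho> \<mu> p i f) g = Av_i G \<rho> \<mu> p i f g"
    unfolding avg_act_Av_i[OF f i l] avg_act_commute[OF f i l il, symmetric] inv by (simp add: Av_i_def)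
qed

section \<open>Iterated averages\<close>

definition Av_from :: "nat \<Rightarrow> nat \<Rightarrow> ((nat \<Rightarrow> 'g) \<Rightarrow> 'v) \<Rightarrow> (nat \<Rightarrow> 'g) \<Rightarrow> 'v" where
  "Av_from p m f = foldr (Av_i G \<rho> \<mu> p) [m..<p + 1] f"

lemma Av_from_Suc: "Av_from p (Suc p) f = f"
  by (simp add: Av_from_def)

lemma Av_from_step: "m \<le> p \<Longrightarrow> Av_from p m f = Av_i G \<rho> \<mu> p m (Av_from p (Suc m) f)"
  unfolding Av_from_def by (subst upt_conv_Cons) simp_all

lemma Av_from_cochains:
  assumes f: "f \<in> cochains G p" shows "m \<le> Suc p \<Longrightarrow> Av_from p m f \<in> cochains G p"
proof (induction m rule: inc_induct)
  case (step m)
  then have "m \<le> p" by simp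
  then show ?case unfolding Av_from_step[OF \<open>m \<le> p\<close>] by (intro Av_i_cochains step.IH)
qed (simp add: Av_from_Suc f)

lemma avg_act_Av_from:
  assumes f: "f \<in> cochains G p" and a: "a \<in> K"
  shows "m \<le> Suc p \<Longrightarrow> m \<le> l \<Longrightarrow> l \<le> p \<Longrightarrow> avg_act G \<rho> p l a (Av_from p m f) = Av_from p m f"
proof (induction m rule: inc_induct)
  case (step m)
  then have mp: "m \<le> p" by simp
  have c: "Av_from p (Suc m) f \<in> cochains G p" by (rule Av_from_cochains[OF f]) (use mp in simp)
  show ?case
  proof (cases "l = m")
    case True
    then show ?thesis unfolding Av_from_step[OF mp] True by (intro avg_act_Av_i_same[OF c mp a])
  next
    case False
    then have "avg_act G \<rho> p l a (Av_from p (Suc m) f) = Av_from p (Suc m) f" using step by simp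
    with False show ?thesis unfolding Av_from_step[OF mp] by (intro avg_act_Av_i_other[OF c mp step.prems(2)]) auto
  qed
qed simp

lemma conj_act_Av_from:
  assumes f: "f \<in> cochains G p" and a: "a \<in> K" and m: "m \<le> Suc p" and l: "m \<le> l" "l \<le> p"
  shows "conj_act G \<rho> p l a (Av_from p m f) = Av_from p m f"
proof
  fix g
  have "conj_act G \<rho> p l a (Av_from p m f) g = avg_act G \<rho> p l a (Av_from p m f) g"
    by (rule conj_act_avg_act[OF Av_from_cochains[OF f m] l(2)]) (rule avg_act_Av_from[OF f a m], use l in auto)
  also have "\<dots> = Av_from p m f g" by (simp only: avg_act_Av_from[OF f a m l])
  finally show "conj_act G \<rho> p l a (Av_from p m f) g = Av_from p m f g" .
qed

text \<open>The average with label \<open>m\<close> can be computed with the conjugation action, for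
  which the differentials are natural, because invariance under the higher labels has been achieved
  before.\<close>

lemma integral_conj_act_Av_from:
  assumes f: "f \<in> cochains G p" and m: "m \<le> p"
  shows "(\<integral>k. conj_act G \<rho> p m k (Av_from p (Suc m) f) g \<partial>\<mu>) = Av_from p m f g"
  unfolding Av_from_step[OF m] Av_i_def
proof (rule integral_cong_K)
  fix k assume k: "k \<in> K"
  show "conj_act G \<rho> p m k (Av_from p (Suc m) f) g = avg_act G \<rho> p m k (Av_from p (Suc m) f) g"
    by (rule conj_act_avg_act[OF Av_from_cochains[OF f] m]) (use m in \<open>auto intro!: avg_act_Av_from[OF f k]\<close>)
qed

lemma d_from_integral_conj_act:
  assumes f: "f \<in> cochains G p" and m: "m \<le> p" and j: "j \<le> Suc p"
  shows "continuous_on K (\<lambda>k. d_from p j (conj_act G \<rho> p m k (Av_from p (Suc m) f)) g \<xi>)"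
    and "(\<integral>k. d_from p j (conj_act G \<rho> p m k (Av_from p (Suc m) f)) g \<xi> \<partial>\<mu>) = d_from p j (Av_from p m f) g \<xi>"
proof -
  let ?F = "Av_from p (Suc m) f"
  have F: "?F \<in> cochains G p" by (rule Av_from_cochains[OF f]) (use m in simp)
  \<comment> \<open>\<open>?H\<close> carries the acting element in entry \<open>p + 1\<close>:
    fixing this entry gives the transformed function, integrating over it gives the average.\<close>
  let ?H = "\<lambda>h. conj_act G \<rho> p m (h (Suc p)) ?F h"
  have H: "?H \<in> cochains G (Suc p)" by (rule conj_act_cochains_param[OF F])
  have s: "conj_act G \<rho> p m k ?F = (\<lambda>h. ?H (h(Suc p := k)))" for k
    by (rule ext) (simp only: conj_act_upd[OF F order_refl m] fun_upd_same)
  have D: "d_from p j (conj_act G \<rho> p m k ?F) g \<xi> = d_from p j ?H (g(Suc p := k)) \<xi>" for k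
    unfolding s[of k] by (rule d_from_slice[OF order_refl j])
  have "(\<lambda>g. d_from p j ?H g \<xi>) \<in> cochains G (Suc p)" by (rule d_from_cochains[OF H _ j]) simp
  from cochains_continuous_slice[OF this, of K g "Suc p"]
  show "continuous_on K (\<lambda>k. d_from p j (conj_act G \<rho> p m k ?F) g \<xi>)" unfolding D .
  have "Av_from p m f = (\<lambda>g. \<integral>k. ?H (g(Suc p := k)) \<partial>\<mu>)"
    by (rule ext) (simp only: conj_act_upd[OF F order_refl m] fun_upd_same integral_conj_act_Av_from[OF f m])
  then show "(\<integral>k. d_from p j (conj_act G \<rho> p m k ?F) g \<xi> \<partial>\<mu>) = d_from p j (Av_from p m f) g \<xi>"
    unfolding D by (simp only: d_from_integral[OF compact_prob_K H order_refl j])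
qed

end

section \<open>The van Est map\<close>

lemma CEa_scaleR: "CEa B q (\<lambda>\<zeta> \<theta>. r *\<^sub>R \<alpha> \<zeta> \<theta>) (\<lambda>\<theta>. r *\<^sub>R w \<theta>) \<xi> = r *\<^sub>R CEa B q \<alpha> w \<xi>"
  unfolding CEa_def by (simp only: scaleR_add_right scaleR_sum_right scaleR_left_commute)

context lie_rep
begin

definition trunc :: "nat \<Rightarrow> (nat \<Rightarrow> 'g) \<Rightarrow> nat \<Rightarrow> 'g" where
  "trunc j g = (\<lambda>l. if 1 \<le> l \<and> l \<le> j then g l else \<one>)"

text \<open>At such a point the conjugated entries stay trivial, only \<open>x\<close> is multiplied
  by \<open>a\<close>, and \<open>\<rho> a\<close> acts on the value. The product rule separates the
  left-invariant field on \<open>x\<close> from the derivative of the representation.\<close>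

lemma vert_act_trunc:
  assumes F: "F \<in> cochains G p" and j: "1 \<le> j" "j \<le> p"
  shows "vert_act G \<rho> \<zeta> (\<lambda>(g, x). F (trunc j (g(j := x)))) (g, x) = actD p j \<zeta> F (trunc j (g(j := x)))"
proof -
  let ?y = "\<lambda>b. trunc j (g(j := x \<otimes> b))"
  let ?w = "\<lambda>a b. \<rho> a (F (?y b))"
  have "(\<lambda>h. \<rho> (h 1) (F (?y (h 2)))) \<in> cochains G 2"
  proof (intro rho_cochains cochains_composeI[OF F])
    show "smap 2 (\<lambda>h. ?y (h 2) l)" for l
      unfolding trunc_def fun_upd_apply by (intro smap_if smap_mult smap_const smap_proj) simp_all
  qed (rule smap_proj; simp)
  from curve2_derivative[OF cochains_smooth_at_e2[OF this] velocity_exp velocity_exp, of \<zeta> \<zeta>]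
  have d: "((\<lambda>t. ?w (exp_chart G (t *\<^sub>R \<zeta>)) (exp_chart G (t *\<^sub>R \<zeta>))) has_vector_derivative
     ediff (\<lambda>a. ?w a \<one>) \<zeta> + ediff (?w \<one>) \<zeta>) (at 0)" .
  have e: "conj_act G \<rho> p j a F (trunc j (g(j := x))) = ?w a a" for a
  proof -
    have "conj_point p j a (trunc j (g(j := x))) = ?y a"
      using j by (auto simp: conj_point_def trunc_def fun_eq_iff)
    then show ?thesis by (simp add: conj_act_conj_point)
  qed
  have "actD p j \<zeta> F (trunc j (g(j := x))) = ediff (\<lambda>a. ?w a \<one>) \<zeta> + ediff (?w \<one>) \<zeta>"
    unfolding conj_act_deriv_def e by (rule vector_derivative_at[OF d])
  then show ?thesis
    by (simp add: vert_act_def left_deriv_def rep_deriv_def ediff_def add.commute)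
qed

lemma vert_diff_zero: "vert_diff G \<rho> i q (\<lambda>_ _. 0) = (\<lambda>_ _. 0)"
proof -
  have "vert_act G \<rho> \<zeta> (\<lambda>_. 0) y = 0" for \<zeta> y
    by (cases y) (simp add: vert_act_def left_deriv_def rep_deriv_def)
  then show ?thesis unfolding vert_diff_def CE_def by (intro ext) simp
qed

end

lemma inj_one_plus_dh: "inj_on (one_plus_dh G \<rho> \<mu>) A"
proof (rule inj_onI)
  fix \<Psi> \<Psi>' assume eq: "one_plus_dh G \<rho> \<mu> \<Psi> = one_plus_dh G \<rho> \<mu> \<Psi>'"
  have eq': "\<Psi> p q y \<xi> + dh G \<rho> \<mu> \<Psi> p q y \<xi> = \<Psi>' p q y \<xi> + dh G \<rho> \<mu> \<Psi>' p q y \<xi>" for p q y \<xi>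
    using eq unfolding one_plus_dh_def fun_eq_iff by blast
  have "\<Psi> p q = \<Psi>' p q" for p q
  proof (induction q arbitrary: p)
    case 0
    show ?case using eq'[of p 0] by (intro ext) (simp add: dh_def)
  next
    case (Suc q)
    then have "dh G \<rho> \<mu> \<Psi> p (Suc q) = dh G \<rho> \<mu> \<Psi>' p (Suc q)" by (simp add: dh_def)
    then show ?case using eq'[of p "Suc q"] by (intro ext) simp
  qed
  then show "\<Psi> = \<Psi>'" by blast
qed

section \<open>The preimage under \<open>1 + dh\<close> and the van Est formula\<close>

context lie_haar
begin

definition psi :: "nat \<Rightarrow> ((nat \<Rightarrow> 'g) \<Rightarrow> 'v) \<Rightarrow> nat \<Rightarrow> ('g, 'e, 'v) dcochain" where
  "psi p f j = (\<lambda>(g, x) \<xi>. d_from p j (Av_from p j f) (trunc j (g(j := x))) \<xi>)"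

text \<open>\<open>Psi p f\<close> is the preimage of \<open>j f\<close> under \<open>1 + dh\<close>.\<close>

definition Psi :: "nat \<Rightarrow> ((nat \<Rightarrow> 'g) \<Rightarrow> 'v) \<Rightarrow> ('g, 'e, 'v) dfamily" where
  "Psi p f = (\<lambda>i q. if i + q = p then (if q = 0 then j_map G \<rho> f else psi p f (Suc i)) else (\<lambda>_ _. 0))"

lemma trunc_conj_point: "1 \<le> j \<Longrightarrow> conj_point p j a (trunc j (g(j := x))) = trunc j (g(j := x \<otimes> a))"
  by (auto simp: conj_point_def trunc_def fun_eq_iff)

text \<open>Naturality is used twice. Invariance under label \<open>j + 1\<close> removes the
  \<open>k\<close> from entry \<open>j + 1\<close> at the price of \<open>\<rho> (inv k)\<close> on
  the value and \<open>Ad G k\<close> on the arguments. Together with the entry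
  \<open>x \<otimes> inv k\<close> these make up the conjugation action of \<open>inv k\<close> with
  label \<open>j\<close>.\<close>

lemma Psi_integrand:
  assumes f: "f \<in> cochains G p" and j: "j \<le> p" and k: "k \<in> K"
  shows "Psi p f j (p - j) (g(j := x \<otimes> inv k), k) \<xi>
     = d_from p (Suc j) (conj_act G \<rho> p j (inv k) (Av_from p (Suc j) f)) (trunc j (g(j := x))) \<xi>"
proof (cases "j = p")
  case True
  \<comment> \<open>For \<open>j = p\<close> the component is \<open>j f\<close>, whose factor
    \<open>\<rho> (inv k)\<close> is already that of the conjugation action with label
    \<open>p\<close>.\<close>
  have "f (g(p := x \<otimes> inv k)) = f (conj_point p p (inv k) (trunc p (g(p := x))))"
    by (rule depends_uptoD[OF cochains_depends[OF f]]) (auto simp: conj_point_def trunc_def)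
  then show ?thesis unfolding True
    by (simp add: Psi_def j_map_def d_from_Suc Av_from_Suc conj_act_conj_point)
next
  case False
  then have jp: "Suc j \<le> p" using j by simp
  let ?F = "Av_from p (Suc j) f"
  have F: "?F \<in> cochains G p" by (rule Av_from_cochains[OF f]) (use jp in simp)
  let ?y = "trunc j (g(j := x \<otimes> inv k))"
  have "Psi p f j (p - j) (g(j := x \<otimes> inv k), k) \<xi> = d_from p (Suc j) ?F (trunc (Suc j) (g(j := x \<otimes> inv k, Suc j := k))) \<xi>"
    using jp by (simp add: Psi_def psi_def)
  also have "trunc (Suc j) (g(j := x \<otimes> inv k, Suc j := k)) = conj_point p (Suc j) k ?y"
    by (auto simp: conj_point_def trunc_def fun_eq_iff)
  also have "d_from p (Suc j) ?F (conj_point p (Suc j) k ?y) \<xi> = \<rho> (inv k) (d_from p (Suc j) ?F ?y (\<lambda>i. Ad G k (\<xi> i)))"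
  proof -
    have "d_from p (Suc j) (conj_act G \<rho> p (Suc j) k ?F) ?y (\<lambda>i. Ad G k (\<xi> i))
      = \<rho> k (d_from p (Suc j) ?F (conj_point p (Suc j) k ?y) (\<lambda>i. Ad G (inv k) (Ad G k (\<xi> i))))"
      by (rule d_from_natural[OF F order_refl jp]) (use jp in simp_all)
    moreover have "conj_act G \<rho> p (Suc j) k ?F = ?F"
      by (rule conj_act_Av_from[OF f k]) (use jp in simp_all)
    ultimately have "d_from p (Suc j) ?F ?y (\<lambda>i. Ad G k (\<xi> i)) = \<rho> k (d_from p (Suc j) ?F (conj_point p (Suc j) k ?y) \<xi>)"
      by (simp only: Ad_inv)
    then show ?thesis by (simp only: rho_inv)
  qed
  also have "\<dots> = \<rho> (inv k) (d_from p (Suc j) ?F (conj_point p j (inv k) (trunc j (g(j := x)))) (\<lambda>i. Ad G (inv (inv k)) (\<xi> i)))"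
  proof -
    \<comment> \<open>Not an equality of points: for \<open>j = 0\<close> they may differ in the
      unread entry 0.\<close>
    have "d_from p (Suc j) ?F ?y \<theta> = d_from p (Suc j) ?F (conj_point p j (inv k) (trunc j (g(j := x)))) \<theta>" for \<theta>
      by (rule depends_uptoD[OF cochains_depends[OF d_from_cochains[OF F order_refl]]])
         (use j in \<open>auto simp: conj_point_def trunc_def\<close>)
    then show ?thesis by simp
  qed
  also have "\<dots> = d_from p (Suc j) (conj_act G \<rho> p j (inv k) ?F) (trunc j (g(j := x))) \<xi>"
    by (rule d_from_natural[OF F order_refl j, symmetric]) (use j in simp_all)
  finally show ?thesis .
qed

text \<open>The integrand is a conjugation action by \<open>inv k\<close>, and inversion invariance
  of the measure turns its integral into the average with label \<open>j\<close>. The case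
  \<open>j = 0\<close> serves \<open>p_map\<close> in place of \<open>h_map\<close>; there the
  update of entry 0 has no effect.\<close>

lemma Psi_integral:
  assumes f: "f \<in> cochains G p" and j: "j \<le> p"
  shows "(\<integral>k. Psi p f j (p - j) (g(j := x \<otimes> inv k), k) \<xi> \<partial>\<mu>)
     = d_from p (Suc j) (Av_from p j f) (trunc j (g(j := x))) \<xi>"
proof -
  have sj: "Suc j \<le> Suc p" using j by simp
  note D = d_from_integral_conj_act[OF f j sj, of "trunc j (g(j := x))" \<xi>]
  have "(\<integral>k. Psi p f j (p - j) (g(j := x \<otimes> inv k), k) \<xi> \<partial>\<mu>)
     = (\<integral>k. d_from p (Suc j) (conj_act G \<rho> p j (inv k) (Av_from p (Suc j) f)) (trunc j (g(j := x))) \<xi> \<partial>\<mu>)"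
    by (rule integral_cong_K) (rule Psi_integrand[OF f j])
  also have "\<dots> = (\<integral>k. d_from p (Suc j) (conj_act G \<rho> p j k (Av_from p (Suc j) f)) (trunc j (g(j := x))) \<xi> \<partial>\<mu>)"
    by (rule integral_inverse[OF D(1)])
  also have "\<dots> = d_from p (Suc j) (Av_from p j f) (trunc j (g(j := x))) \<xi>" by (rule D(2))
  finally show ?thesis .
qed

text \<open>With \<open>j = i + 1\<close>, \<open>h_map\<close> produces \<open>D_(j+1) f_j\<close>
  on points ending in neutral elements, up to the sign \<open>(-1) ^ Suc i\<close>. There the
  vertical differential acts as the differential with index \<open>j\<close>, and its own sign
  \<open>(-1) ^ i\<close> makes the total sign -1.\<close>

lemma vert_diff_h_Psi:
  assumes f: "f \<in> cochains G p" and i: "Suc i \<le> p"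
  shows "vert_diff G \<rho> i (p - Suc i) (h_map G \<mu> (Suc i) (Psi p f (Suc i) (p - Suc i))) y \<xi> = - psi p f (Suc i) y \<xi>"
proof -
  obtain g x where y: "y = (g, x)" by (cases y)
  let ?j = "Suc i" and ?q = "p - Suc i"
  let ?W = "d_from p (Suc ?j) (Av_from p ?j f)" and ?r = "(-1) ^ ?j :: real"
  let ?H = "h_map G \<mu> ?j (Psi p f ?j ?q)" and ?y = "trunc ?j (g(?j := x))"
  have A: "Av_from p ?j f \<in> cochains G p" by (rule Av_from_cochains[OF f]) (use i in simp)
  have W: "(\<lambda>g. ?W g \<theta>) \<in> cochains G p" for \<theta> by (rule d_from_cochains[OF A order_refl]) (use i in simp)
  have H: "?H (g, x) \<theta> = ?r *\<^sub>R ?W (trunc ?j (g(?j := x))) \<theta>" for g x \<theta>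
    using Psi_integral[OF f i, of g x \<theta>] by (simp add: h_map_def)
  have "vert_act G \<rho> \<zeta> (\<lambda>y. ?H y \<theta>) (g, x) = ?r *\<^sub>R actD p ?j \<zeta> (\<lambda>y. ?W y \<theta>) ?y" for \<zeta> \<theta>
  proof -
    have "(\<lambda>y. ?H y \<theta>) = (\<lambda>(g, x). (\<lambda>y. ?r *\<^sub>R ?W y \<theta>) (trunc ?j (g(?j := x))))"
    proof
      fix y' show "?H y' \<theta> = (case y' of (g, x) \<Rightarrow> (\<lambda>y. ?r *\<^sub>R ?W y \<theta>) (trunc ?j (g(?j := x))))"
        by (cases y') (simp only: H prod.case)
    qed
    moreover have "vert_act G \<rho> \<zeta> (\<lambda>(g, x). (\<lambda>y. ?r *\<^sub>R ?W y \<theta>) (trunc ?j (g(?j := x)))) (g, x)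
       = actD p ?j \<zeta> (\<lambda>y. ?r *\<^sub>R ?W y \<theta>) ?y"
      by (rule vert_act_trunc[OF cochains_scaleR_const[OF W]]) (use i in simp_all)
    ultimately show ?thesis by (simp only: actD_scaleR[OF W])
  qed
  moreover have "?H (g, x) = (\<lambda>\<theta>. ?r *\<^sub>R ?W ?y \<theta>)" by (rule ext) (rule H)
  ultimately have "CE G (vert_act G \<rho>) ?q ?H (g, x) \<xi>
      = ?r *\<^sub>R CEa (lie_bracket G) ?q (\<lambda>\<zeta> \<theta>. actD p ?j \<zeta> (\<lambda>y. ?W y \<theta>) ?y) (?W ?y) \<xi>"
    unfolding CE_CEa by (simp only: CEa_scaleR)
  also have "CEa (lie_bracket G) ?q (\<lambda>\<zeta> \<theta>. actD p ?j \<zeta> (\<lambda>y. ?W y \<theta>) ?y) (?W ?y) \<xi> = psi p f ?j (g, x) \<xi>"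
    unfolding psi_def prod.case by (rule d_from_step[OF i, symmetric])
  finally show ?thesis unfolding vert_diff_def y by (simp flip: power_add add: power_Suc)
qed

lemma zero_basic: "(\<lambda>_ _. 0) \<in> basic_dcochains G \<rho> K i q"
  using cochains_const[of "0::'v" "i + 1"]
  by (simp add: basic_dcochains_def dcochains_def alt_forms_zero depends_upto_def cochains_def)

lemma j_map_basic:
  assumes f: "f \<in> cochains G p" shows "j_map G \<rho> f \<in> basic_dcochains G \<rho> K p 0"
proof -
  have "(\<lambda>g. \<rho> (inv (g (p + 1))) (f g)) \<in> cochains G (p + 1)"
    by (rule rho_cochains[OF smap_inv[OF smap_proj] cochains_weaken[OF f]]) simp_all
  then have "smooth_fun G (p + 1) (\<lambda>g. j_map G \<rho> f (g, g (p + 1)) \<xi>)" for \<xi>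
    by (simp add: cochains_def j_map_def)
  moreover have "j_map G \<rho> f y \<in> alt_forms 0" for y
    by (cases y) (simp add: j_map_def alt_forms_def depends_upto_def)
  moreover have "depends_upto p (\<lambda>g. j_map G \<rho> f (g, x))" for x
    unfolding j_map_def prod.case using depends_upto_comp1[OF cochains_depends[OF f], of "\<lambda>v _. \<rho> (inv x) v"] .
  moreover have "\<rho> a (j_map G \<rho> f (g, x \<otimes> a) (\<lambda>i. Ad G (inv a) (\<xi> i))) = j_map G \<rho> f (g, x) \<xi>" for a g x \<xi>
    by (simp add: j_map_def inv_mult_group rho_mult)
  ultimately show ?thesis unfolding basic_dcochains_def dcochains_def by simp
qed

text \<open>Needed because the inverse in \<open>VE\<close> is formed inside
  \<open>total_basic\<close>. Invariance is naturality for label \<open>Suc i\<close>, under which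
  the averaged function is fixed.\<close>

lemma psi_basic:
  assumes f: "f \<in> cochains G p" and i: "Suc i \<le> p"
  shows "psi p f (Suc i) \<in> basic_dcochains G \<rho> K i (p - i)"
proof -
  let ?j = "Suc i"
  let ?F = "Av_from p ?j f"
  have F: "?F \<in> cochains G p" by (rule Av_from_cochains[OF f]) (use i in simp)
  have W: "(\<lambda>g. d_from p ?j ?F g \<theta>) \<in> cochains G p" for \<theta> by (rule d_from_cochains[OF F order_refl]) (use i in simp)
  have dW: "d_from p ?j ?F g = d_from p ?j ?F h" if "\<And>l. 1 \<le> l \<Longrightarrow> l \<le> p \<Longrightarrow> g l = h l" for g h
    by (rule ext) (rule depends_uptoD[OF cochains_depends[OF W] that])
  have alt: "d_from p ?j ?F g \<in> alt_forms (p - i)" for g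
    using d_from_alt[OF F order_refl, of ?j g] i by simp
  have "psi p f ?j y \<in> alt_forms (p - i)" for y
    by (cases y) (simp only: psi_def prod.case alt)
  moreover have "depends_upto i (\<lambda>g. psi p f ?j (g, x))" for x
  proof (rule depends_uptoI)
    fix g h :: "nat \<Rightarrow> 'g" assume gh: "\<And>l. 1 \<le> l \<Longrightarrow> l \<le> i \<Longrightarrow> g l = h l"
    have "trunc ?j (g(?j := x)) = trunc ?j (h(?j := x))" by (auto simp: trunc_def fun_eq_iff gh le_Suc_eq)
    then show "psi p f ?j (g, x) = psi p f ?j (h, x)" by (simp only: psi_def prod.case)
  qed
  moreover have "smooth_fun G (i + 1) (\<lambda>g. psi p f ?j (g, g (i + 1)) \<xi>)" for \<xi>
  proof -
    have "(\<lambda>g. d_from p ?j ?F (trunc ?j g) \<xi>) \<in> cochains G ?j"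
    proof (rule cochains_composeI[OF W])
      show "smap ?j (\<lambda>g. trunc ?j g l)" for l
        unfolding trunc_def by (intro smap_if smap_const smap_proj) simp_all
    qed
    then show ?thesis by (simp add: cochains_def psi_def)
  qed
  moreover have "psi p f ?j y \<xi> = 0" if "\<xi> 1 \<in> lie_subalgebra G K" for y \<xi>
  proof -
    obtain g x where y: "y = (g, x)" by (cases y)
    have "psi p f ?j y \<xi> = d_from p ?j ?F (trunc ?j (g(?j := x))) (prepend (\<xi> 1) (\<lambda>k. \<xi> (Suc k)))"
      unfolding psi_def y prod.case by (rule prepend_tail[OF alt_formsD(1)[OF alt]])
    also have "\<dots> = 0"
      by (rule d_from_horizontal[OF F order_refl that i]) (rule conj_act_Av_from[OF f]; use i in simp)
    finally show ?thesis .
  qed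
  moreover have "\<rho> a (psi p f ?j (g, x \<otimes> a) (\<lambda>k. Ad G (inv a) (\<xi> k))) = psi p f ?j (g, x) \<xi>" if a: "a \<in> K" for a g x \<xi>
  proof -
    have "d_from p ?j (conj_act G \<rho> p ?j a ?F) (trunc ?j (g(?j := x))) \<xi>
      = \<rho> a (d_from p ?j ?F (conj_point p ?j a (trunc ?j (g(?j := x)))) (\<lambda>k. Ad G (inv a) (\<xi> k)))"
      by (rule d_from_natural[OF F order_refl i]) (use i in simp_all)
    moreover have "conj_act G \<rho> p ?j a ?F = ?F" by (rule conj_act_Av_from[OF f a]) (use i in simp_all)
    moreover have "conj_point p ?j a (trunc ?j (g(?j := x))) = trunc ?j (g(?j := x \<otimes> a))" by (rule trunc_conj_point) simp
    ultimately show ?thesis unfolding psi_def prod.case by (simp only:)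
  qed
  ultimately show ?thesis unfolding basic_dcochains_def dcochains_def by blast
qed

lemma Psi_total_basic:
  assumes f: "f \<in> cochains G p" shows "Psi p f \<in> total_basic G \<rho> K"
proof -
  have "Psi p f i q \<in> basic_dcochains G \<rho> K i q" for i q
  proof -
    consider "i + q \<noteq> p" | "i = p" "q = 0" | "i + q = p" "q > 0" by fastforce
    then show ?thesis
    proof cases
      case 3
      then show ?thesis using psi_basic[OF f, of i] by (auto simp: Psi_def)
    qed (simp_all add: Psi_def zero_basic j_map_basic[OF f])
  qed
  moreover have "finite {(i, q). Psi p f i q \<noteq> (\<lambda>y \<xi>. 0)}"
    by (rule finite_subset[of _ "{..p} \<times> {..p}"]) (auto simp: Psi_def split: if_splits)
  ultimately show ?thesis unfolding total_basic_def by simp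
qed

text \<open>For \<open>q > 0\<close> each nonzero component of \<open>Psi\<close> is cancelled by
  \<open>dh\<close> of its predecessor; for \<open>q = 0\<close> the operator \<open>dh\<close>
  contributes nothing and \<open>j f\<close> remains.\<close>

lemma one_plus_dh_Psi:
  assumes f: "f \<in> cochains G p" shows "one_plus_dh G \<rho> \<mu> (Psi p f) = j_total G \<rho> p f"
proof (intro ext)
  fix i q y \<xi>
  show "one_plus_dh G \<rho> \<mu> (Psi p f) i q y \<xi> = j_total G \<rho> p f i q y \<xi>"
  proof (cases q)
    case 0
    then show ?thesis by (simp add: one_plus_dh_def dh_def Psi_def j_total_def)
  next
    case (Suc r)
    show ?thesis
    proof (cases "i + q = p")
      case True
      then have i: "Suc i \<le> p" "r = p - Suc i" using Suc by auto
      moreover have "Psi p f i q = psi p f (Suc i)" using True Suc by (simp add: Psi_def)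
      ultimately show ?thesis using vert_diff_h_Psi[OF f i(1), of y \<xi>] Suc
        by (simp add: one_plus_dh_def dh_def j_total_def)
    next
      case False
      then have "Psi p f (Suc i) r = (\<lambda>_ _. 0)" "Psi p f i q = (\<lambda>_ _. 0)" using Suc by (auto simp: Psi_def)
      moreover have "h_map G \<mu> (Suc i) (\<lambda>_ _. 0 :: 'v) = (\<lambda>_ _. 0 :: 'v)"
        unfolding h_map_def by (intro ext) (simp split: prod.split)
      ultimately show ?thesis using Suc by (simp add: one_plus_dh_def dh_def vert_diff_zero j_total_def)
    qed
  qed
qed

lemma d_all_Av: "d_all G \<rho> p (Av G \<rho> \<mu> p f) = d_from p 1 (Av_from p 0 f)"
  by (simp add: d_all_def Av_def d_from_def Av_from_def)

lemma van_Est_formula: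
  assumes f: "f \<in> cochains G p"
  shows "VE G \<rho> K \<mu> p f = homogeneous p (d_all G \<rho> p (Av G \<rho> \<mu> p f) (\<lambda>_. \<one>))"
proof -
  have "the_inv_into (total_basic G \<rho> K) (one_plus_dh G \<rho> \<mu>) (j_total G \<rho> p f) = Psi p f"
    by (rule the_inv_into_f_eq[OF inj_one_plus_dh one_plus_dh_Psi[OF f] Psi_total_basic[OF f]])
  then have VE: "VE G \<rho> K \<mu> p f = p_map G \<mu> (Psi p f)" by (simp add: VE_def)
  have "p_map G \<mu> (Psi p f) q \<xi> = homogeneous p (d_from p 1 (Av_from p 0 f) (\<lambda>_. \<one>)) q \<xi>" for q \<xi>
  proof (cases "q = p")
    case False
    then show ?thesis by (simp add: p_map_def homogeneous_def Psi_def)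
  next
    case True
    \<comment> \<open>The integrand of \<open>p_map\<close> is brought into the form of
      \<open>Psi_integral\<close> with \<open>j = 0\<close> and neutral \<open>x\<close> by a change
      in entry 0 alone.\<close>
    have "Psi p f 0 p (\<lambda>_. \<one>, k) \<xi> = Psi p f 0 (p - 0) ((\<lambda>_. \<one>)(0 := \<one> \<otimes> inv k), k) \<xi>" for k
    proof (cases "p = 0")
      case True
      have "f (\<lambda>_. \<one>) = f ((\<lambda>_. \<one>)(0 := \<one> \<otimes> inv k))"
        by (rule depends_uptoD[OF cochains_depends[OF f]]) (simp add: True)
      then show ?thesis using True by (simp add: Psi_def j_map_def)
    next
      case False
      have "trunc (Suc 0) ((\<lambda>_. \<one>)(Suc 0 := k)) = trunc (Suc 0) ((\<lambda>_. \<one>)(0 := \<one> \<otimes> inv k, Suc 0 := k))"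
        by (auto simp: trunc_def fun_eq_iff)
      then show ?thesis using False by (simp add: Psi_def psi_def)
    qed
    then have "p_map G \<mu> (Psi p f) p \<xi> = (\<integral>k. Psi p f 0 (p - 0) ((\<lambda>_. \<one>)(0 := \<one> \<otimes> inv k), k) \<xi> \<partial>\<mu>)"
      by (simp only: p_map_def)
    also have "\<dots> = d_from p (Suc 0) (Av_from p 0 f) (trunc 0 ((\<lambda>_. \<one>)(0 := \<one>))) \<xi>"
      by (rule Psi_integral[OF f]) simp
    also have "trunc 0 ((\<lambda>_. \<one>)(0 := \<one>)) = (\<lambda>_. \<one>)" by (auto simp: trunc_def)
    finally show ?thesis using True by (simp add: homogeneous_def)
  qed
  then show ?thesis unfolding VE d_all_Av by blast
qed

lemma d_all_Av_basic:
  assumes f: "f \<in> cochains G p"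
  shows "d_all G \<rho> p (Av G \<rho> \<mu> p f) (\<lambda>_. \<one>) \<in> basic_forms G \<rho> K p"
proof -
  let ?F = "Av_from p 0 f"
  have F: "?F \<in> cochains G p" by (rule Av_from_cochains[OF f]) simp
  have alt: "d_from p 1 ?F (\<lambda>_. \<one>) \<in> alt_forms p"
    using d_from_alt[OF F order_refl, of 1] by simp
  have "d_from p 1 ?F (\<lambda>_. \<one>) \<xi> = 0" if "p > 0" "\<xi> 1 \<in> lie_subalgebra G K" for \<xi>
  proof -
    have "d_from p 1 ?F (\<lambda>_. \<one>) \<xi> = d_from p 1 ?F (\<lambda>_. \<one>) (prepend (\<xi> 1) (\<lambda>k. \<xi> (Suc k)))"
      by (rule prepend_tail[OF alt_formsD(1)[OF alt]])
    also have "\<dots> = 0"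
      by (rule d_from_horizontal[OF F order_refl that(2)]) (use that(1) conj_act_Av_from[OF f] in simp_all)
    finally show ?thesis .
  qed
  moreover have "\<rho> a (d_from p 1 ?F (\<lambda>_. \<one>) (\<lambda>i. Ad G (inv a) (\<xi> i))) = d_from p 1 ?F (\<lambda>_. \<one>) \<xi>" if a: "a \<in> K" for a \<xi>
  proof -
    have "d_from p 1 (conj_act G \<rho> p 0 a ?F) (\<lambda>_. \<one>) \<xi> = \<rho> a (d_from p 1 ?F (conj_point p 0 a (\<lambda>_. \<one>)) (\<lambda>i. Ad G (inv a) (\<xi> i)))"
      by (rule d_from_natural[OF F order_refl]) simp_all
    moreover have "conj_act G \<rho> p 0 a ?F = ?F" by (rule conj_act_Av_from[OF f a]) simp_all
    \<comment> \<open>Label 0 conjugates all entries, so it fixes the neutral point except in entry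
      0.\<close>
    moreover have "d_from p 1 ?F (conj_point p 0 a (\<lambda>_. \<one>)) \<theta> = d_from p 1 ?F (\<lambda>_. \<one>) \<theta>" for \<theta>
      by (rule depends_uptoD[OF cochains_depends[OF d_from_cochains[OF F order_refl]]]) (auto simp: conj_point_def)
    ultimately show ?thesis by (simp only:)
  qed
  ultimately show ?thesis unfolding d_all_Av basic_forms_def using alt by simp
qed

lemma Av_trivial:
  assumes K: "K = {\<one>}" and f: "f \<in> cochains G p"
  shows "Av G \<rho> \<mu> p f = f"
proof -
  interpret prob_space \<mu> by (rule prob)
  have "m \<le> Suc p \<Longrightarrow> Av_from p m f = f" for m
  proof (induction m rule: inc_induct)
    case (step m)
    then have m: "m \<le> p" by simp
    have "Av_i G \<rho> \<mu> p m f g = f g" for g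
    proof -
      have "Av_i G \<rho> \<mu> p m f g = (\<integral>k. f g \<partial>\<mu>)" unfolding Av_i_def
      proof (rule integral_cong_K)
        fix k assume "k \<in> K"
        then have k: "k = \<one>" using K by simp
        have "avg_point p m \<one> g = g" by (auto simp: avg_point_def fun_eq_iff)
        then show "avg_act G \<rho> p m k f g = f g" unfolding k avg_act_avg_point[OF f m] by (cases "m = p") simp_all
      qed
      then show ?thesis by (simp add: prob_space)
    qed
    then show ?case unfolding Av_from_step[OF m] using step.IH by auto
  qed (simp add: Av_from_Suc)
  then have "Av_from p 0 f = f" by simp
  then show ?thesis by (simp only: Av_from_def Av_def)
qed

lemma Av_cochains: "f \<in> cochains G p \<Longrightarrow> Av G \<rho> \<mu> p f \<in> cochains G p"
  using Av_from_cochains[of f p 0] by (simp add: Av_def Av_from_def)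

end

theorem theorem3p2:
  fixes G :: "('g::{t2_space, second_countable_topology}, 'e::real_normed_vector) charted_group"
    and \<rho> :: "'g \<Rightarrow> 'v::{banach, second_countable_topology} \<Rightarrow> 'v"
    and K :: "'g set" and \<mu> \<mu>\<^sub>1 :: "'g measure"
    and p :: nat and f :: "(nat \<Rightarrow> 'g) \<Rightarrow> 'v"
  assumes "lie_group G"
    and "smooth_rep G \<rho>"
    and "lie_subgroup K G" and "compact K"
    and "normalized_haar G K \<mu>"
    and "normalized_haar G {\<one>\<^bsub>G\<^esub>} \<mu>\<^sub>1"
    and "f \<in> cochains G p"
  shows "VE G \<rho> K \<mu> p f = homogeneous p (d_all G \<rho> p (Av G \<rho> \<mu> p f) (\<lambda>_. \<one>\<^bsub>G\<^esub>))
     \<and> d_all G \<rho> p (Av G \<rho> \<mu> p f) (\<lambda>_. \<one>\<^bsub>G\<^esub>) \<in> basic_forms G \<rho> K p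
     \<and> VE G \<rho> K \<mu> p f = VE G \<rho> {\<one>\<^bsub>G\<^esub>} \<mu>\<^sub>1 p (Av G \<rho> \<mu> p f)"
proof -
  have lr: "lie_rep G \<rho>" by unfold_locales (rule assms(1,2))+
  interpret lie_rep G \<rho> by (rule lr)
  interpret H: lie_haar G \<rho> K \<mu>
    by (rule lie_haar.intro[OF lr lie_haar_axioms.intro])
      (use assms in \<open>simp_all add: lie_subgroup_def\<close>)
  interpret T: lie_haar G \<rho> "{\<one>\<^bsub>G\<^esub>}" \<mu>\<^sub>1
    by (rule lie_haar.intro[OF lr lie_haar_axioms.intro]) (use assms triv_subgroup in simp_all)
  have A: "Av G \<rho> \<mu> p f \<in> cochains G p" by (rule H.Av_cochains[OF assms(7)])
  \<comment> \<open>Both van Est maps equal the same differential of \<open>Av f\<close> at the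
    neutral point: the formula for the trivial subgroup is applied to \<open>Av f\<close>, which
    averaging over a single point leaves as it is.\<close>
  show ?thesis
    using H.van_Est_formula[OF assms(7)] H.d_all_Av_basic[OF assms(7)]
      T.van_Est_formula[OF A] T.Av_trivial[OF refl A] by simp
qed

end
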